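(* The homeomorphism group $\mathrm{Homeo}(E)$ of a uniquely self-similar second-countable Stone space $E$ is coarsely bounded.
   Context: A Stone space is a compact zero-dimensional Hausdorff space. $\mathrm{Homeo}(E)$ carries the compact-open topology. A 2-manifold is a connected second-countable Hausdorff space in which every point has an open neighborhood homeomorphic to $\mathbb{R}^2$; it is planar if it is homeomorphic to an open subset of $\mathbb{R}^2$. A subset $K$ of a 2-manifold $M$ is displaceable if there is a homeomorphism $f\colon M\to M$ with $f(K)\cap K=\varnothing$. $M$ is self-similar if every proper compact subset of $M$ is displaceable and, for every separating simple closed curve $c$ in $M$, some component of $M\smallsetminus c$ is homeomorphic to $M$ with a point removed; a self-similar $M$ is perfectly self-similar if $M\# M$ is homeomorphic to $M$, and uniquely self-similar otherwise. A second-countable Stone space is uniquely self-similar if it is homeomorphic to the space of ends of a planar uniquely self-similar 2-manifold. A topological group $G$ is coarsely bounded if, whenever $G$ acts continuously by isometries on a metric space, every $G$-orbit is bounded. *)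

theory Defs
  imports "HOL-Analysis.Analysis" "HOL-Algebra.Group_Action"
begin

section \<open>Topological groups and coarse boundedness\<close>

definition topological_group :: "('a, 'b) monoid_scheme \<Rightarrow> 'a topology \<Rightarrow> bool" where
  "topological_group G T \<longleftrightarrow>
     group G \<and> topspace T = carrier G \<and>
     continuous_map (prod_topology T T) T (\<lambda>(g, h). g \<otimes>\<^bsub>G\<^esub> h) \<and>
     continuous_map T T (\<lambda>g. inv\<^bsub>G\<^esub> g)"

definition continuous_isometric_action ::
    "('a, 'b) monoid_scheme \<Rightarrow> 'a topology \<Rightarrow> 'x metric \<Rightarrow> ('a \<Rightarrow> 'x \<Rightarrow> 'x) \<Rightarrow> bool" where
  "continuous_isometric_action G T X \<phi> \<longleftrightarrow>
     group_action G (mspace X) \<phi> \<and>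
     (\<forall>g\<in>carrier G. \<forall>x\<in>mspace X. \<forall>y\<in>mspace X. mdist X (\<phi> g x) (\<phi> g y) = mdist X x y) \<and>
     continuous_map (prod_topology T (mtopology_of X)) (mtopology_of X) (\<lambda>(g, x). \<phi> g x)"

text \<open>
  Definitions cannot quantify over types, so the type of points of the metric spaces is passed as
  a parameter. A theorem concluding \<open>coarsely_bounded TYPE('x) G T\<close> with \<open>'x\<close> a free type variable
  speaks about all metric spaces.
\<close>

definition coarsely_bounded ::
    "'x itself \<Rightarrow> ('a, 'b) monoid_scheme \<Rightarrow> 'a topology \<Rightarrow> bool" where
  "coarsely_bounded _ G T \<longleftrightarrow>
     topological_group G T \<and>
     (\<forall>(X :: 'x metric) \<phi>. continuous_isometric_action G T X \<phi> \<longrightarrow>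
        (\<forall>x\<in>mspace X. Metric_space.mbounded (mspace X) (mdist X) (orbit G \<phi> x)))"


section \<open>Homeomorphism groups\<close>

text \<open>
  As in \<^const>\<open>BijGroup\<close>, homeomorphisms are extensional functions, so that equality in the group
  is equality on the space.
\<close>

definition homeo_group :: "'a topology \<Rightarrow> ('a \<Rightarrow> 'a) monoid" where
  "homeo_group E =
     (BijGroup (topspace E)) \<lparr>carrier := {f \<in> Bij (topspace E). homeomorphic_map E E f}\<rparr>"

definition compact_open_topology :: "'a topology \<Rightarrow> ('a \<Rightarrow> 'a) topology" where
  "compact_open_topology E = topology_generated_by
     {{f \<in> carrier (homeo_group E). f ` K \<subseteq> U} | K U. compactin E K \<and> openin E U}"


section \<open>Two-manifolds\<close>

definition two_manifold :: "'m topology \<Rightarrow> bool" where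
  "two_manifold M \<longleftrightarrow>
     connected_space M \<and> second_countable M \<and> Hausdorff_space M \<and>
     (\<forall>x\<in>topspace M. \<exists>U. openin M U \<and> x \<in> U \<and>
        subtopology M U homeomorphic_space (euclidean :: (real^2) topology))"

definition planar :: "'m topology \<Rightarrow> bool" where
  "planar M \<longleftrightarrow> (\<exists>U :: (real^2) set. open U \<and> M homeomorphic_space top_of_set U)"

definition displaceable :: "'m topology \<Rightarrow> 'm set \<Rightarrow> bool" where
  "displaceable M K \<longleftrightarrow> (\<exists>f. homeomorphic_map M M f \<and> f ` K \<inter> K = {})"

definition simple_closed_curve :: "'m topology \<Rightarrow> 'm set \<Rightarrow> bool" where
  "simple_closed_curve M c \<longleftrightarrow>
     (\<exists>\<gamma>. embedding_map (top_of_set (sphere (0 :: real^2) 1)) M \<gamma> \<and> c = \<gamma> ` sphere 0 1)"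

definition separating :: "'m topology \<Rightarrow> 'm set \<Rightarrow> bool" where
  "separating M c \<longleftrightarrow> \<not> connected_space (subtopology M (topspace M - c))"

definition self_similar :: "'m topology \<Rightarrow> bool" where
  "self_similar M \<longleftrightarrow>
     two_manifold M \<and>
     (\<forall>K. compactin M K \<and> K \<noteq> topspace M \<longrightarrow> displaceable M K) \<and>
     (\<forall>c. simple_closed_curve M c \<and> separating M c \<longrightarrow>
        (\<exists>C \<in> connected_components_of (subtopology M (topspace M - c)). \<exists>p \<in> topspace M.
           subtopology M C homeomorphic_space subtopology M (topspace M - {p})))"


subsection \<open>Connected sums\<close>

definition quotient_topology :: "'a topology \<Rightarrow> ('a \<times> 'a) set \<Rightarrow> 'a set topology" where
  "quotient_topology X r = topology (\<lambda>\<U>. \<U> \<subseteq> topspace X // r \<and> openin X (\<Union>\<U>))"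

lemma openin_quotient_topology:
  assumes r: "equiv (topspace X) r"
  shows "openin (quotient_topology X r) \<U> \<longleftrightarrow> \<U> \<subseteq> topspace X // r \<and> openin X (\<Union>\<U>)"
proof -
  have "\<Union>(\<U> \<inter> \<V>) = \<Union>\<U> \<inter> \<Union>\<V>" if "\<U> \<subseteq> topspace X // r" "\<V> \<subseteq> topspace X // r" for \<U> \<V>
    using that quotient_disj [OF r] by blast
  then have "istopology (\<lambda>\<U>. \<U> \<subseteq> topspace X // r \<and> openin X (\<Union>\<U>))"
    unfolding istopology_def
  proof (intro conjI allI impI, goal_cases)
    case (4 \<K>)
    have "openin X (\<Union>\<U>\<in>\<K>. \<Union>\<U>)" using 4 by (intro openin_Union) auto
    moreover have "\<Union>(\<Union>\<K>) = (\<Union>\<U>\<in>\<K>. \<Union>\<U>)" by blast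
    ultimately show ?case by simp
  qed auto
  then show ?thesis
    by (simp add: quotient_topology_def)
qed

lemma quotient_map_quotient_topology:
  assumes r: "equiv (topspace X) r"
  shows "quotient_map X (quotient_topology X r) (\<lambda>x. r `` {x})"
proof -
  have top: "topspace (quotient_topology X r) = topspace X // r"
  proof
    show "topspace (quotient_topology X r) \<subseteq> topspace X // r"
      using openin_quotient_topology [OF r] openin_topspace by blast
    have "openin (quotient_topology X r) (topspace X // r)"
      by (simp add: openin_quotient_topology [OF r] Union_quotient [OF r])
    then show "topspace X // r \<subseteq> topspace (quotient_topology X r)"
      by (rule openin_subset)
  qed
  have "{x \<in> topspace X. r `` {x} \<in> \<U>} = \<Union>\<U>" if \<U>: "\<U> \<subseteq> topspace X // r" for \<U>
  proof (intro equalityI subsetI)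
    fix x assume "x \<in> {x \<in> topspace X. r `` {x} \<in> \<U>}"
    then show "x \<in> \<Union>\<U>" using equiv_class_self [OF r] by blast
  next
    fix x assume "x \<in> \<Union>\<U>"
    then obtain A where A: "A \<in> \<U>" "x \<in> A" by blast
    then have "A \<in> topspace X // r" using \<U> by blast
    then obtain y where y: "y \<in> topspace X" "A = r `` {y}" by (rule quotientE)
    then have "(y, x) \<in> r" using A by simp
    then show "x \<in> {x \<in> topspace X. r `` {x} \<in> \<U>}"
      using A y equiv_class_eq [OF r] equiv_type [OF r] by fastforce
  qed
  then show ?thesis
    unfolding quotient_map_def top
    by (auto simp: openin_quotient_topology [OF r] quotient_def)
qed

definition embedded_disc :: "'m topology \<Rightarrow> (real^2 \<Rightarrow> 'm) \<Rightarrow> bool" where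
  "embedded_disc M d \<longleftrightarrow> embedding_map (top_of_set (cball 0 1)) M d"

text \<open>
  The connected sum of \<open>M\<close> and \<open>N\<close> along embedded closed discs \<open>d\<close> and \<open>e\<close>: remove the interiors
  of both discs, take the disjoint union (\<open>False\<close> tags points of \<open>M\<close>, \<open>True\<close> points of \<open>N\<close>) and
  identify \<open>d z\<close> with \<open>e z\<close> for all \<open>z\<close> on the unit circle. Any other homeomorphism between the
  boundary circles arises from this one by reparametrizing \<open>e\<close>.
\<close>

definition connected_sum_pieces ::
    "'m topology \<Rightarrow> 'm topology \<Rightarrow> (real^2 \<Rightarrow> 'm) \<Rightarrow> (real^2 \<Rightarrow> 'm) \<Rightarrow> (bool \<times> 'm) topology" where
  "connected_sum_pieces M N d e =
     sum_topology (\<lambda>b. if b then subtopology N (topspace N - e ` ball 0 1)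
                       else subtopology M (topspace M - d ` ball 0 1)) UNIV"

definition connected_sum_gluing ::
    "'m topology \<Rightarrow> 'm topology \<Rightarrow> (real^2 \<Rightarrow> 'm) \<Rightarrow> (real^2 \<Rightarrow> 'm) \<Rightarrow>
     ((bool \<times> 'm) \<times> (bool \<times> 'm)) set" where
  "connected_sum_gluing M N d e =
     Id_on (topspace (connected_sum_pieces M N d e)) \<union>
     {((False, d z), (True, e z)) | z. z \<in> sphere 0 1} \<union>
     {((True, e z), (False, d z)) | z. z \<in> sphere 0 1}"

definition connected_sum ::
    "'m topology \<Rightarrow> 'm topology \<Rightarrow> (real^2 \<Rightarrow> 'm) \<Rightarrow> (real^2 \<Rightarrow> 'm) \<Rightarrow> (bool \<times> 'm) set topology" where
  "connected_sum M N d e =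
     quotient_topology (connected_sum_pieces M N d e) (connected_sum_gluing M N d e)"

lemma equiv_connected_sum_gluing:
  assumes "embedded_disc M d" "embedded_disc N e"
  shows "equiv (topspace (connected_sum_pieces M N d e)) (connected_sum_gluing M N d e)"
proof -
  have inj: "inj_on d (cball 0 1)" "inj_on e (cball 0 1)"
    and img: "d ` cball 0 1 \<subseteq> topspace M" "e ` cball 0 1 \<subseteq> topspace N"
    using assms unfolding embedded_disc_def embedding_map_def homeomorphic_map_def quotient_map_def
    by auto
  have eq: "d z = d w \<longleftrightarrow> z = w" "e z = e w \<longleftrightarrow> z = w" if "z \<in> cball 0 1" "w \<in> cball 0 1" for z w
    using inj that by (auto dest: inj_onD)
  have d: "d z \<in> topspace M - d ` ball 0 1" if "z \<in> sphere 0 1" for z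
    using that img eq(1) by (fastforce simp: image_iff)
  have e: "e z \<in> topspace N - e ` ball 0 1" if "z \<in> sphere 0 1" for z
    using that img eq(2) by (fastforce simp: image_iff)
  have top: "topspace (connected_sum_pieces M N d e) =
      {False} \<times> (topspace M - d ` ball 0 1) \<union> {True} \<times> (topspace N - e ` ball 0 1)"
    unfolding connected_sum_pieces_def
    by (simp add: Sigma_def UNIV_bool) blast
  show ?thesis
  proof (rule equivI)
    show "connected_sum_gluing M N d e
        \<subseteq> topspace (connected_sum_pieces M N d e) \<times> topspace (connected_sum_pieces M N d e)"
      using d e unfolding connected_sum_gluing_def top by blast
    show "refl_on (topspace (connected_sum_pieces M N d e)) (connected_sum_gluing M N d e)"
      unfolding refl_on_def connected_sum_gluing_def by blast
    show "sym (connected_sum_gluing M N d e)"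
      unfolding connected_sum_gluing_def by (rule symI) blast
    have "z = w" if "z \<in> sphere 0 1" "w \<in> sphere 0 1" "d z = d w \<or> e z = e w" for z w
      using that eq sphere_cball by blast
    moreover have "(False, d z) \<in> topspace (connected_sum_pieces M N d e)"
      "(True, e z) \<in> topspace (connected_sum_pieces M N d e)" if "z \<in> sphere 0 1" for z
      using d [OF that] e [OF that] unfolding top by auto
    ultimately show "trans (connected_sum_gluing M N d e)"
      unfolding connected_sum_gluing_def by (intro transI) (auto simp: Id_on_def)
  qed
qed

text \<open>
  The connected sum of connected 2-manifolds is independent of the discs up to homeomorphism,
  so the choice of discs below is immaterial.
\<close>

definition self_sum_homeomorphic :: "'m topology \<Rightarrow> bool" where
  "self_sum_homeomorphic M \<longleftrightarrow>
     (\<exists>d e. embedded_disc M d \<and> embedded_disc M e \<and> connected_sum M M d e homeomorphic_space M)"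

definition perfectly_self_similar :: "'m topology \<Rightarrow> bool" where
  "perfectly_self_similar M \<longleftrightarrow> self_similar M \<and> self_sum_homeomorphic M"

definition uniquely_self_similar :: "'m topology \<Rightarrow> bool" where
  "uniquely_self_similar M \<longleftrightarrow> self_similar M \<and> \<not> perfectly_self_similar M"


subsection \<open>Spaces of ends\<close>

text \<open>
  The (Freudenthal) space of ends is the inverse limit, over the compact subsets \<open>K\<close> of \<open>M\<close> ordered
  by inclusion, of the discrete sets of components of \<open>M - K\<close>. For \<open>K \<subseteq> L\<close> the bonding map sends
  a component of \<open>M - L\<close> to the component of \<open>M - K\<close> containing it.
\<close>

definition ends_space :: "'m topology \<Rightarrow> ('m set \<Rightarrow> 'm set) topology" where
  "ends_space M =
     subtopology
       (product_topology
          (\<lambda>K. discrete_topology (connected_components_of (subtopology M (topspace M - K))))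
          {K. compactin M K})
       {\<epsilon>. \<forall>K L. compactin M K \<and> compactin M L \<and> K \<subseteq> L \<longrightarrow> \<epsilon> L \<subseteq> \<epsilon> K}"


section \<open>Stone spaces\<close>

text \<open>
  Zero-dimensionality is \<^term>\<open>E dim_le 0\<close>: the clopen sets form a base
  (see \<open>dimension_le_0_neighbourhood_base_of_clopen\<close>).
\<close>

definition stone_space :: "'a topology \<Rightarrow> bool" where
  "stone_space E \<longleftrightarrow> compact_space E \<and> Hausdorff_space E \<and> E dim_le 0"

text \<open>
  For \<open>E\<close> a second-countable Stone space. The type of points of the manifold is a parameter, for the same reason as in
  \<^const>\<open>coarsely_bounded\<close>. Assuming \<open>uniquely_self_similar_stone TYPE('m) E\<close> with \<open>'m\<close> a free type
  variable covers manifolds on any type.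
\<close>

definition uniquely_self_similar_stone :: "'m itself \<Rightarrow> 'a topology \<Rightarrow> bool" where
  "uniquely_self_similar_stone _ E \<longleftrightarrow>
     (\<exists>M :: 'm topology. planar M \<and> uniquely_self_similar M \<and> E homeomorphic_space ends_space M)"

end

theory Submission
  imports Defs "HOL-Complex_Analysis.Riemann_Mapping"
begin

text \<open>
  Write \<open>E\<close> for the space of ends of the planar self-similar manifold \<open>M\<close>, an open connected subset of
  the plane. Let \<open>K\<close> be a compact connected subset of \<open>M\<close> and \<open>W\<close> a component of its complement in the
  sphere. Then \<open>W\<close> is simply connected, so by the Riemann mapping theorem it is a disc, and a large
  concentric circle in this disc is a simple closed curve in \<open>M\<close> separating the ends in \<open>W\<close> from the other
  ends. One of its sides is homeomorphic to \<open>M\<close> with a point removed; cancelling the isolated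
  ends at the curve and at the point shows that the ends on that side form a copy of \<open>E\<close>.
  Displacing \<open>K\<close> then shows that for every partition of \<open>E\<close> into two clopen sets, one of them contains
  a clopen copy of \<open>E\<close>. This dichotomy alone implies, by an argument of Mann and Rafi, that every
  homeomorphism of \<open>E\<close> is a product of boundedly many elements of a given neighbourhood of the identity
  and of a finite set.
\<close>

section \<open>Clopen sets and homeomorphism groups\<close>

text \<open>Two obstacles shape the proof. The curve axiom makes one side of a circle homeomorphic
  to the punctured manifold, but it tells neither which side this is nor where the homeomorphism
  sends the end at the circle. The first point is met by displacement: \<open>K\<close> is chosen to
  contain the frontier of a set representing the partition, so that the ends in one component of the
  complement of \<open>K\<close> all lie in the same part, and a copy lying outside a component can
  be pushed into a single component by moving \<open>K\<close> off itself. The second is met by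
  Stone duality for the algebra of sets with compact frontier: it passes to open subsets, and it
  sees the end at the circle as one additional truth value. The group-theoretic half rests on a
  consequence of the dichotomy: when a clopen set containing a copy of \<open>E\<close> is cut in
  two, one piece still contains a copy. Hence every neighbourhood of the identity contains all
  homeomorphisms supported in some clopen \<open>A\<close> that contains a copy. The complement of
  \<open>A\<close> embeds in \<open>A\<close> twice disjointly, and this room makes the bounded
  factorization possible.\<close>

definition clopenin :: "'a topology \<Rightarrow> 'a set \<Rightarrow> bool" where
  "clopenin X S \<longleftrightarrow> openin X S \<and> closedin X S"

lemma clopenin_subset: "clopenin X S \<Longrightarrow> S \<subseteq> topspace X"
  by (simp add: clopenin_def openin_subset)

lemma clopenin_topspace [simp]: "clopenin X (topspace X)"
  by (simp add: clopenin_def)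

lemma clopenin_empty [simp]: "clopenin X {}"
  by (simp add: clopenin_def)

lemma clopenin_Int: "clopenin X S \<Longrightarrow> clopenin X T \<Longrightarrow> clopenin X (S \<inter> T)"
  by (simp add: clopenin_def openin_Int closedin_Int)

lemma clopenin_Diff: "clopenin X S \<Longrightarrow> clopenin X T \<Longrightarrow> clopenin X (S - T)"
  by (simp add: clopenin_def openin_diff closedin_diff)

lemma clopenin_compl: "clopenin X S \<Longrightarrow> clopenin X (topspace X - S)"
  by (simp add: clopenin_Diff)

text \<open>Domain and image are clopen in \<open>E\<close>, so openness in these subspaces is
  openness in \<open>E\<close>; restriction, composition and gluing then need no
  subtopologies.\<close>

definition clopen_embedding :: "'a topology \<Rightarrow> 'a set \<Rightarrow> ('a \<Rightarrow> 'a) \<Rightarrow> bool" where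
  "clopen_embedding E X a \<longleftrightarrow> clopenin E X \<and> clopenin E (a ` X) \<and> inj_on a X \<and>
     (\<forall>Y\<subseteq>X. openin E (a ` Y) \<longleftrightarrow> openin E Y)"

lemma clopen_embedding_clopenin:
  assumes a: "clopen_embedding E X a" and Y: "clopenin E Y" "Y \<subseteq> X"
  shows "clopenin E (a ` Y)"
proof -
  have "a ` Y = a ` X - a ` (X - Y)"
    using a Y(2) unfolding clopen_embedding_def inj_on_def by blast
  moreover have "clopenin E (X - Y)"
    using a Y unfolding clopen_embedding_def by (blast intro: clopenin_Diff)
  ultimately show ?thesis
    using a Y unfolding clopen_embedding_def clopenin_def by (auto intro: closedin_diff)
qed

lemma clopen_embedding_subset:
  assumes a: "clopen_embedding E X a" and Y: "clopenin E Y" "Y \<subseteq> X"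
  shows "clopen_embedding E Y a"
  using clopen_embedding_clopenin [OF assms] assms unfolding clopen_embedding_def
  by (meson inj_on_subset subset_trans)

lemma clopen_embedding_compose:
  assumes a: "clopen_embedding E X a" and b: "clopen_embedding E Y b" and "a ` X \<subseteq> Y"
  shows "clopen_embedding E X (\<lambda>x. b (a x))"
proof -
  have "clopenin E (a ` X)"
    using a by (simp add: clopen_embedding_def)
  then have b': "clopen_embedding E (a ` X) b"
    using clopen_embedding_subset [OF b] assms(3) by simp
  have im: "(\<lambda>x. b (a x)) ` Z = b ` a ` Z" for Z
    by blast
  have "openin E (b ` a ` Z) \<longleftrightarrow> openin E Z" if "Z \<subseteq> X" for Z
  proof -
    have "a ` Z \<subseteq> a ` X" using that by (rule image_mono)
    then show ?thesis
      using that a b' by (simp add: clopen_embedding_def)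
  qed
  moreover have "inj_on (\<lambda>x. b (a x)) X"
    using a b' by (auto simp: clopen_embedding_def inj_on_def)
  ultimately show ?thesis
    using a b' unfolding clopen_embedding_def im by simp
qed

lemma clopen_embedding_id: "clopenin E X \<Longrightarrow> clopen_embedding E X (\<lambda>x. x)"
  by (simp add: clopen_embedding_def)

lemma clopen_embedding_homeomorphic_map:
  assumes h: "homeomorphic_map E (subtopology E Q) h" and Q: "clopenin E Q"
  shows "clopen_embedding E (topspace E) h"
proof -
  have im: "h ` topspace E = Q"
    using homeomorphic_imp_surjective_map [OF h] clopenin_subset [OF Q] by auto
  have inj: "inj_on h (topspace E)"
    using h homeomorphic_imp_injective_map by blast
  have "openin E (h ` Y) \<longleftrightarrow> openin E Y" if Y: "Y \<subseteq> topspace E" for Y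
  proof -
    have "openin E (h ` Y) \<longleftrightarrow> openin (subtopology E Q) (h ` Y)"
      using Q Y im by (auto simp: clopenin_def openin_open_subtopology)
    also have "\<dots> \<longleftrightarrow> openin E Y"
      using homeomorphic_map_openness [OF h Y] .
    finally show ?thesis .
  qed
  then show ?thesis
    using im inj Q by (simp add: clopen_embedding_def)
qed

lemma carrier_homeo_group:
  "f \<in> carrier (homeo_group E) \<longleftrightarrow> f \<in> extensional (topspace E) \<and> homeomorphic_map E E f"
proof -
  have "bij_betw f (topspace E) (topspace E)" if "homeomorphic_map E E f"
    using that homeomorphic_imp_surjective_map homeomorphic_imp_injective_map
    unfolding bij_betw_def by blast
  then show ?thesis
    unfolding homeo_group_def Bij_def by auto
qed

lemma homeo_group_embedding:
  assumes "f \<in> carrier (homeo_group E)"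
  shows "clopen_embedding E (topspace E) f" "f ` topspace E = topspace E"
proof -
  have f: "homeomorphic_map E E f"
    using assms by (simp add: carrier_homeo_group)
  show "f ` topspace E = topspace E"
    using f by (rule homeomorphic_imp_surjective_map)
  show "clopen_embedding E (topspace E) f"
    using f clopen_embedding_homeomorphic_map [of E "topspace E" f] by simp
qed

lemma subgroup_homeo_group:
  "subgroup (carrier (homeo_group E)) (BijGroup (topspace E))"
proof -
  interpret B: group "BijGroup (topspace E)" by (rule group_BijGroup)
  let ?S = "topspace E"
  have mult: "f \<otimes>\<^bsub>BijGroup ?S\<^esub> g = compose ?S f g" if "f \<in> Bij ?S" "g \<in> Bij ?S" for f g
    using that by (simp add: BijGroup_def)
  have C: "f \<in> Bij ?S" if "f \<in> carrier (homeo_group E)" for f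
    using that by (simp add: homeo_group_def)
  show ?thesis
  proof (rule B.subgroupI)
    show "carrier (homeo_group E) \<subseteq> carrier (BijGroup ?S)"
      using C by (auto simp: BijGroup_def)
    have "(\<lambda>x\<in>?S. x) \<in> carrier (homeo_group E)"
      using homeomorphic_map_eq [of E E id "\<lambda>x\<in>?S. x"] by (simp add: carrier_homeo_group)
    then show "carrier (homeo_group E) \<noteq> {}" by blast
    fix f assume f: "f \<in> carrier (homeo_group E)"
    then obtain k where k: "homeomorphic_maps E E f k"
      by (auto simp: carrier_homeo_group homeomorphic_map_maps)
    have inj: "inj_on f ?S" "f ` ?S = ?S"
      using f by (auto simp: carrier_homeo_group homeomorphic_imp_surjective_map homeomorphic_imp_injective_map)
    have "inv_into ?S f y = k y" if "y \<in> ?S" for y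
      using k inj that unfolding homeomorphic_maps_def
      by (metis continuous_map_image_subset_topspace image_subset_iff inv_into_f_f)
    moreover have "homeomorphic_map E E k"
      using k homeomorphic_map_maps homeomorphic_maps_sym by blast
    ultimately have "homeomorphic_map E E (restrict (inv_into ?S f) ?S)"
      by (auto intro: homeomorphic_map_eq)
    then show "inv\<^bsub>BijGroup ?S\<^esub> f \<in> carrier (homeo_group E)"
      using C [OF f] by (simp add: inv_BijGroup carrier_homeo_group)
    fix g assume g: "g \<in> carrier (homeo_group E)"
    have "homeomorphic_map E E (compose ?S f g)"
      using f g homeomorphic_map_compose [of E E g E f]
      by (auto simp: carrier_homeo_group compose_def intro: homeomorphic_map_eq)
    then show "f \<otimes>\<^bsub>BijGroup ?S\<^esub> g \<in> carrier (homeo_group E)"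
      using mult C f g by (simp add: carrier_homeo_group)
  qed
qed

lemma group_homeo_group: "group (homeo_group E)"
proof -
  have "homeo_group E = BijGroup (topspace E) \<lparr>carrier := carrier (homeo_group E)\<rparr>"
    by (simp add: homeo_group_def)
  then show ?thesis
    using subgroup.subgroup_is_group [OF subgroup_homeo_group group_BijGroup] by metis
qed

lemma homeo_group_mult_apply:
  assumes "f \<in> carrier (homeo_group E)" "g \<in> carrier (homeo_group E)" "x \<in> topspace E"
  shows "(f \<otimes>\<^bsub>homeo_group E\<^esub> g) x = f (g x)"
  using assms by (simp add: homeo_group_def BijGroup_def compose_eq)

lemma homeo_group_one_apply:
  "x \<in> topspace E \<Longrightarrow> \<one>\<^bsub>homeo_group E\<^esub> x = x"
  by (simp add: homeo_group_def BijGroup_def)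

lemma homeo_group_inv_apply:
  assumes "f \<in> carrier (homeo_group E)" "x \<in> topspace E"
  shows "(inv\<^bsub>homeo_group E\<^esub> f) (f x) = x" "f ((inv\<^bsub>homeo_group E\<^esub> f) x) = x"
proof -
  interpret group "homeo_group E" by (rule group_homeo_group)
  show "(inv\<^bsub>homeo_group E\<^esub> f) (f x) = x" "f ((inv\<^bsub>homeo_group E\<^esub> f) x) = x"
    using homeo_group_mult_apply [of "inv\<^bsub>homeo_group E\<^esub> f" E f x]
      homeo_group_mult_apply [of f E "inv\<^bsub>homeo_group E\<^esub> f" x] assms
    by (auto simp: l_inv r_inv homeo_group_one_apply)
qed

text \<open>The images of \<open>a\<close> and \<open>b\<close> are clopen and disjoint, so
  exchanging them and fixing the rest glues to a continuous map. It is its own inverse, so one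
  continuity check gives a homeomorphism.\<close>

lemma homeo_group_swap:
  assumes a: "clopen_embedding E Z a" and b: "clopen_embedding E Z b"
    and disj: "a ` Z \<inter> b ` Z = {}"
  obtains s where "s \<in> carrier (homeo_group E)"
    and "\<And>z. z \<in> Z \<Longrightarrow> s (a z) = b z" and "\<And>z. z \<in> Z \<Longrightarrow> s (b z) = a z"
    and "\<And>x. x \<in> topspace E \<Longrightarrow> x \<notin> a ` Z \<Longrightarrow> x \<notin> b ` Z \<Longrightarrow> s x = x"
proof -
  \<comment> \<open>The value \<open>undefined\<close> off the space makes \<open>s\<close>
    extensional, as membership in \<open>homeo_group\<close> requires.\<close>
  define s where "s = (\<lambda>x. if x \<in> a ` Z then b (inv_into Z a x)
    else if x \<in> b ` Z then a (inv_into Z b x) else if x \<in> topspace E then x else undefined)"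
  have inj: "inj_on a Z" "inj_on b Z"
    using a b by (auto simp: clopen_embedding_def)
  have cl: "clopenin E (a ` Z)" "clopenin E (b ` Z)"
    using a b by (auto simp: clopen_embedding_def)
  have ab: "a z \<in> topspace E" "b z \<in> topspace E" if "z \<in> Z" for z
    using that cl clopenin_subset by blast+
  have sa: "s (a z) = b z" if "z \<in> Z" for z
    using that inj by (simp add: s_def)
  have sb: "s (b z) = a z" if "z \<in> Z" for z
    using that inj disj by (auto simp: s_def)
  have sx: "s x = x" if "x \<in> topspace E" "x \<notin> a ` Z" "x \<notin> b ` Z" for x
    using that by (simp add: s_def)
  have cases: "\<lbrakk>x \<in> topspace E; \<And>z. z \<in> Z \<Longrightarrow> P (a z); \<And>z. z \<in> Z \<Longrightarrow> P (b z);
      \<lbrakk>x \<notin> a ` Z; x \<notin> b ` Z\<rbrakk> \<Longrightarrow> P x\<rbrakk> \<Longrightarrow> P x" for x P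
    by blast
  have inv: "s (s x) = x" if "x \<in> topspace E" for x
    using that by (rule cases) (simp_all add: sa sb sx [OF that])
  have S: "s x \<in> topspace E" if "x \<in> topspace E" for x
    using that by (rule cases) (simp_all add: sa sb sx [OF that] ab that)
  \<comment> \<open>The embeddings are variables \<open>c\<close> and \<open>d\<close> because the
    same computation serves both directions of the exchange.\<close>
  have pre: "openin E {x \<in> c ` Z. s x \<in> W}"
    if W: "openin E W" and c: "clopen_embedding E Z c" and d: "clopen_embedding E Z d"
      and sc: "\<And>z. z \<in> Z \<Longrightarrow> s (c z) = d z" for c d W
  proof -
    have eq: "{x \<in> c ` Z. s x \<in> W} = c ` {z \<in> Z. d z \<in> W}"
      using sc by auto
    have "d ` {z \<in> Z. d z \<in> W} = W \<inter> d ` Z" by auto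
    then have "openin E (d ` {z \<in> Z. d z \<in> W})"
      using W d by (auto simp: clopen_embedding_def clopenin_def)
    then have "openin E {z \<in> Z. d z \<in> W}"
      using d unfolding clopen_embedding_def by (metis (no_types, lifting) mem_Collect_eq subsetI)
    then show ?thesis
      using c unfolding eq clopen_embedding_def by (metis (no_types, lifting) mem_Collect_eq subsetI)
  qed
  have "openin E {x \<in> topspace E. s x \<in> W}" if W: "openin E W" for W
  proof -
    have "{x \<in> topspace E. s x \<in> W} = {x \<in> a ` Z. s x \<in> W} \<union> {x \<in> b ` Z. s x \<in> W} \<union>
        (W - (a ` Z \<union> b ` Z))" (is "?l = ?r")
    proof
      show "?l \<subseteq> ?r"
      proof
        fix x assume x: "x \<in> ?l"
        then have "x \<in> topspace E" by simp
        then show "x \<in> ?r"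
          using x sx [of x] by (cases "x \<in> a ` Z \<or> x \<in> b ` Z") auto
      qed
      show "?r \<subseteq> ?l"
      proof
        fix x assume x: "x \<in> ?r"
        then have "x \<in> topspace E" using openin_subset [OF W] ab by blast
        then show "x \<in> ?l" using x sx [of x] by auto
      qed
    qed
    moreover have "openin E (W - (a ` Z \<union> b ` Z))"
      using W cl by (auto simp: clopenin_def intro: openin_diff)
    ultimately show ?thesis
      using pre [OF W a b sa] pre [OF W b a sb] by (auto intro!: openin_Un)
  qed
  then have "continuous_map E E s"
    using S by (auto simp: continuous_map_def)
  then have "homeomorphic_map E E s"
    unfolding homeomorphic_map_maps homeomorphic_maps_def using inv by blast
  moreover have "s \<in> extensional (topspace E)"
    using ab by (auto simp: extensional_def s_def)
  ultimately show thesis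
    using that sa sb sx by (auto simp: carrier_homeo_group)
qed

section \<open>Coarse boundedness from the copy dichotomy\<close>

text \<open>A copy somewhere inside \<open>P\<close> suffices. This makes the notion monotone in
  \<open>P\<close>, and under \<open>copy_dichotomy\<close> the clopen sets without a copy form an
  ideal.\<close>

definition contains_copy :: "'a topology \<Rightarrow> 'a set \<Rightarrow> bool" where
  "contains_copy E P \<longleftrightarrow> clopenin E P \<and> (\<exists>h. clopen_embedding E (topspace E) h \<and> h ` topspace E \<subseteq> P)"

lemma contains_copy_mono:
  "contains_copy E P \<Longrightarrow> P \<subseteq> Q \<Longrightarrow> clopenin E Q \<Longrightarrow> contains_copy E Q"
  unfolding contains_copy_def by blast

lemma contains_copy_image:
  assumes P: "contains_copy E P" and a: "clopen_embedding E P a"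
  shows "contains_copy E (a ` P)"
proof -
  obtain h where h: "clopen_embedding E (topspace E) h" "h ` topspace E \<subseteq> P"
    using P by (auto simp: contains_copy_def)
  have "clopen_embedding E (topspace E) (\<lambda>x. a (h x))"
    using clopen_embedding_compose [OF h(1) a h(2)] .
  moreover have "(\<lambda>x. a (h x)) ` topspace E \<subseteq> a ` P"
    using h(2) by blast
  moreover have "clopenin E (a ` P)"
    using a by (simp add: clopen_embedding_def)
  ultimately show ?thesis
    unfolding contains_copy_def by blast
qed

definition copy_dichotomy :: "'a topology \<Rightarrow> bool" where
  "copy_dichotomy E \<longleftrightarrow>
     (\<forall>A. clopenin E A \<longrightarrow> contains_copy E A \<or> contains_copy E (topspace E - A))"

lemma clopen_embedding_vimage:
  assumes h: "clopen_embedding E X h" and D: "clopenin E D"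
  shows "clopenin E {x \<in> X. h x \<in> D}"
proof -
  have op: "openin E {x \<in> X. h x \<in> W}" if "clopenin E W" for W
  proof -
    have "h ` {x \<in> X. h x \<in> W} = h ` X \<inter> W" by auto
    then have "openin E (h ` {x \<in> X. h x \<in> W})"
      using that h by (simp add: clopen_embedding_def clopenin_def openin_Int)
    moreover have "{x \<in> X. h x \<in> W} \<subseteq> X" by blast
    ultimately show ?thesis
      using h unfolding clopen_embedding_def by blast
  qed
  have X: "clopenin E X" "h ` X \<subseteq> topspace E"
    using h clopenin_subset unfolding clopen_embedding_def by auto
  have "{x \<in> X. h x \<in> D} = X - {x \<in> X. h x \<in> topspace E - D}"
    using X by auto
  moreover have "closedin E (X - {x \<in> X. h x \<in> topspace E - D})"
    using X(1) op [OF clopenin_compl [OF D]] by (simp add: clopenin_def closedin_diff)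
  ultimately show ?thesis
    using op [OF D] by (simp add: clopenin_def)
qed

text \<open>Pulling \<open>D\<close> back along a copy of \<open>E\<close> in \<open>P\<close> turns
  the cut of \<open>P\<close> into a clopen partition of \<open>E\<close>; the dichotomy gives a
  copy in one half, which the embedding carries back into \<open>P\<close>.\<close>

lemma contains_copy_split:
  assumes "copy_dichotomy E" and P: "contains_copy E P" and D: "clopenin E D"
  shows "contains_copy E (P \<inter> D) \<or> contains_copy E (P - D)"
proof -
  let ?S = "topspace E"
  obtain h where h: "clopen_embedding E ?S h" "h ` ?S \<subseteq> P" and clP: "clopenin E P"
    using P by (auto simp: contains_copy_def)
  define A where "A = {x \<in> ?S. h x \<in> D}"
  have A: "clopenin E A"
    using clopen_embedding_vimage [OF h(1) D] by (simp add: A_def)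
  have *: "contains_copy E (h ` B)" if "contains_copy E B" for B
  proof -
    have "clopenin E B" using that by (simp add: contains_copy_def)
    then show ?thesis
      using that h(1) contains_copy_image clopen_embedding_subset clopenin_subset by blast
  qed
  have "contains_copy E A \<or> contains_copy E (?S - A)"
    using assms(1) A by (simp add: copy_dichotomy_def)
  then show ?thesis
  proof
    assume "contains_copy E A"
    moreover have "h ` A \<subseteq> P \<inter> D" using h(2) by (auto simp: A_def)
    ultimately show ?thesis
      using * contains_copy_mono clopenin_Int [OF clP D] by blast
  next
    assume "contains_copy E (?S - A)"
    moreover have "h ` (?S - A) \<subseteq> P - D" using h(2) by (auto simp: A_def)
    ultimately show ?thesis
      using * contains_copy_mono clopenin_Diff [OF clP D] by blast
  qed
qed

text \<open>Cut by one \<open>D\<close> at a time and keep a half that still has a copy. A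
  homeomorphism supported in the resulting \<open>A\<close> maps every \<open>D\<close> onto itself,
  which is how smallness will be recognized.\<close>

lemma contains_copy_atom:
  assumes "copy_dichotomy E" and "finite \<D>" and "\<And>D. D \<in> \<D> \<Longrightarrow> clopenin E D"
  obtains A where "contains_copy E A" and "\<And>D. D \<in> \<D> \<Longrightarrow> A \<subseteq> D \<or> A \<inter> D = {}"
proof -
  have "\<exists>A. contains_copy E A \<and> (\<forall>D\<in>\<D>. A \<subseteq> D \<or> A \<inter> D = {})"
    using assms(2,3)
  proof (induction \<D> rule: finite_induct)
    case empty
    have "contains_copy E (topspace E)"
      unfolding contains_copy_def using clopen_embedding_id [of E "topspace E"] by auto
    then show ?case by blast
  next
    case (insert D \<D>)
    then obtain A where A: "contains_copy E A" "\<forall>D\<in>\<D>. A \<subseteq> D \<or> A \<inter> D = {}"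
      by auto
    then have "contains_copy E (A \<inter> D) \<or> contains_copy E (A - D)"
      using contains_copy_split assms(1) insert.prems by blast
    then show ?case
    proof
      assume "contains_copy E (A \<inter> D)"
      then show ?thesis using A(2) by (intro exI [of _ "A \<inter> D"]) blast
    next
      assume "contains_copy E (A - D)"
      then show ?thesis using A(2) by (intro exI [of _ "A - D"]) blast
    qed
  qed
  then show ?thesis using that by blast
qed

lemma homeo_group_supported_image:
  assumes v: "v \<in> carrier (homeo_group E)" and supp: "\<And>x. x \<in> topspace E - A \<Longrightarrow> v x = x"
    and "A \<subseteq> D \<or> A \<inter> D = {}" and D: "D \<subseteq> topspace E" and A: "A \<subseteq> topspace E"
  shows "v ` D = D"
proof -
  let ?S = "topspace E"
  have v': "inj_on v ?S" "v ` ?S = ?S"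
    using homeo_group_embedding [OF v] by (auto simp: clopen_embedding_def)
  have im: "v ` B = B" if "B \<subseteq> ?S - A" for B
    using that supp by force
  have "v ` A = v ` ?S - v ` (?S - A)"
    using v'(1) A by (auto simp: inj_on_def)
  then have "v ` A = A"
    using v'(2) im A by auto
  then have "v ` D = D" if "A \<subseteq> D"
  proof -
    have "D = A \<union> (D - A)" using that by blast
    then show ?thesis
      using \<open>v ` A = A\<close> im [of "D - A"] D by (metis Diff_mono image_Un subset_refl)
  qed
  then show ?thesis
    using assms(3) im [of D] D by blast
qed

text \<open>
  Let \<open>A\<close> contain a copy of \<open>E\<close> and be so small that homeomorphisms supported in \<open>A\<close> have length at most
  one, and let \<open>B\<close> be its complement. Fix involutions \<open>f0\<close>, \<open>f1\<close> that exchange \<open>B\<close> with two disjoint copies of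
  \<open>B\<close> in \<open>A\<close>. If \<open>A \<inter> g ` A\<close> minus one of these copies still contains a copy of \<open>E\<close>, hence an image \<open>k ` B\<close>,
  then the product \<open>t f w f\<close> agrees with \<open>k g\<^sup>-\<^sup>1\<close> on \<open>g ` B\<close>, where \<open>t\<close> and \<open>w\<close> are supported in \<open>A\<close>, and \<open>v f v\<close>
  takes \<open>k ` B\<close> back to \<open>B\<close>. So \<open>g\<close> is a product of boundedly many elements of bounded length.
\<close>

lemma homeo_group_subadditive_bounded:
  fixes E :: "'a topology" and l :: "('a \<Rightarrow> 'a) \<Rightarrow> real"
  assumes dich: "copy_dichotomy E" and fin: "finite \<D>" and clD: "\<And>D. D \<in> \<D> \<Longrightarrow> clopenin E D"
    and sub: "\<And>u g. u \<in> carrier (homeo_group E) \<Longrightarrow> g \<in> carrier (homeo_group E) \<Longrightarrow>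
        l g \<le> l u + l (u \<otimes>\<^bsub>homeo_group E\<^esub> g)"
    and small: "\<And>v. v \<in> carrier (homeo_group E) \<Longrightarrow> (\<And>D. D \<in> \<D> \<Longrightarrow> v ` D = D) \<Longrightarrow> l v \<le> 1"
  shows "\<exists>c. \<forall>g\<in>carrier (homeo_group E). l g \<le> c"
proof -
  let ?S = "topspace E" and ?C = "carrier (homeo_group E)"
  interpret group "homeo_group E" by (rule group_homeo_group)
  obtain A where bigA: "contains_copy E A" and atom: "\<And>D. D \<in> \<D> \<Longrightarrow> A \<subseteq> D \<or> A \<inter> D = {}"
    using contains_copy_atom [OF dich fin clD] by blast
  have clA: "clopenin E A" using bigA by (simp add: contains_copy_def)
  have AS: "A \<subseteq> ?S" using clopenin_subset [OF clA] .
  define B where "B = ?S - A"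
  have clB: "clopenin E B" using clA by (simp add: B_def clopenin_compl)
  have BS: "B \<subseteq> ?S" by (simp add: B_def)
  have supp: "l v \<le> 1" if "v \<in> ?C" "\<And>x. x \<in> B \<Longrightarrow> v x = x" for v
    using that small homeo_group_supported_image [of v E A] atom clD clopenin_subset AS
    unfolding B_def by metis
  obtain h where h: "clopen_embedding E ?S h" "h ` ?S \<subseteq> A"
    using bigA by (auto simp: contains_copy_def)
  define R where "R = (\<lambda>f b. f \<in> ?C \<and> clopen_embedding E B b \<and> b ` B \<subseteq> A \<and>
    (\<forall>x\<in>B. f x = b x \<and> f (b x) = x) \<and> (\<forall>x\<in>?S - B - b ` B. f x = x))"
  have exR: "\<exists>f. R f b" if b: "clopen_embedding E B b" "b ` B \<subseteq> A" for b
  proof -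
    have "(\<lambda>x. x) ` B \<inter> b ` B = {}" using b(2) by (auto simp: B_def)
    from homeo_group_swap [OF clopen_embedding_id [OF clB] b(1) this]
    obtain f where "f \<in> ?C" "\<And>z. z \<in> B \<Longrightarrow> f z = b z" "\<And>z. z \<in> B \<Longrightarrow> f (b z) = z"
      "\<And>x. x \<in> ?S \<Longrightarrow> x \<notin> (\<lambda>x. x) ` B \<Longrightarrow> x \<notin> b ` B \<Longrightarrow> f x = x" by blast
    then show ?thesis using b unfolding R_def by (intro exI [of _ f]) auto
  qed
  have hB: "clopen_embedding E B h" "h ` B \<subseteq> A"
    using h clopen_embedding_subset [OF h(1) clB BS] BS by auto
  have hhB: "clopen_embedding E B (\<lambda>x. h (h x))" "(\<lambda>x. h (h x)) ` B \<subseteq> A"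
    using clopen_embedding_compose [OF hB(1) h(1)] hB h AS BS by auto
  obtain f0 f1 where f0: "R f0 h" and f1: "R f1 (\<lambda>x. h (h x))"
    using exR [OF hB] exR [OF hhB] by blast
  \<comment> \<open>The second copy of \<open>B\<close> comes from iterating \<open>h\<close>. A
    common point \<open>h x = h (h y)\<close> would give \<open>x = h y\<close>, which lies in
    \<open>A\<close> and not in \<open>B\<close>.\<close>
  have disj: "h ` B \<inter> (\<lambda>x. h (h x)) ` B = {}"
  proof -
    have "h x \<noteq> h (h y)" if "x \<in> B" "y \<in> B" for x y
    proof
      assume "h x = h (h y)"
      moreover have "h y \<in> A" using hB(2) that by blast
      ultimately have "x = h y"
        using h(1) that AS BS unfolding clopen_embedding_def inj_on_def by blast
      then show False using \<open>h y \<in> A\<close> that by (simp add: B_def)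
    qed
    then show ?thesis by blast
  qed
  define c where "c = max (l f0) (l f1)"
  \<comment> \<open>The word \<open>v f v t f w f g\<close> costs \<open>l f\<close> three times, 1
    for each of \<open>v\<close>, \<open>v\<close>, \<open>t\<close>, \<open>w\<close>, and 1 for
    the product itself, which fixes \<open>B\<close> pointwise.\<close>
  have main: "l g \<le> 5 + 3 * l f"
    if g: "g \<in> ?C" and R: "R f b" and big: "contains_copy E (A \<inter> g ` A - b ` B)" for g f b
  proof -
    have f: "f \<in> ?C" and b: "clopen_embedding E B b" "b ` B \<subseteq> A"
      and fb: "\<And>x. x \<in> B \<Longrightarrow> f x = b x" "\<And>x. x \<in> B \<Longrightarrow> f (b x) = x"
      and ff: "\<And>x. x \<in> ?S \<Longrightarrow> x \<notin> B \<Longrightarrow> x \<notin> b ` B \<Longrightarrow> f x = x"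
      using R unfolding R_def by auto
    obtain k where k: "clopen_embedding E ?S k" "k ` ?S \<subseteq> A \<inter> g ` A - b ` B"
      using big by (auto simp: contains_copy_def)
    have gS: "clopen_embedding E ?S g" "g ` ?S = ?S" and fS: "clopen_embedding E ?S f" "f ` ?S = ?S"
      using g f homeo_group_embedding by blast+
    have kB: "clopen_embedding E B k" using clopen_embedding_subset [OF k(1) clB BS] .
    have kS: "k x \<in> A" "k x \<in> g ` A" "k x \<notin> b ` B" if "x \<in> ?S" for x
      using k(2) that by auto
    have inj: "inj_on g ?S" "inj_on k ?S" "inj_on f ?S"
      using gS k(1) fS by (auto simp: clopen_embedding_def)
    have kg: "k x \<noteq> g y" if "x \<in> ?S" "y \<in> B" for x y
    proof
      assume "k x = g y"
      have "k x \<in> g ` A" using kS(2) that(1) .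
      with \<open>k x = g y\<close> obtain z where "z \<in> A" "g y = g z" by auto
      then have "z = y"
        using inj_onD [OF inj(1), of z y] that(2) AS BS by auto
      then show False using \<open>z \<in> A\<close> that(2) by (simp add: B_def)
    qed
    \<comment> \<open>\<open>g\<close> sends \<open>B1\<close> into \<open>A\<close>, where an
      element supported in \<open>A\<close> can move it, and \<open>B2\<close> into
      \<open>B\<close>, where none can. So the image of \<open>B2\<close> is first carried by
      \<open>f\<close> into the copy of \<open>B\<close> inside \<open>A\<close>.\<close>
    define B1 where "B1 = {x \<in> B. g x \<in> A}"
    define B2 where "B2 = {x \<in> B. g x \<in> B}"
    have gB: "clopen_embedding E B g" using clopen_embedding_subset [OF gS(1) clB BS] .
    have cl12: "clopenin E B1" "clopenin E B2"
      using clopen_embedding_vimage [OF gB] clA clB by (auto simp: B1_def B2_def)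
    have sub12: "B1 \<subseteq> B" "B2 \<subseteq> B" by (auto simp: B1_def B2_def)
    have kB': "x \<in> ?S" "k x \<in> A" "k x \<notin> b ` B" if "x \<in> B" for x
      using kS [of x] subsetD [OF BS that] by simp_all
    have kB1: "y \<notin> b ` B" "y \<in> A" if "y \<in> k ` B" for y
      using that kB'(2,3) by (elim imageE, simp)+
    have kgB: "y \<notin> k ` B" if "y \<in> g ` B" for y
    proof
      assume "y \<in> k ` B"
      then obtain z where z: "z \<in> B" "y = k z" by (rule imageE) simp
      from that obtain x where "x \<in> B" "y = g x" by (rule imageE) simp
      then show False using kg [of z x] z kB'(1) by simp
    qed
    have "b ` B \<inter> k ` B = {}" using kB1(1) by blast
    then obtain v where v: "v \<in> ?C" "\<And>z. z \<in> B \<Longrightarrow> v (b z) = k z" "\<And>z. z \<in> B \<Longrightarrow> v (k z) = b z"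
      "\<And>x. x \<in> ?S \<Longrightarrow> x \<notin> b ` B \<Longrightarrow> x \<notin> k ` B \<Longrightarrow> v x = x"
      by (rule homeo_group_swap [OF b(1) kB]) (rule that)
    have g1: "clopen_embedding E B1 g" "clopen_embedding E B1 k"
      by (rule clopen_embedding_subset [OF gB cl12(1) sub12(1)],
          rule clopen_embedding_subset [OF kB cl12(1) sub12(1)])
    have "g ` B1 \<inter> k ` B1 = {}" 
    proof (rule equals0I)
      fix y assume "y \<in> g ` B1 \<inter> k ` B1"
      then have "y \<in> g ` B" "y \<in> k ` B" using sub12(1) by auto
      then show False using kgB by simp
    qed
    then obtain t where t: "t \<in> ?C" "\<And>z. z \<in> B1 \<Longrightarrow> t (g z) = k z" "\<And>z. z \<in> B1 \<Longrightarrow> t (k z) = g z"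
      "\<And>x. x \<in> ?S \<Longrightarrow> x \<notin> g ` B1 \<Longrightarrow> x \<notin> k ` B1 \<Longrightarrow> t x = x"
      by (rule homeo_group_swap [OF g1]) (rule that)
    have g2: "clopen_embedding E B2 g" "clopen_embedding E B2 k"
      by (rule clopen_embedding_subset [OF gB cl12(2) sub12(2)],
          rule clopen_embedding_subset [OF kB cl12(2) sub12(2)])
    have fg2: "clopen_embedding E B2 (\<lambda>x. f (g x))"
    proof (rule clopen_embedding_compose [OF g2(1) fS(1)])
      show "g ` B2 \<subseteq> ?S" using gS(2) sub12 BS by blast
    qed
    have fgB: "f (g x) \<in> b ` B" if "x \<in> B2" for x
      using that fb(1) by (auto simp: B2_def)
    then have "(\<lambda>x. f (g x)) ` B2 \<inter> k ` B2 = {}"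
    proof (intro equals0I)
      fix y assume fg: "\<And>x. x \<in> B2 \<Longrightarrow> f (g x) \<in> b ` B"
        and "y \<in> (\<lambda>x. f (g x)) ` B2 \<inter> k ` B2"
      then have "y \<in> b ` B" "y \<in> k ` B" using sub12(2) by auto
      then show False using kB1(1) by simp
    qed
    then obtain w where w: "w \<in> ?C" "\<And>z. z \<in> B2 \<Longrightarrow> w (f (g z)) = k z"
      "\<And>z. z \<in> B2 \<Longrightarrow> w (k z) = f (g z)"
      "\<And>x. x \<in> ?S \<Longrightarrow> x \<notin> (\<lambda>x. f (g x)) ` B2 \<Longrightarrow> x \<notin> k ` B2 \<Longrightarrow> w x = x"
      by (rule homeo_group_swap [OF fg2 g2(2)]) (rule that)
    have supp_v: "v x = x" if "x \<in> B" for x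
    proof (rule v(4))
      show "x \<notin> b ` B" using that b(2) by (auto simp: B_def)
      show "x \<notin> k ` B" using that kB1(2) by (auto simp: B_def)
    qed (use that BS in blast)
    have supp_t: "t x = x" if "x \<in> B" for x
    proof (rule t(4))
      show "x \<notin> g ` B1" using that by (auto simp: B1_def B_def)
      show "x \<notin> k ` B1" using that kB1(2) sub12 by (auto simp: B_def)
    qed (use that BS in blast)
    have supp_w: "w x = x" if "x \<in> B" for x
    proof (rule w(4))
      show "x \<notin> (\<lambda>x. f (g x)) ` B2" using that fgB b(2) by (auto simp: B_def)
      show "x \<notin> k ` B2" using that kB1(2) sub12 by (auto simp: B_def)
    qed (use that BS in blast)
    have twist: "t (f (w (f (g x)))) = k x" if x: "x \<in> B" for x
    proof (cases "g x \<in> B")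
      case True
      then have x2: "x \<in> B2" using x by (simp add: B2_def)
      have "f (k x) = k x"
      proof (rule ff)
        show "k x \<in> ?S" using kB'(2) [OF x] AS by blast
        show "k x \<notin> B" using kB'(2) [OF x] by (simp add: B_def)
      qed (rule kB'(3) [OF x])
      moreover have "t (k x) = k x"
      proof (rule t(4))
        show "k x \<in> ?S" using kB'(2) [OF x] AS by blast
        show "k x \<notin> g ` B1"
        proof
          assume "k x \<in> g ` B1"
          then have "k x \<in> g ` B" using sub12(1) by auto
          from kgB [OF this] show False using x by simp
        qed
        have "x \<notin> B1" using True by (simp add: B1_def B_def)
        then show "k x \<notin> k ` B1"
          using inj_onD [OF inj(2)] kB'(1) x sub12(1) by (metis imageE subsetD)
      qed
      ultimately show ?thesis using w(2) [OF x2] by simp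
    next
      case False
      have gx: "g x \<in> ?S" using gS(2) x BS by blast
      then have gA: "g x \<in> A" using False by (simp add: B_def)
      then have x1: "x \<in> B1" using x by (simp add: B1_def)
      \<comment> \<open>If \<open>g x\<close> lies in the copy of \<open>B\<close>, then
        \<open>f\<close> takes it to \<open>B\<close>, where \<open>w\<close> fixes it, and
        \<open>f\<close> brings it back; otherwise \<open>f\<close> and \<open>w\<close> both fix
        it.\<close>
      have "f (w (f (g x))) = g x"
      proof (cases "g x \<in> b ` B")
        case True
        then obtain y where y: "y \<in> B" "g x = b y" by blast
        then show ?thesis using fb supp_w by simp
      next
        case gb: False
        have "f (g x) = g x" using ff [OF gx False gb] .
        moreover have "w (g x) = g x"
        proof (rule w(4) [OF gx])
          show "g x \<notin> (\<lambda>x. f (g x)) ` B2"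
          proof
            assume "g x \<in> (\<lambda>x. f (g x)) ` B2"
            then obtain z where "z \<in> B2" "g x = f (g z)" by (rule imageE) simp
            then show False using fgB [of z] gb by simp
          qed
          have "g x \<notin> k ` B" using kgB x by simp
          then show "g x \<notin> k ` B2" using sub12(2) by auto
        qed
        ultimately show ?thesis by simp
      qed
      then show ?thesis using t(2) [OF x1] by simp
    qed
    have final: "v (f (v (t (f (w (f (g x))))))) = x" if x: "x \<in> B" for x
      using twist [OF x] v(3) [OF x] fb(2) [OF x] supp_v [OF x] by simp
    let ?m = "\<lambda>u g. u \<otimes>\<^bsub>homeo_group E\<^esub> g"
    let ?u = "?m v (?m f (?m v (?m t (?m f (?m w (?m f g))))))"
    have app: "?m u u' x = u (u' x)" if "u \<in> ?C" "u' \<in> ?C" "x \<in> B" for u u' x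
      using homeo_group_mult_apply [OF that(1,2)] subsetD [OF BS that(3)] by simp
    have "?u x = x" if "x \<in> B" for x
      using final [OF that] by (simp add: app that f g v(1) t(1) w(1))
    then have "l ?u \<le> 1" by (intro supp) (simp_all add: f g v(1) t(1) w(1))
    moreover have "l v \<le> 1" "l t \<le> 1" "l w \<le> 1"
      by (rule supp; simp add: v(1) t(1) w(1) supp_v supp_t supp_w)+
    moreover have "l g \<le> l f + l (?m f g)" by (simp add: sub f g)
    moreover have "l (?m f g) \<le> l w + l (?m w (?m f g))" by (simp add: sub f g v(1) t(1) w(1))
    moreover have "l (?m w (?m f g)) \<le> l f + l (?m f (?m w (?m f g)))"
      by (simp add: sub f g v(1) t(1) w(1))
    moreover have "l (?m f (?m w (?m f g))) \<le> l t + l (?m t (?m f (?m w (?m f g))))"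
      by (simp add: sub f g v(1) t(1) w(1))
    moreover have "l (?m t (?m f (?m w (?m f g)))) \<le> l v + l (?m v (?m t (?m f (?m w (?m f g)))))"
      by (simp add: sub f g v(1) t(1) w(1))
    moreover have "l (?m v (?m t (?m f (?m w (?m f g))))) \<le> l f + l (?m f (?m v (?m t (?m f (?m w (?m f g))))))"
      by (simp add: sub f g v(1) t(1) w(1))
    moreover have "l (?m f (?m v (?m t (?m f (?m w (?m f g)))))) \<le> l v + l ?u"
      by (simp add: sub f g v(1) t(1) w(1))
    ultimately show ?thesis by linarith
  qed
  have main2: "l g \<le> 5 + 3 * c" if g: "g \<in> ?C" and big: "contains_copy E (A \<inter> g ` A)" for g
  proof -
    have "clopenin E (h ` B)" using hB by (simp add: clopen_embedding_def)
    \<comment> \<open>If removing the first copy of \<open>B\<close> loses every copy of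
      \<open>E\<close>, then the part inside the first copy contains one, and this part is disjoint
      from the second copy.\<close>
    then consider "contains_copy E (A \<inter> g ` A - h ` B)" | "contains_copy E (A \<inter> g ` A \<inter> h ` B)"
      using contains_copy_split [OF dich big] by blast
    then show ?thesis
    proof cases
      case 1
      then show ?thesis using main [OF g f0] by (simp add: c_def)
    next
      case 2
      have "clopenin E (A \<inter> g ` A - (\<lambda>x. h (h x)) ` B)"
        using big hhB by (simp add: clopen_embedding_def contains_copy_def clopenin_Diff)
      then have "contains_copy E (A \<inter> g ` A - (\<lambda>x. h (h x)) ` B)"
        using contains_copy_mono [OF 2] disj by blast
      then show ?thesis using main [OF g f1] by (simp add: c_def)
    qed
  qed
  \<comment> \<open>If the part of the image of \<open>A\<close> outside \<open>A\<close> contains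
    the copy, composing with \<open>f0\<close> brings it into \<open>A\<close> at the price of one
    more \<open>l f0\<close>. The absolute value makes one bound serve both cases, \<open>c\<close>
    having no known sign.\<close>
  have "l g \<le> 5 + 4 * \<bar>c\<bar>" if g: "g \<in> ?C" for g
  proof -
    have img: "contains_copy E (u ` P)" if "u \<in> ?C" "contains_copy E P" for u P
    proof -
      have "clopenin E P" using that by (simp add: contains_copy_def)
      then show ?thesis
        using that homeo_group_embedding(1) clopen_embedding_subset clopenin_subset contains_copy_image
        by metis
    qed
    have f: "f0 \<in> ?C" "\<And>x. x \<in> B \<Longrightarrow> f0 x = h x" using f0 by (auto simp: R_def)
    have fg: "f0 \<otimes>\<^bsub>homeo_group E\<^esub> g \<in> ?C" using f g by simp
    consider "contains_copy E (g ` A \<inter> A)" | "contains_copy E (g ` A - A)"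
      using contains_copy_split [OF dich img [OF g bigA] clA] by blast
    then show ?thesis
    proof cases
      case 1
      then show ?thesis using main2 [OF g] by (simp add: Int_commute)
    next
      case 2
      have gA: "g ` A \<subseteq> ?S" using homeo_group_embedding(2) [OF g] AS by blast
      have "(f0 \<otimes>\<^bsub>homeo_group E\<^esub> g) ` A = f0 ` g ` A"
        using homeo_group_mult_apply [OF f(1) g] AS by (force simp: image_image)
      moreover have "f0 ` (g ` A - A) \<subseteq> A"
        using gA f(2) hB(2) by (fastforce simp: B_def)
      ultimately have "f0 ` (g ` A - A) \<subseteq> A \<inter> (f0 \<otimes>\<^bsub>homeo_group E\<^esub> g) ` A"
        by blast
      moreover have "clopenin E (A \<inter> (f0 \<otimes>\<^bsub>homeo_group E\<^esub> g) ` A)"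
        using img [OF fg bigA] clA by (simp add: contains_copy_def clopenin_Int)
      ultimately have "contains_copy E (A \<inter> (f0 \<otimes>\<^bsub>homeo_group E\<^esub> g) ` A)"
        using contains_copy_mono [OF img [OF f(1) 2]] by blast
      then have "l (f0 \<otimes>\<^bsub>homeo_group E\<^esub> g) \<le> 5 + 3 * c"
        using main2 [OF fg] by blast
      moreover have "l f0 \<le> c" by (simp add: c_def)
      ultimately show ?thesis using sub [OF f(1) g] by linarith
    qed
  qed
  then show ?thesis by blast
qed

section \<open>The compact-open topology on the homeomorphism group\<close>

lemma clopenin_separation:
  assumes E: "E dim_le 0" and K: "compactin E K" and U: "openin E U" and "K \<subseteq> U"
  obtains P where "clopenin E P" "K \<subseteq> P" "P \<subseteq> U"
proof -
  have nb: "\<exists>V. clopenin E V \<and> x \<in> V \<and> V \<subseteq> U" if "x \<in> K" for x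
  proof -
    have "x \<in> U" using that \<open>K \<subseteq> U\<close> by blast
    then obtain W V where "openin E W" "closedin E V \<and> openin E V" "x \<in> W" "W \<subseteq> V" "V \<subseteq> U"
      using E U unfolding dimension_le_0_neighbourhood_base_of_clopen neighbourhood_base_of by meson
    then show ?thesis unfolding clopenin_def by blast
  qed
  then obtain V where V: "\<And>x. x \<in> K \<Longrightarrow> clopenin E (V x) \<and> x \<in> V x \<and> V x \<subseteq> U"
    by metis
  have "\<exists>\<F>. finite \<F> \<and> \<F> \<subseteq> V ` K \<and> K \<subseteq> \<Union>\<F>"
  proof -
    have "\<forall>W\<in>V ` K. openin E W" "K \<subseteq> \<Union>(V ` K)"
      using V by (auto simp: clopenin_def)
    then show ?thesis using K unfolding compactin_def by blast
  qed
  then obtain \<F> where \<F>: "finite \<F>" "\<F> \<subseteq> V ` K" "K \<subseteq> \<Union>\<F>" by blast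
  have "clopenin E (\<Union>\<F>)"
    using \<F>(1,2) V unfolding clopenin_def by (auto intro!: openin_Union closedin_Union)
  moreover have "\<Union>\<F> \<subseteq> U" using \<F>(2) V by auto
  ultimately show thesis by (intro that [OF _ \<F>(3)])
qed

lemma topspace_compact_open_topology:
  "topspace (compact_open_topology E) = carrier (homeo_group E)"
proof -
  have "carrier (homeo_group E) \<in>
    {{f \<in> carrier (homeo_group E). f ` K \<subseteq> U} | K U. compactin E K \<and> openin E U}"
    by (intro CollectI exI [of _ "{}"]) simp
  then show ?thesis
    unfolding compact_open_topology_def topology_generated_by_topspace by blast
qed

lemma openin_compact_open_subbase:
  "compactin E K \<Longrightarrow> openin E U \<Longrightarrow>
    openin (compact_open_topology E) {f \<in> carrier (homeo_group E). f ` K \<subseteq> U}"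
  unfolding compact_open_topology_def by (intro topology_generated_by_Basis) blast

lemma continuous_map_into_compact_open:
  assumes "\<And>x. x \<in> topspace X \<Longrightarrow> F x \<in> carrier (homeo_group E)"
    and "\<And>K U. compactin E K \<Longrightarrow> openin E U \<Longrightarrow> openin X {x \<in> topspace X. F x ` K \<subseteq> U}"
  shows "continuous_map X (compact_open_topology E) F"
  unfolding compact_open_topology_def continuous_on_generated_topo_iff
proof (intro conjI allI impI)
  fix W assume "W \<in> {{f \<in> carrier (homeo_group E). f ` K \<subseteq> U} | K U. compactin E K \<and> openin E U}"
  then obtain K U where W: "W = {f \<in> carrier (homeo_group E). f ` K \<subseteq> U}" "compactin E K" "openin E U"
    by blast
  have "F -` W \<inter> topspace X = {x \<in> topspace X. F x ` K \<subseteq> U}"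
    using assms(1) by (auto simp: W)
  then show "openin X (F -` W \<inter> topspace X)"
    using assms(2) W by simp
next
  show "F ` topspace X \<subseteq>
    \<Union> {{f \<in> carrier (homeo_group E). f ` K \<subseteq> U} | K U. compactin E K \<and> openin E U}"
    using assms(1) topspace_compact_open_topology [of E]
    unfolding compact_open_topology_def topology_generated_by_topspace by blast
qed

text \<open>For composition, zero-dimensionality puts a clopen, hence compact, set between the image
  of \<open>K\<close> under \<open>h\<close> and the preimage of \<open>U\<close> under
  \<open>g\<close>. For inversion, complements of open sets are compact, and the inverse takes
  \<open>K\<close> into \<open>U\<close> exactly if \<open>g\<close> takes the complement of
  \<open>U\<close> off \<open>K\<close>.\<close>

lemma topological_group_homeo_group:
  assumes "compact_space E" "Hausdorff_space E" "E dim_le 0"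
  shows "topological_group (homeo_group E) (compact_open_topology E)"
proof -
  let ?S = "topspace E" and ?C = "carrier (homeo_group E)" and ?T = "compact_open_topology E"
  interpret group "homeo_group E" by (rule group_homeo_group)
  have closed: "compactin E K \<longleftrightarrow> closedin E K" for K
    using assms closedin_compact_space compactin_imp_closedin by blast
  have top: "topspace (prod_topology ?T ?T) = ?C \<times> ?C"
    by (simp add: topspace_compact_open_topology)
  have mult_im: "(f \<otimes>\<^bsub>homeo_group E\<^esub> g) ` K = f ` g ` K" if "f \<in> ?C" "g \<in> ?C" "K \<subseteq> ?S" for f g K
    using homeo_group_mult_apply [OF that(1,2)] that(3) by (force simp: image_image)
  have "continuous_map (prod_topology ?T ?T) ?T (\<lambda>(g, h). g \<otimes>\<^bsub>homeo_group E\<^esub> h)"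
  proof (rule continuous_map_into_compact_open)
    fix K U assume K: "compactin E K" and U: "openin E U"
    have KS: "K \<subseteq> ?S" using K by (rule compactin_subset_topspace)
    show "openin (prod_topology ?T ?T)
      {x \<in> topspace (prod_topology ?T ?T). (case x of (g, h) \<Rightarrow> g \<otimes>\<^bsub>homeo_group E\<^esub> h) ` K \<subseteq> U}"
      unfolding openin_prod_topology_alt
    proof (intro allI impI)
      fix g h
      assume "(g, h) \<in> {x \<in> topspace (prod_topology ?T ?T).
        (case x of (g, h) \<Rightarrow> g \<otimes>\<^bsub>homeo_group E\<^esub> h) ` K \<subseteq> U}"
      then have gh: "g \<in> ?C" "h \<in> ?C" "g ` h ` K \<subseteq> U"
        using mult_im KS unfolding top by auto
      have cont: "continuous_map E E g" "continuous_map E E h"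
        using gh by (auto simp: carrier_homeo_group homeomorphic_imp_continuous_map)
      have "h ` K \<subseteq> ?S" using homeo_group_embedding(2) [OF gh(2)] KS by blast
      then have "h ` K \<subseteq> {x \<in> ?S. g x \<in> U}" using gh(3) by blast
      moreover have "openin E {x \<in> ?S. g x \<in> U}"
        using cont(1) U by (simp add: continuous_map_def)
      moreover have "compactin E (h ` K)" using image_compactin [OF K cont(2)] .
      ultimately obtain P where P: "clopenin E P" "h ` K \<subseteq> P" "P \<subseteq> {x \<in> ?S. g x \<in> U}"
        using clopenin_separation [OF assms(3)] by blast
      let ?A = "{f \<in> ?C. f ` P \<subseteq> U}" and ?B = "{f \<in> ?C. f ` K \<subseteq> P}"
      have "openin ?T ?A" "openin ?T ?B"
        using P(1) closed K U by (auto intro: openin_compact_open_subbase simp: clopenin_def)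
      moreover have "g \<in> ?A" "h \<in> ?B" using gh P by auto
      moreover have "?A \<times> ?B \<subseteq> {x \<in> topspace (prod_topology ?T ?T).
          (case x of (g, h) \<Rightarrow> g \<otimes>\<^bsub>homeo_group E\<^esub> h) ` K \<subseteq> U}"
      proof
        fix z assume "z \<in> ?A \<times> ?B"
        then obtain a b where z: "z = (a, b)" "a \<in> ?C" "b \<in> ?C" "a ` P \<subseteq> U" "b ` K \<subseteq> P" by blast
        then have "a ` b ` K \<subseteq> U" by blast
        then show "z \<in> {x \<in> topspace (prod_topology ?T ?T).
          (case x of (g, h) \<Rightarrow> g \<otimes>\<^bsub>homeo_group E\<^esub> h) ` K \<subseteq> U}"
          using z mult_im [OF z(2,3) KS] unfolding top by simp
      qed
      ultimately show "\<exists>A B. openin ?T A \<and> openin ?T B \<and> g \<in> A \<and> h \<in> B \<and> A \<times> B \<subseteq>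
          {x \<in> topspace (prod_topology ?T ?T). (case x of (g, h) \<Rightarrow> g \<otimes>\<^bsub>homeo_group E\<^esub> h) ` K \<subseteq> U}"
        by blast
    qed
  qed (auto simp: top topspace_compact_open_topology)
  moreover have "continuous_map ?T ?T (\<lambda>g. inv\<^bsub>homeo_group E\<^esub> g)"
  proof (rule continuous_map_into_compact_open)
    fix K U assume K: "compactin E K" and U: "openin E U"
    have KS: "K \<subseteq> ?S" using K by (rule compactin_subset_topspace)
    have US: "U \<subseteq> ?S" using U by (rule openin_subset)
    have eq: "(inv\<^bsub>homeo_group E\<^esub> g) ` K \<subseteq> U \<longleftrightarrow> g ` (?S - U) \<subseteq> ?S - K" if g: "g \<in> ?C" for g
    proof -
      let ?i = "inv\<^bsub>homeo_group E\<^esub> g"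
      have ig: "?i (g x) = x" "g (?i x) = x" "?i x \<in> ?S" "g x \<in> ?S" if "x \<in> ?S" for x
        using homeo_group_inv_apply [OF g that] homeo_group_embedding(2) [OF g]
          homeo_group_embedding(2) [of ?i E] g that by auto
      show ?thesis
      proof
        assume L: "?i ` K \<subseteq> U"
        show "g ` (?S - U) \<subseteq> ?S - K"
        proof
          fix y assume "y \<in> g ` (?S - U)"
          then obtain x where x: "x \<in> ?S" "x \<notin> U" "y = g x" by blast
          have "y \<notin> K"
          proof
            assume "y \<in> K"
            then have "?i y \<in> U" using L by blast
            then show False using x ig by simp
          qed
          then show "y \<in> ?S - K" using x ig by simp
        qed
      next
        assume R: "g ` (?S - U) \<subseteq> ?S - K"
        show "?i ` K \<subseteq> U"
        proof
          fix y assume "y \<in> ?i ` K"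
          then obtain x where x: "x \<in> K" "y = ?i x" by blast
          then have xS: "x \<in> ?S" using KS by blast
          show "y \<in> U"
          proof (rule ccontr)
            assume "y \<notin> U"
            then have "g y \<in> ?S - K" using R x ig(3) [OF xS] by blast
            then show False using x ig(2) [OF xS] by simp
          qed
        qed
      qed
    qed
    have "{g \<in> topspace ?T. (inv\<^bsub>homeo_group E\<^esub> g) ` K \<subseteq> U} = {g \<in> ?C. g ` (?S - U) \<subseteq> ?S - K}"
      unfolding topspace_compact_open_topology using eq by (intro Collect_cong conj_cong refl)
    moreover have "openin ?T {g \<in> ?C. g ` (?S - U) \<subseteq> ?S - K}"
      using K U by (intro openin_compact_open_subbase) (auto simp: closed intro: openin_diff)
    ultimately show "openin ?T {g \<in> topspace ?T. (inv\<^bsub>homeo_group E\<^esub> g) ` K \<subseteq> U}"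
      by simp
  qed (auto simp: topspace_compact_open_topology)
  ultimately show ?thesis
    unfolding topological_group_def
    by (simp add: topspace_compact_open_topology is_group)
qed

text \<open>For a subbasic set given by \<open>K\<close> and \<open>U\<close>, take a clopen
  \<open>P\<close> between them: preserving \<open>P\<close> keeps \<open>K\<close> inside
  \<open>U\<close>.\<close>

lemma compact_open_identity_neighbourhood:
  assumes "E dim_le 0" "openin (compact_open_topology E) W" "\<one>\<^bsub>homeo_group E\<^esub> \<in> W"
  shows "\<exists>\<D>. finite \<D> \<and> (\<forall>D\<in>\<D>. clopenin E D) \<and>
    (\<forall>v\<in>carrier (homeo_group E). (\<forall>D\<in>\<D>. v ` D = D) \<longrightarrow> v \<in> W)"
proof -
  let ?C = "carrier (homeo_group E)"
  have "\<one>\<^bsub>homeo_group E\<^esub> \<in> W \<longrightarrow> (\<exists>\<D>. finite \<D> \<and> (\<forall>D\<in>\<D>. clopenin E D) \<and>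
      (\<forall>v\<in>?C. (\<forall>D\<in>\<D>. v ` D = D) \<longrightarrow> v \<in> W))"
    using assms(2) unfolding compact_open_topology_def openin_topology_generated_by_iff
  proof (induction W rule: generate_topology_on.induct)
    case Empty
    then show ?case by simp
  next
    case (Int a b)
    show ?case
    proof
      assume "\<one>\<^bsub>homeo_group E\<^esub> \<in> a \<inter> b"
      then obtain \<A> \<B> where
        "finite \<A>" "\<forall>D\<in>\<A>. clopenin E D" "\<forall>v\<in>?C. (\<forall>D\<in>\<A>. v ` D = D) \<longrightarrow> v \<in> a"
        "finite \<B>" "\<forall>D\<in>\<B>. clopenin E D" "\<forall>v\<in>?C. (\<forall>D\<in>\<B>. v ` D = D) \<longrightarrow> v \<in> b"
        using Int by auto
      then show "\<exists>\<D>. finite \<D> \<and> (\<forall>D\<in>\<D>. clopenin E D) \<and>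
          (\<forall>v\<in>?C. (\<forall>D\<in>\<D>. v ` D = D) \<longrightarrow> v \<in> a \<inter> b)"
        by (intro exI [of _ "\<A> \<union> \<B>"]) auto
    qed
  next
    case (UN K)
    show ?case
    proof
      assume "\<one>\<^bsub>homeo_group E\<^esub> \<in> \<Union>K"
      then obtain k where k: "k \<in> K" "\<one>\<^bsub>homeo_group E\<^esub> \<in> k" by (rule UnionE)
      then obtain \<D> where "finite \<D>" "\<forall>D\<in>\<D>. clopenin E D" "\<forall>v\<in>?C. (\<forall>D\<in>\<D>. v ` D = D) \<longrightarrow> v \<in> k"
        using UN.IH [OF k(1)] by auto
      then show "\<exists>\<D>. finite \<D> \<and> (\<forall>D\<in>\<D>. clopenin E D) \<and>
          (\<forall>v\<in>?C. (\<forall>D\<in>\<D>. v ` D = D) \<longrightarrow> v \<in> \<Union>K)"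
        using k(1) by (intro exI [of _ \<D>]) auto
    qed
  next
    case (Basis s)
    then obtain K U where s: "s = {f \<in> ?C. f ` K \<subseteq> U}" "compactin E K" "openin E U" by blast
    show ?case
    proof
      assume "\<one>\<^bsub>homeo_group E\<^esub> \<in> s"
      then have "K \<subseteq> U"
        using s compactin_subset_topspace [OF s(2)] homeo_group_one_apply [of _ E] by (auto simp: subset_iff image_iff)
      then obtain P where "clopenin E P" "K \<subseteq> P" "P \<subseteq> U"
        using clopenin_separation [OF assms(1) s(2,3)] by blast
      then show "\<exists>\<D>. finite \<D> \<and> (\<forall>D\<in>\<D>. clopenin E D) \<and>
          (\<forall>v\<in>?C. (\<forall>D\<in>\<D>. v ` D = D) \<longrightarrow> v \<in> s)"
        unfolding s(1) by (intro exI [of _ "{P}"]) fastforce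
    qed
  qed
  then show ?thesis using assms(3) by simp
qed

text \<open>The displacement of \<open>x\<close> serves as length. Isometry and the triangle
  inequality give the required subadditivity, continuity at the identity makes the length at most 1
  on a basic neighbourhood, and bounded displacement means a bounded orbit.\<close>

theorem coarsely_bounded_homeo_group:
  fixes E :: "'a topology"
  assumes "compact_space E" "Hausdorff_space E" "E dim_le 0" and "copy_dichotomy E"
  shows "coarsely_bounded TYPE('x) (homeo_group E) (compact_open_topology E)"
  unfolding coarsely_bounded_def
proof (intro conjI allI impI ballI)
  show "topological_group (homeo_group E) (compact_open_topology E)"
    using assms by (intro topological_group_homeo_group)
next
  let ?C = "carrier (homeo_group E)" and ?T = "compact_open_topology E" and ?G = "homeo_group E"
  fix X :: "'x metric" and \<phi> x
  assume act: "continuous_isometric_action ?G ?T X \<phi>" and x: "x \<in> mspace X"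
  interpret M: Metric_space "mspace X" "mdist X" by simp
  interpret A: group_action ?G "mspace X" \<phi>
    using act by (simp add: continuous_isometric_action_def)
  interpret G: group ?G by (rule group_homeo_group)
  have iso: "mdist X (\<phi> g y) (\<phi> g z) = mdist X y z" if "g \<in> ?C" "y \<in> mspace X" "z \<in> mspace X" for g y z
    using act that by (simp add: continuous_isometric_action_def)
  have im: "\<phi> g y \<in> mspace X" if "g \<in> ?C" "y \<in> mspace X" for g y
    using A.element_image that by blast
  define l where "l = (\<lambda>g. mdist X (\<phi> g x) x)"
  have cont: "continuous_map (prod_topology ?T (mtopology_of X)) (mtopology_of X) (\<lambda>(g, x). \<phi> g x)"
    using act by (simp add: continuous_isometric_action_def)
  have "continuous_map ?T (prod_topology ?T (mtopology_of X)) (\<lambda>g. (g, x))"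
    using x by (simp add: continuous_map_pairedI)
  from continuous_map_compose [OF this cont]
  have "continuous_map ?T (mtopology_of X) (\<lambda>g. \<phi> g x)"
    by (simp add: o_def)
  moreover have "openin (mtopology_of X) (M.mball x 1)"
    by (simp add: mtopology_of_def)
  ultimately have op: "openin ?T {g \<in> topspace ?T. \<phi> g x \<in> M.mball x 1}"
    by (rule openin_continuous_map_preimage)
  have one: "\<one>\<^bsub>?G\<^esub> \<in> {g \<in> topspace ?T. \<phi> g x \<in> M.mball x 1}"
  proof -
    have "\<phi> \<one>\<^bsub>?G\<^esub> x = x" using fun_cong [OF A.id_eq_one, of x] x by simp
    then show ?thesis using x by (simp add: topspace_compact_open_topology)
  qed
  from compact_open_identity_neighbourhood [OF assms(3) op one]
  obtain \<D> where \<D>: "finite \<D>" "\<forall>D\<in>\<D>. clopenin E D"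
    "\<forall>v\<in>?C. (\<forall>D\<in>\<D>. v ` D = D) \<longrightarrow> v \<in> {g \<in> topspace ?T. \<phi> g x \<in> M.mball x 1}"
    by (elim exE conjE) (rule that)
  have small: "l v \<le> 1" if "v \<in> ?C" "\<And>D. D \<in> \<D> \<Longrightarrow> v ` D = D" for v
  proof -
    have "\<phi> v x \<in> M.mball x 1" using \<D>(3) that by simp
    then show ?thesis by (simp add: l_def M.commute)
  qed
  have sub: "l g \<le> l u + l (u \<otimes>\<^bsub>?G\<^esub> g)" if "u \<in> ?C" "g \<in> ?C" for u g
  proof -
    have "l g = mdist X (\<phi> u (\<phi> g x)) (\<phi> u x)"
      using iso im that x by (simp add: l_def)
    also have "\<dots> = mdist X (\<phi> (u \<otimes>\<^bsub>?G\<^esub> g) x) (\<phi> u x)"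
      using A.composition_rule [OF x that] by simp
    also have "\<dots> \<le> mdist X (\<phi> (u \<otimes>\<^bsub>?G\<^esub> g) x) x + mdist X x (\<phi> u x)"
      using im that x by (intro M.triangle) auto
    finally show ?thesis by (simp add: l_def M.commute)
  qed
  obtain c where c: "\<And>g. g \<in> ?C \<Longrightarrow> l g \<le> c"
    using homeo_group_subadditive_bounded [OF assms(4) \<D>(1) bspec [OF \<D>(2)] sub small] by blast
  have "orbit ?G \<phi> x \<subseteq> M.mcball x c"
    using c im x by (auto simp: orbit_def l_def M.commute)
  then show "M.mbounded (orbit ?G \<phi> x)"
    unfolding M.mbounded_def by blast
qed

section \<open>Stone duality and isolated points\<close>

lemma stone_space_clopenin_base:
  assumes "stone_space X" "openin X W" "x \<in> W"
  obtains P where "clopenin X P" "x \<in> P" "P \<subseteq> W"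
proof -
  have "neighbourhood_base_of (\<lambda>U. closedin X U \<and> openin X U) X"
    using assms(1) unfolding stone_space_def dimension_le_0_neighbourhood_base_of_clopen by blast
  then obtain U V where "openin X U" "closedin X V \<and> openin X V" "x \<in> U" "U \<subseteq> V" "V \<subseteq> W"
    using assms(2,3) unfolding neighbourhood_base_of by meson
  then show thesis using that [of V] by (auto simp: clopenin_def)
qed

lemma stone_space_separation:
  assumes "stone_space X" "x \<in> topspace X" "y \<in> topspace X" "x \<noteq> y"
  obtains P where "clopenin X P" "x \<in> P" "y \<notin> P"
proof -
  have "closedin X {y}"
    using assms(1,3) unfolding stone_space_def by (simp add: closedin_Hausdorff_singleton)
  then have "openin X (topspace X - {y})" by blast
  then obtain P where P: "clopenin X P" "x \<in> P" "P \<subseteq> topspace X - {y}"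
    by (rule stone_space_clopenin_base [OF assms(1)]) (use assms in auto)
  then show thesis using that [of P] by blast
qed

lemma stone_space_subtopology:
  assumes X: "stone_space X" and P: "clopenin X P"
  shows "stone_space (subtopology X P)"
proof -
  have "compactin X P"
    using X P by (simp add: stone_space_def clopenin_def closedin_compact_space)
  then show ?thesis
    using X by (simp add: stone_space_def compact_space_subtopology Hausdorff_space_subtopology
        dimension_le_subtopology)
qed

lemma clopenin_subtopology:
  assumes "clopenin X P"
  shows "clopenin (subtopology X P) A \<longleftrightarrow> clopenin X A \<and> A \<subseteq> P"
proof -
  have "openin X P" "closedin X P" using assms by (auto simp: clopenin_def)
  then show ?thesis
    by (auto simp: clopenin_def openin_open_subtopology closedin_closed_subtopology)
qed

text \<open>
  A point \<open>x\<close> is recovered from the clopen sets containing it, so an order isomorphism between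
  the lattices of clopen sets determines the image of \<open>x\<close> as the only point of an intersection of
  clopen sets.
\<close>

lemma clopen_order_iso_point:
  assumes Y: "compact_space Y"
    and F: "F ` \<A> = Collect (clopenin X)" and G: "G ` \<A> = Collect (clopenin Y)"
    and order: "\<And>i j. i \<in> \<A> \<Longrightarrow> j \<in> \<A> \<Longrightarrow> F i \<subseteq> F j \<longleftrightarrow> G i \<subseteq> G j"
    and x: "x \<in> topspace X"
  obtains y where "y \<in> topspace Y" "\<And>i. i \<in> \<A> \<Longrightarrow> x \<in> F i \<longleftrightarrow> y \<in> G i"
proof -
  have clF: "clopenin X (F i)" and clG: "clopenin Y (G i)" if "i \<in> \<A>" for i
    using F G that by blast+
  have exF: "\<exists>i\<in>\<A>. F i = A" if "clopenin X A" for A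
    using F that by (metis imageE mem_Collect_eq)
  have exG: "\<exists>i\<in>\<A>. G i = A" if "clopenin Y A" for A
    using G that by (metis imageE mem_Collect_eq)
  obtain z where z: "z \<in> \<A>" "F z = {}" using exF [of "{}"] by auto
  obtain z' where z': "z' \<in> \<A>" "G z' = {}" using exG [of "{}"] by auto
  have empty: "G i = {} \<longleftrightarrow> F i = {}" if "i \<in> \<A>" for i
  proof
    assume "G i = {}"
    then show "F i = {}" using order [OF that z(1)] z(2) by simp
  next
    assume "F i = {}"
    then show "G i = {}" using order [OF that z'(1)] z'(2) by simp
  qed
  \<comment> \<open>Only the order is shared by the two families. The meet of \<open>F i\<close> and
    \<open>F k\<close> is again some \<open>F l\<close>; \<open>G l\<close> is then a lower bound of
    \<open>G i\<close> and \<open>G k\<close>, which is enough for the finite intersection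
    property.\<close>
  have fin: "\<exists>k\<in>\<A>. x \<in> F k \<and> G k \<subseteq> topspace Y \<inter> \<Inter>(G ` I)"
    if "finite I" "I \<subseteq> {i \<in> \<A>. x \<in> F i}" for I
    using that
  proof (induction I rule: finite_induct)
    case empty
    obtain k where "k \<in> \<A>" "F k = topspace X" using exF [of "topspace X"] by auto
    then show ?case using x clG clopenin_subset by force
  next
    case (insert i I)
    then obtain k where k: "k \<in> \<A>" "x \<in> F k" "G k \<subseteq> topspace Y \<inter> \<Inter>(G ` I)" by auto
    have i: "i \<in> \<A>" "x \<in> F i" using insert.prems by auto
    obtain l where l: "l \<in> \<A>" "F l = F i \<inter> F k"
      using exF [OF clopenin_Int [OF clF [OF i(1)] clF [OF k(1)]]] by auto
    have "G l \<subseteq> G i" "G l \<subseteq> G k"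
      using order [OF l(1) i(1)] order [OF l(1) k(1)] l(2) by auto
    then show ?case using l i k by (intro bexI [of _ l]) auto
  qed
  \<comment> \<open>Including the whole space makes the common point a point of
    \<open>Y\<close>.\<close>
  define \<U> where "\<U> = insert (topspace Y) (G ` {i \<in> \<A>. x \<in> F i})"
  have "\<Inter>\<F> \<noteq> {}" if \<F>: "finite \<F>" "\<F> \<subseteq> \<U>" for \<F>
  proof -
    have "finite (\<F> - {topspace Y})" "\<F> - {topspace Y} \<subseteq> G ` {i \<in> \<A>. x \<in> F i}"
      using \<F> by (auto simp: \<U>_def)
    from finite_subset_image [OF this]
    obtain I where I: "finite I" "I \<subseteq> {i \<in> \<A>. x \<in> F i}" "\<F> - {topspace Y} = G ` I"
      by (elim exE conjE) (rule that)
    obtain k where k: "k \<in> \<A>" "x \<in> F k" "G k \<subseteq> topspace Y \<inter> \<Inter>(G ` I)"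
      using fin [OF I(1,2)] by auto
    have "G k \<subseteq> C" if "C \<in> \<F>" for C
    proof (cases "C = topspace Y")
      case True
      then show ?thesis using k(3) by simp
    next
      case False
      then have "C \<in> G ` I" using that I(3) by blast
      then show ?thesis using k(3) by blast
    qed
    then have "G k \<subseteq> \<Inter>\<F>" by (rule Inter_greatest)
    moreover have "G k \<noteq> {}"
      unfolding empty [OF k(1)] using k(2) by (rule ex_in_conv [THEN iffD1, OF exI])
    ultimately show ?thesis by auto
  qed
  moreover have "closedin Y C" if "C \<in> \<U>" for C
    using that clG by (auto simp: \<U>_def clopenin_def)
  ultimately have "(\<forall>C\<in>\<U>. closedin Y C) \<and> (\<forall>\<F>. finite \<F> \<and> \<F> \<subseteq> \<U> \<longrightarrow> \<Inter>\<F> \<noteq> {})"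
    by simp
  from mp [OF spec [OF Y [unfolded compact_space_fip]] this] have "\<Inter>\<U> \<noteq> {}" .
  then obtain y where y: "y \<in> topspace Y" "\<And>i. i \<in> \<A> \<Longrightarrow> x \<in> F i \<Longrightarrow> y \<in> G i"
    by (auto simp: \<U>_def)
  \<comment> \<open>Otherwise \<open>x\<close> lies in the complement \<open>F j\<close>, so
    \<open>y\<close> lies in both \<open>G i\<close> and \<open>G j\<close>; but an index
    representing their meet is sent by \<open>F\<close> below two disjoint sets.\<close>
  have "x \<in> F i" if i: "i \<in> \<A>" and yi: "y \<in> G i" for i
  proof (rule ccontr)
    assume "x \<notin> F i"
    obtain j where j: "j \<in> \<A>" "F j = topspace X - F i"
      using exF [OF clopenin_compl [OF clF [OF i]]] by auto
    then have "y \<in> G j" using y(2) [OF j(1)] x \<open>x \<notin> F i\<close> by simp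
    obtain l where l: "l \<in> \<A>" "G l = G i \<inter> G j"
      using exG [OF clopenin_Int [OF clG [OF i] clG [OF j(1)]]] by auto
    have "F l \<subseteq> F i" "F l \<subseteq> F j"
      using order [OF l(1) i] order [OF l(1) j(1)] l(2) by auto
    then have "F l = {}" using j(2) by auto
    then show False using empty [OF l(1)] l(2) yi \<open>y \<in> G j\<close> by auto
  qed
  then show thesis using that [OF y(1)] y(2) by auto
qed

lemma clopen_order_iso_continuous:
  assumes Y: "stone_space Y"
    and F: "F ` \<A> = Collect (clopenin X)" and G: "G ` \<A> = Collect (clopenin Y)"
    and f: "\<And>x. x \<in> topspace X \<Longrightarrow> f x \<in> topspace Y"
      "\<And>x i. x \<in> topspace X \<Longrightarrow> i \<in> \<A> \<Longrightarrow> x \<in> F i \<longleftrightarrow> f x \<in> G i"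
  shows "continuous_map X Y f"
proof -
  have "openin X {x \<in> topspace X. f x \<in> W}" if W: "openin Y W" for W
  proof (subst openin_subopen, intro ballI)
    fix x assume x: "x \<in> {x \<in> topspace X. f x \<in> W}"
    then obtain P where P: "clopenin Y P" "f x \<in> P" "P \<subseteq> W"
      using stone_space_clopenin_base [OF Y W, of "f x"] by auto
    then obtain i where i: "i \<in> \<A>" "G i = P" using G by (metis imageE mem_Collect_eq)
    have "clopenin X (F i)" using F i by blast
    then have "openin X (F i)" "F i \<subseteq> topspace X" by (auto simp: clopenin_def openin_subset)
    moreover have "x \<in> F i" using f(2) [of x i] x i P by simp
    moreover have "F i \<subseteq> {x \<in> topspace X. f x \<in> W}"
    proof
      fix w assume w: "w \<in> F i"
      then have "w \<in> topspace X" using \<open>F i \<subseteq> topspace X\<close> by blast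
      then show "w \<in> {x \<in> topspace X. f x \<in> W}" using f(2) [of w i] w i P by auto
    qed
    ultimately show "\<exists>T. openin X T \<and> x \<in> T \<and> T \<subseteq> {x \<in> topspace X. f x \<in> W}" by blast
  qed
  then show ?thesis using f(1) by (auto simp: continuous_map_def)
qed

text \<open>Stone duality with the isomorphism given by two surjections from one index set. Several
  indices may represent the same clopen set, so the algebra of end sets modulo bounded sets never
  has to be formed as a quotient.\<close>

lemma clopen_order_iso_homeomorphic:
  assumes X: "stone_space X" and Y: "stone_space Y"
    and F: "F ` \<A> = Collect (clopenin X)" and G: "G ` \<A> = Collect (clopenin Y)"
    and order: "\<And>i j. i \<in> \<A> \<Longrightarrow> j \<in> \<A> \<Longrightarrow> F i \<subseteq> F j \<longleftrightarrow> G i \<subseteq> G j"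
  shows "X homeomorphic_space Y"
proof -
  have cpt: "compact_space X" "compact_space Y" using X Y by (auto simp: stone_space_def)
  have "\<exists>y. y \<in> topspace Y \<and> (\<forall>i\<in>\<A>. x \<in> F i \<longleftrightarrow> y \<in> G i)" if "x \<in> topspace X" for x
    by (rule clopen_order_iso_point [OF cpt(2) F G order that]) auto
  then obtain f where f: "\<And>x. x \<in> topspace X \<Longrightarrow> f x \<in> topspace Y"
    "\<And>x i. x \<in> topspace X \<Longrightarrow> i \<in> \<A> \<Longrightarrow> x \<in> F i \<longleftrightarrow> f x \<in> G i"
    by metis
  have "\<exists>x. x \<in> topspace X \<and> (\<forall>i\<in>\<A>. y \<in> G i \<longleftrightarrow> x \<in> F i)" if "y \<in> topspace Y" for y
    by (rule clopen_order_iso_point [OF cpt(1) G F order [symmetric] that]) auto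
  then obtain g where g: "\<And>y. y \<in> topspace Y \<Longrightarrow> g y \<in> topspace X"
    "\<And>y i. y \<in> topspace Y \<Longrightarrow> i \<in> \<A> \<Longrightarrow> y \<in> G i \<longleftrightarrow> g y \<in> F i"
    by metis
  have "g (f x) = x" if x: "x \<in> topspace X" for x
  proof (rule ccontr)
    assume "g (f x) \<noteq> x"
    then obtain P where P: "clopenin X P" "g (f x) \<in> P" "x \<notin> P"
      using stone_space_separation [OF X] f(1) g(1) x by metis
    then obtain i where i: "i \<in> \<A>" "F i = P" using F by (metis imageE mem_Collect_eq)
    show False using f(2) [OF x i(1)] g(2) [OF f(1) [OF x] i(1)] P i by simp
  qed
  moreover have "f (g y) = y" if y: "y \<in> topspace Y" for y
  proof (rule ccontr)
    assume "f (g y) \<noteq> y"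
    then obtain P where P: "clopenin Y P" "f (g y) \<in> P" "y \<notin> P"
      using stone_space_separation [OF Y] f(1) g(1) y by metis
    then obtain i where i: "i \<in> \<A>" "G i = P" using G by (metis imageE mem_Collect_eq)
    show False using g(2) [OF y i(1)] f(2) [OF g(1) [OF y] i(1)] P i by simp
  qed
  moreover have "continuous_map X Y f"
    by (rule clopen_order_iso_continuous [OF Y F G f])
  moreover have "continuous_map Y X g"
    by (rule clopen_order_iso_continuous [OF X G F g])
  ultimately show ?thesis
    unfolding homeomorphic_space_def homeomorphic_maps_def by blast
qed

section \<open>Cancelling isolated points\<close>

lemma homeomorphic_map_swap_isolated:
  assumes b: "clopenin Y {b}" and c: "clopenin Y {c}"
  shows "homeomorphic_map Y Y (\<lambda>y. if y = b then c else if y = c then b else y)"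
    (is "homeomorphic_map Y Y ?s")
proof -
  have bc: "b \<in> topspace Y" "c \<in> topspace Y"
    using clopenin_subset [OF b] clopenin_subset [OF c] by auto
  have "openin Y {y \<in> topspace Y. ?s y \<in> W}" if W: "openin Y W" for W
  proof -
    have "{y \<in> topspace Y. ?s y \<in> W} =
        (W - ({b} \<union> {c})) \<union> ((if c \<in> W then {b} else {}) \<union> (if b \<in> W then {c} else {}))"
      using bc openin_subset [OF W] by auto
    moreover have "openin Y (W - ({b} \<union> {c}))"
      using b c W by (intro openin_diff closedin_Un) (auto simp: clopenin_def)
    moreover have "openin Y (if c \<in> W then {b} else {})" "openin Y (if b \<in> W then {c} else {})"
      using b c by (simp_all add: clopenin_def)
    ultimately show ?thesis by (simp only: openin_Un)
  qed
  then have "continuous_map Y Y ?s" using bc by (auto simp: continuous_map_def)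
  moreover have "?s (?s y) = y" for y by auto
  ultimately have "homeomorphic_maps Y Y ?s ?s" unfolding homeomorphic_maps_def by simp
  then show ?thesis by (rule homeomorphic_maps_imp_map)
qed

text \<open>A homeomorphism may send \<open>a\<close> to an isolated point other than
  \<open>b\<close>; following it by the exchange of these two points corrects this.\<close>

lemma homeomorphic_space_remove_isolated:
  assumes XY: "X homeomorphic_space Y" and a: "clopenin X {a}" and b: "clopenin Y {b}"
  shows "subtopology X (topspace X - {a}) homeomorphic_space subtopology Y (topspace Y - {b})"
proof -
  obtain h where h: "homeomorphic_map X Y h"
    using XY homeomorphic_space by blast
  have aX: "a \<in> topspace X" using clopenin_subset [OF a] by auto
  have "openin Y (h ` {a})" "closedin Y (h ` {a})"
    using homeomorphic_map_openness [OF h, of "{a}"] homeomorphic_map_closedness [OF h, of "{a}"] a aX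
    by (auto simp: clopenin_def)
  then have c: "clopenin Y {h a}" by (simp add: clopenin_def)
  define s where "s = (\<lambda>y. if y = b then h a else if y = h a then b else y)"
  have s: "homeomorphic_map Y Y s"
    unfolding s_def by (rule homeomorphic_map_swap_isolated [OF b c])
  have sh: "homeomorphic_map X Y (s \<circ> h)" by (rule homeomorphic_map_compose [OF h s])
  have sa: "(s \<circ> h) a = b" by (simp add: s_def)
  have inj: "inj_on (s \<circ> h) (topspace X)" and im: "(s \<circ> h) ` topspace X = topspace Y"
    using sh homeomorphic_imp_injective_map homeomorphic_imp_surjective_map by blast+
  have "(s \<circ> h) ` (topspace X - {a}) = (s \<circ> h) ` topspace X - (s \<circ> h) ` {a}"
    using inj aX by (intro inj_on_image_set_diff) auto
  then have "(s \<circ> h) ` (topspace X \<inter> (topspace X - {a})) = topspace Y \<inter> (topspace Y - {b})"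
    using im sa by (simp add: Int_absorb1 image_comp)
  from homeomorphic_map_subtopologies [OF sh this] show ?thesis
    using homeomorphic_space by blast
qed

text \<open>The clopen sets of this sum are pairs of a clopen set of \<open>X\<close> and a truth
  value for the new point, the form in which the ends of a collared set will be described.\<close>

definition add_point :: "'a topology \<Rightarrow> (bool \<times> 'a) topology" where
  "add_point X = sum_topology (\<lambda>b. if b then X else discrete_topology {undefined}) UNIV"

definition add_point_set :: "'a set \<Rightarrow> bool \<Rightarrow> (bool \<times> 'a) set" where
  "add_point_set A b = {True} \<times> A \<union> (if b then {(False, undefined)} else {})"

lemma add_point_set_subset:
  "add_point_set A b \<subseteq> add_point_set A' b' \<longleftrightarrow> A \<subseteq> A' \<and> (b \<longrightarrow> b')"
  by (auto simp: add_point_set_def)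

lemma openin_add_point:
  "openin (add_point X) U \<longleftrightarrow> (\<exists>A b. openin X A \<and> U = add_point_set A b)"
proof
  assume U: "openin (add_point X) U"
  define T where "T = {x. (True, x) \<in> U}"
  have T: "openin X T" "{x. (False, x) \<in> U} \<subseteq> {undefined}"
    using U unfolding add_point_def openin_sum_topology T_def
    by (auto dest: spec [of _ True] spec [of _ False])
  have "U = add_point_set T ((False, undefined) \<in> U)"
  proof (rule Set.set_eqI)
    fix z :: "bool \<times> 'a"
    obtain c x where z: "z = (c, x)" by (cases z)
    show "z \<in> U \<longleftrightarrow> z \<in> add_point_set T ((False, undefined) \<in> U)"
      using T(2) unfolding z add_point_set_def T_def by (cases c) auto
  qed
  then show "\<exists>A b. openin X A \<and> U = add_point_set A b" using T(1) by blast
next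
  assume "\<exists>A b. openin X A \<and> U = add_point_set A b"
  then obtain A b where U: "openin X A" "U = add_point_set A b" by blast
  have "{x. (True, x) \<in> U} = A" "{x. (False, x) \<in> U} \<subseteq> {undefined}"
    using U(2) by (auto simp: add_point_set_def split: if_splits)
  moreover have "U \<subseteq> Sigma UNIV (topspace \<circ> (\<lambda>b. if b then X else discrete_topology {undefined}))"
    using U openin_subset [OF U(1)] by (auto simp: add_point_set_def split: if_splits)
  ultimately show "openin (add_point X) U"
    using U(1) by (simp add: add_point_def openin_sum_topology)
qed

lemma topspace_add_point: "topspace (add_point X) = add_point_set (topspace X) True"
  unfolding add_point_def topspace_sum_topology add_point_set_def by (auto split: if_splits)

lemma clopenin_add_point:
  "clopenin (add_point X) U \<longleftrightarrow> (\<exists>A b. clopenin X A \<and> U = add_point_set A b)"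
proof -
  have compl: "topspace (add_point X) - add_point_set A b = add_point_set (topspace X - A) (\<not> b)" for A b
    unfolding topspace_add_point by (auto simp: add_point_set_def)
  have inj: "add_point_set A b = add_point_set A' b' \<longleftrightarrow> A = A' \<and> b = b'" for A b A' b'
    using add_point_set_subset [of A b A' b'] add_point_set_subset [of A' b' A b] by auto
  show ?thesis
  proof
    assume U: "clopenin (add_point X) U"
    then obtain A b where A: "openin X A" "U = add_point_set A b"
      by (auto simp: clopenin_def openin_add_point)
    have "openin (add_point X) (topspace (add_point X) - U)"
      using U by (auto simp: clopenin_def)
    then have "openin X (topspace X - A)"
      unfolding A(2) compl openin_add_point inj by blast
    then have "clopenin X A"
      using A(1) openin_subset [OF A(1)] by (simp add: clopenin_def closedin_def)
    then show "\<exists>A b. clopenin X A \<and> U = add_point_set A b" using A(2) by blast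
  next
    assume "\<exists>A b. clopenin X A \<and> U = add_point_set A b"
    then obtain A b where A: "clopenin X A" "U = add_point_set A b" by blast
    have "openin X A" "openin X (topspace X - A)" "A \<subseteq> topspace X"
      using A(1) by (auto simp: clopenin_def openin_subset)
    then have "openin (add_point X) U" "openin (add_point X) (add_point_set (topspace X - A) (\<not> b))"
      "U \<subseteq> topspace (add_point X)"
      unfolding A(2) openin_add_point topspace_add_point add_point_set_subset by blast+
    moreover have "topspace (add_point X) - U = add_point_set (topspace X - A) (\<not> b)"
      unfolding A(2) by (rule compl)
    ultimately show "clopenin (add_point X) U" by (simp add: clopenin_def closedin_def)
  qed
qed

lemma stone_space_add_point:
  assumes X: "stone_space X"
  shows "stone_space (add_point X)"
proof -
  let ?Y = "add_point X"
  have cl: "clopenin ?Y (add_point_set A b)" if "clopenin X A" for A b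
    using that clopenin_add_point by blast
  have "compact_space ?Y"
    unfolding compact_space_def
  proof -
    have "compactin ?Y (Pair True ` topspace X)"
    proof (rule image_compactin)
      show "compactin X (topspace X)"
        using X by (simp add: stone_space_def compact_space_def)
      show "continuous_map X ?Y (Pair True)"
        using continuous_map_component_injection
          [of True UNIV "\<lambda>b. if b then X else discrete_topology {undefined}"]
        by (simp add: add_point_def)
    qed
    moreover have "compactin ?Y {(False, undefined)}"
      by (simp add: topspace_add_point add_point_set_def)
    ultimately have "compactin ?Y (Pair True ` topspace X \<union> {(False, undefined)})"
      by (rule compactin_Un)
    moreover have "Pair True ` topspace X \<union> {(False, undefined)} = topspace ?Y"
      by (auto simp: topspace_add_point add_point_set_def)
    ultimately show "compactin ?Y (topspace ?Y)" by simp
  qed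
  moreover have "Hausdorff_space ?Y"
  proof -
    have sep: "\<exists>P. clopenin ?Y P \<and> x \<in> P \<and> y \<notin> P" if "x \<in> topspace ?Y" "y \<in> topspace ?Y" "x \<noteq> y" for x y
    proof (cases "fst x \<and> fst y")
      case True
      then have "snd x \<in> topspace X" "snd y \<in> topspace X" "snd x \<noteq> snd y"
        using that by (auto simp: topspace_add_point add_point_set_def prod_eq_iff)
      then obtain P where "clopenin X P" "snd x \<in> P" "snd y \<notin> P"
        by (rule stone_space_separation [OF X])
      moreover have "x \<in> add_point_set P False \<longleftrightarrow> snd x \<in> P" "y \<in> add_point_set P False \<longleftrightarrow> snd y \<in> P"
        using True by (cases x; cases y; simp add: add_point_set_def)+
      ultimately show ?thesis using cl [of P False] by blast
    next
      case False
      show ?thesis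
      proof (cases "fst x")
        case True
        then have "x \<in> add_point_set (topspace X) False" "y \<notin> add_point_set (topspace X) False"
          using False that by (auto simp: add_point_set_def topspace_add_point)
        then show ?thesis using cl [of "topspace X" False] by auto
      next
        case False
        then have "x \<in> add_point_set {} True" "y \<notin> add_point_set {} True"
          using that by (auto simp: add_point_set_def topspace_add_point)
        then show ?thesis using cl [of "{}" True] by auto
      qed
    qed
    show ?thesis
      unfolding Hausdorff_space_def
    proof (intro allI impI, elim conjE)
      fix x y assume xy: "x \<in> topspace ?Y" "y \<in> topspace ?Y" "x \<noteq> y"
      obtain P where P: "clopenin ?Y P" "x \<in> P" "y \<notin> P" using sep [OF xy] by blast
      have "openin ?Y P" "openin ?Y (topspace ?Y - P)"
        using P(1) clopenin_compl [OF P(1)] by (auto simp: clopenin_def)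
      then show "\<exists>U V. openin ?Y U \<and> openin ?Y V \<and> x \<in> U \<and> y \<in> V \<and> disjnt U V"
        using P xy by (intro exI [of _ P] exI [of _ "topspace ?Y - P"]) (auto simp: disjnt_def)
    qed
  qed
  moreover have "?Y dim_le 0"
    unfolding dimension_le_0_neighbourhood_base_of_clopen neighbourhood_base_of
  proof (intro allI impI, elim conjE)
    fix W x assume W: "openin ?Y W" "x \<in> W"
    then obtain A b where A: "openin X A" "W = add_point_set A b"
      using openin_add_point by blast
    have "\<exists>P. clopenin ?Y P \<and> x \<in> P \<and> P \<subseteq> W"
    proof (cases "fst x")
      case True
      then have "snd x \<in> A" using W(2) A(2) by (auto simp: add_point_set_def split: if_splits)
      then obtain P where P: "clopenin X P" "snd x \<in> P" "P \<subseteq> A"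
        by (rule stone_space_clopenin_base [OF X A(1)])
      then have "add_point_set P False \<subseteq> W" unfolding A(2) add_point_set_subset by simp
      moreover have "x \<in> add_point_set P False"
        using True P(2) by (cases x) (simp add: add_point_set_def)
      ultimately show ?thesis using cl [OF P(1)] by blast
    next
      case False
      then have "b" "x \<in> add_point_set {} True"
        using W(2) A(2) by (auto simp: add_point_set_def split: if_splits)
      then have "add_point_set {} True \<subseteq> W" unfolding A(2) add_point_set_subset by simp
      then show ?thesis using cl [of "{}" True] \<open>x \<in> add_point_set {} True\<close> by auto
    qed
    then obtain P where "clopenin ?Y P" "x \<in> P" "P \<subseteq> W" by blast
    then show "\<exists>U V. openin ?Y U \<and> (closedin ?Y V \<and> openin ?Y V) \<and> x \<in> U \<and> U \<subseteq> V \<and> V \<subseteq> W"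
      by (intro exI [of _ P]) (auto simp: clopenin_def)
  qed
  ultimately show ?thesis by (simp add: stone_space_def)
qed

lemma homeomorphic_space_add_point_cancel:
  assumes "add_point X homeomorphic_space add_point Y"
  shows "X homeomorphic_space Y"
proof -
  have cl: "clopenin (add_point Z) {(False, undefined)}" for Z :: "'c topology"
    unfolding clopenin_add_point by (intro exI [of _ "{}"] exI [of _ True]) (simp add: add_point_set_def)
  have rem: "Z homeomorphic_space subtopology (add_point Z) (topspace (add_point Z) - {(False, undefined)})"
    for Z :: "'c topology"
  proof -
    have "embedding_map Z (add_point Z) (Pair True)"
      using embedding_map_component_injection
        [of True UNIV "\<lambda>b. if b then Z else discrete_topology {undefined}"]
      by (simp add: add_point_def)
    moreover have "Pair True ` topspace Z = topspace (add_point Z) - {(False, undefined)}"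
      by (auto simp: topspace_add_point add_point_set_def)
    ultimately show ?thesis
      using embedding_map_imp_homeomorphic_space by metis
  qed
  show ?thesis
    using rem [of X] homeomorphic_space_remove_isolated [OF assms cl cl] rem [of Y]
    by (meson homeomorphic_space_sym homeomorphic_space_trans)
qed

text \<open>The pair of \<open>F i\<close> and \<open>\<beta> i\<close> is a clopen set of
  \<open>X\<close> with a point added, so the hypotheses identify the clopen algebras of the two
  enlarged spaces. Only the combined orders have to agree: the point added to \<open>X\<close> may
  correspond to an old point of \<open>Y\<close>.\<close>

lemma clopen_order_iso_homeomorphic_add_point:
  assumes X: "stone_space X" and Y: "stone_space Y"
    and F: "\<And>i. i \<in> \<A> \<Longrightarrow> clopenin X (F i)" "\<And>A b. clopenin X A \<Longrightarrow> \<exists>i\<in>\<A>. F i = A \<and> (\<beta> i \<longleftrightarrow> b)"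
    and G: "\<And>i. i \<in> \<A> \<Longrightarrow> clopenin Y (G i)" "\<And>A b. clopenin Y A \<Longrightarrow> \<exists>i\<in>\<A>. G i = A \<and> (\<gamma> i \<longleftrightarrow> b)"
    and order: "\<And>i j. i \<in> \<A> \<Longrightarrow> j \<in> \<A> \<Longrightarrow>
      F i \<subseteq> F j \<and> (\<beta> i \<longrightarrow> \<beta> j) \<longleftrightarrow> G i \<subseteq> G j \<and> (\<gamma> i \<longrightarrow> \<gamma> j)"
  shows "X homeomorphic_space Y"
proof -
  have im: "(\<lambda>i. add_point_set (H i) (\<delta> i)) ` \<A> = Collect (clopenin (add_point Z))"
    if H: "\<And>i. i \<in> \<A> \<Longrightarrow> clopenin Z (H i)" "\<And>A b. clopenin Z A \<Longrightarrow> \<exists>i\<in>\<A>. H i = A \<and> (\<delta> i \<longleftrightarrow> b)"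
    for Z :: "'d topology" and H \<delta>
  proof (intro equalityI subsetI)
    fix U assume "U \<in> (\<lambda>i. add_point_set (H i) (\<delta> i)) ` \<A>"
    then show "U \<in> Collect (clopenin (add_point Z))"
      using H(1) by (auto simp: clopenin_add_point)
  next
    fix U assume "U \<in> Collect (clopenin (add_point Z))"
    then obtain A b where A: "clopenin Z A" "U = add_point_set A b"
      by (auto simp: clopenin_add_point)
    then obtain i where "i \<in> \<A>" "H i = A" "\<delta> i = b" using H(2) by blast
    then show "U \<in> (\<lambda>i. add_point_set (H i) (\<delta> i)) ` \<A>" using A(2) by auto
  qed
  show ?thesis
  proof (rule homeomorphic_space_add_point_cancel, rule clopen_order_iso_homeomorphic)
    show "stone_space (add_point X)" "stone_space (add_point Y)"
      using X Y by (auto intro: stone_space_add_point)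
    show "(\<lambda>i. add_point_set (F i) (\<beta> i)) ` \<A> = Collect (clopenin (add_point X))"
      by (rule im [OF F])
    show "(\<lambda>i. add_point_set (G i) (\<gamma> i)) ` \<A> = Collect (clopenin (add_point Y))"
      by (rule im [OF G])
  qed (simp add: add_point_set_subset order)
qed

section \<open>Ends and sets with compact frontier\<close>

text \<open>Nothing is asked of \<open>V\<close> on \<open>K\<close>. This makes the end sets a
  Boolean algebra of sets in Hausdorff spaces, although neither \<open>V\<close> nor its complement
  need be open.\<close>

definition end_set :: "'m topology \<Rightarrow> 'm set \<Rightarrow> bool" where
  "end_set X V \<longleftrightarrow> V \<subseteq> topspace X \<and>
     (\<exists>K. compactin X K \<and> openin X (V - K) \<and> openin X (topspace X - V - K))"

definition bounded_in :: "'m topology \<Rightarrow> 'm set \<Rightarrow> bool" where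
  "bounded_in X V \<longleftrightarrow> (\<exists>K. compactin X K \<and> V \<subseteq> K)"

text \<open>
  \<open>end_model X E \<Lambda>\<close> says that \<open>E\<close> is the space of ends of \<open>X\<close> in the sense of Stone duality: the clopen
  subsets of \<open>E\<close> are, via \<open>\<Lambda>\<close>, the subsets of \<open>X\<close> with compact frontier modulo relatively compact ones.
  This notion restricts to open subsets of \<open>X\<close> and is transported by homeomorphisms, whereas
  \<^const>\<open>ends_space\<close> is not easily compared with the ends of a subspace.
\<close>

definition end_model :: "'m topology \<Rightarrow> 'e topology \<Rightarrow> ('m set \<Rightarrow> 'e set) \<Rightarrow> bool" where
  "end_model X E \<Lambda> \<longleftrightarrow>
     (\<forall>V. end_set X V \<longrightarrow> clopenin E (\<Lambda> V)) \<and>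
     (\<forall>A. clopenin E A \<longrightarrow> (\<exists>V. end_set X V \<and> \<Lambda> V = A)) \<and>
     (\<forall>U V. end_set X U \<longrightarrow> end_set X V \<longrightarrow> (\<Lambda> U \<subseteq> \<Lambda> V \<longleftrightarrow> bounded_in X (U - V)))"

lemma bounded_in_subset: "bounded_in X V \<Longrightarrow> U \<subseteq> V \<Longrightarrow> bounded_in X U"
  unfolding bounded_in_def by blast

lemma bounded_in_Un: "bounded_in X U \<Longrightarrow> bounded_in X V \<Longrightarrow> bounded_in X (U \<union> V)"
  unfolding bounded_in_def by (meson Un_mono compactin_Un)

lemma bounded_in_Union:
  "finite \<U> \<Longrightarrow> (\<And>U. U \<in> \<U> \<Longrightarrow> bounded_in X U) \<Longrightarrow> bounded_in X (\<Union>\<U>)"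
proof (induction \<U> rule: finite_induct)
  case empty
  have "compactin X {}" by simp
  then show ?case unfolding bounded_in_def by blast
next
  case (insert U \<U>)
  then show ?case using bounded_in_Un [of X U "\<Union>\<U>"] by simp
qed

lemma bounded_in_compactin: "compactin X K \<Longrightarrow> bounded_in X K"
  unfolding bounded_in_def by blast

lemma bounded_in_empty [simp]: "bounded_in X {}"
  unfolding bounded_in_def using compactin_empty by blast

lemma end_set_witness_mono:
  assumes "Hausdorff_space X" "V \<subseteq> topspace X" "K \<subseteq> L" "compactin X L"
    and "openin X (V - K)" "openin X (topspace X - V - K)"
  shows "openin X (V - L)" "openin X (topspace X - V - L)"
proof -
  have L: "closedin X L" using assms compactin_imp_closedin by blast
  have "V - L = (V - K) - L" "topspace X - V - L = (topspace X - V - K) - L"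
    using assms(3) by blast+
  then show "openin X (V - L)" "openin X (topspace X - V - L)"
    using openin_diff [OF assms(5) L] openin_diff [OF assms(6) L] by simp_all
qed

lemma end_set_common_witness:
  assumes X: "Hausdorff_space X" and U: "end_set X U" and V: "end_set X V"
  obtains K where "compactin X K" "openin X (U - K)" "openin X (topspace X - U - K)"
    "openin X (V - K)" "openin X (topspace X - V - K)"
proof -
  obtain K where K: "compactin X K" "openin X (U - K)" "openin X (topspace X - U - K)"
    using U by (auto simp: end_set_def)
  obtain L where L: "compactin X L" "openin X (V - L)" "openin X (topspace X - V - L)"
    using V by (auto simp: end_set_def)
  have KL: "compactin X (K \<union> L)" using K L by (simp add: compactin_Un)
  have "U \<subseteq> topspace X" "V \<subseteq> topspace X" using U V by (auto simp: end_set_def)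
  then show thesis
    using that [OF KL] end_set_witness_mono [OF X _ Un_upper1 KL K(2,3)]
      end_set_witness_mono [OF X _ Un_upper2 KL L(2,3)] by simp
qed

lemma end_set_compl: "end_set X V \<Longrightarrow> end_set X (topspace X - V)"
proof -
  assume V: "end_set X V"
  then have "topspace X - (topspace X - V) = V" by (auto simp: end_set_def)
  then show ?thesis using V unfolding end_set_def by auto
qed

lemma end_set_Int:
  assumes X: "Hausdorff_space X" and U: "end_set X U" and V: "end_set X V"
  shows "end_set X (U \<inter> V)"
proof -
  obtain K where K: "compactin X K" "openin X (U - K)" "openin X (topspace X - U - K)"
    "openin X (V - K)" "openin X (topspace X - V - K)"
    by (rule end_set_common_witness [OF X U V])
  have "U \<inter> V - K = (U - K) \<inter> (V - K)"
    "topspace X - U \<inter> V - K = (topspace X - U - K) \<union> (topspace X - V - K)"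
    by blast+
  then have "openin X (U \<inter> V - K)" "openin X (topspace X - U \<inter> V - K)"
    using openin_Int [OF K(2,4)] openin_Un [OF K(3,5)] by simp_all
  moreover have "U \<inter> V \<subseteq> topspace X" using U by (auto simp: end_set_def)
  ultimately show ?thesis using K(1) unfolding end_set_def by blast
qed

lemma end_set_Diff:
  assumes X: "Hausdorff_space X" and U: "end_set X U" and V: "end_set X V"
  shows "end_set X (U - V)"
proof -
  have "U - V = U \<inter> (topspace X - V)" using U by (auto simp: end_set_def)
  then show ?thesis using end_set_Int [OF X U end_set_compl [OF V]] by simp
qed

lemma end_set_Un:
  assumes X: "Hausdorff_space X" and U: "end_set X U" and V: "end_set X V"
  shows "end_set X (U \<union> V)"
proof -
  have "U \<union> V = topspace X - (topspace X - U - V)"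
    using U V by (auto simp: end_set_def)
  then show ?thesis
    using end_set_compl [OF end_set_Diff [OF X end_set_compl [OF U] V]] by simp
qed

lemma end_set_empty [simp]: "end_set X {}"
  unfolding end_set_def by (auto intro!: exI [of _ "{}"])

lemma end_set_topspace [simp]: "end_set X (topspace X)"
  using end_set_compl [of X "{}"] by simp

lemma end_set_Union:
  assumes "Hausdorff_space X"
  shows "finite \<U> \<Longrightarrow> (\<And>U. U \<in> \<U> \<Longrightarrow> end_set X U) \<Longrightarrow> end_set X (\<Union>\<U>)"
proof (induction \<U> rule: finite_induct)
  case (insert U \<U>)
  then show ?case using end_set_Un [OF assms, of U "\<Union>\<U>"] by simp
qed simp

lemma connectedin_clopen_subset:
  assumes "connectedin X S" "openin X U" "openin X V" "S \<subseteq> U \<union> V" "U \<inter> V \<inter> S = {}"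
  shows "S \<subseteq> U \<or> S \<inter> U = {}"
proof (rule ccontr)
  assume "\<not> ?thesis"
  then have "S \<inter> U \<noteq> {}" "S \<inter> V \<noteq> {}" using assms(4) by blast+
  then show False using assms unfolding connectedin by blast
qed

definition exhaustion :: "'m topology \<Rightarrow> (nat \<Rightarrow> 'm set) \<Rightarrow> bool" where
  "exhaustion X K \<longleftrightarrow> (\<forall>n. compactin X (K n)) \<and>
     (\<forall>n. \<exists>U. openin X U \<and> K n \<subseteq> U \<and> U \<subseteq> K (Suc n)) \<and>
     (\<forall>L. compactin X L \<longrightarrow> (\<exists>n. L \<subseteq> K n))"

abbreviation compl_components :: "'m topology \<Rightarrow> 'm set \<Rightarrow> 'm set set" where
  "compl_components X K \<equiv> connected_components_of (subtopology X (topspace X - K))"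

lemma compl_componentsD:
  assumes "C \<in> compl_components X K"
  shows "C \<noteq> {}" "connectedin X C" "C \<subseteq> topspace X - K"
  using nonempty_connected_components_of [OF assms] connectedin_connected_components_of [OF assms]
  by (auto simp: connectedin_subtopology)

lemma compl_components_maximal:
  assumes "C \<in> compl_components X K" "connectedin X T" "T \<subseteq> topspace X - K" "T \<inter> C \<noteq> {}"
  shows "T \<subseteq> C"
  using connected_components_of_maximal [OF assms(1), of T] assms(2-)
  by (auto simp: connectedin_subtopology disjnt_def)

lemma compl_components_eq:
  assumes "C \<in> compl_components X K" "D \<in> compl_components X K" "C \<inter> D \<noteq> {}"
  shows "C = D"
  using connected_components_of_overlap [OF assms(1,2)] assms(3) by simp

lemma Union_compl_components: "\<Union>(compl_components X K) = topspace X - K"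
  unfolding Union_connected_components_of by auto

lemma compl_components_superset:
  assumes "connectedin X T" "T \<subseteq> topspace X - K" "T \<noteq> {}"
  obtains C where "C \<in> compl_components X K" "T \<subseteq> C"
proof -
  obtain x where x: "x \<in> T" using assms(3) by blast
  then obtain C where C: "C \<in> compl_components X K" "x \<in> C"
    using Union_compl_components [of X K] assms(2) by blast
  then have "T \<subseteq> C" using compl_components_maximal [OF C(1) assms(1,2)] x by blast
  then show thesis using that C(1) by simp
qed

lemma openin_compl_components:
  assumes "Hausdorff_space X" "locally_connected_space X" "compactin X K" "C \<in> compl_components X K"
  shows "openin X C"
proof -
  have "closedin X K" using assms compactin_imp_closedin by blast
  then have "openin X (topspace X - K)" by blast
  then show ?thesis
    using assms(2,4) unfolding locally_connected_space_open_connected_components by blast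
qed

lemma end_set_compl_component:
  assumes "Hausdorff_space X" "locally_connected_space X" "compactin X K" "C \<in> compl_components X K"
  shows "end_set X C"
proof -
  have op: "openin X D" if "D \<in> compl_components X K" for D
    by (rule openin_compl_components [OF assms(1-3) that])
  have "C - K = C" using compl_componentsD(3) [OF assms(4)] by blast
  moreover have "topspace X - C - K = \<Union>(compl_components X K - {C})"
  proof -
    have "\<Union>(compl_components X K - {C}) = topspace (subtopology X (topspace X - K)) - C"
      using complement_connected_components_of_Union [OF assms(4)] by simp
    then show ?thesis by auto
  qed
  moreover have "openin X (\<Union>(compl_components X K - {C}))"
    using op by (intro openin_Union) blast
  ultimately have "openin X (C - K)" "openin X (topspace X - C - K)"
    using op [OF assms(4)] by simp_all
  moreover have "C \<subseteq> topspace X" using compl_componentsD(3) [OF assms(4)] by blast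
  ultimately show ?thesis using assms(3) unfolding end_set_def by blast
qed

lemma compl_component_end_set:
  assumes "C \<in> compl_components X L" "openin X (V - K)" "openin X (topspace X - V - K)" "K \<subseteq> L"
  shows "C \<subseteq> V \<or> C \<inter> V = {}"
proof -
  have "C \<subseteq> (V - K) \<union> (topspace X - V - K)"
    using compl_componentsD(3) [OF assms(1)] assms(4) by blast
  then have "C \<subseteq> V - K \<or> C \<inter> (V - K) = {}"
    using connectedin_clopen_subset [OF compl_componentsD(2) [OF assms(1)] assms(2,3)] by blast
  then show ?thesis using compl_componentsD(3) [OF assms(1)] assms(4) by blast
qed

section \<open>Clopen sets in the space of ends\<close>

lemma topspace_ends_space:
  "\<epsilon> \<in> topspace (ends_space X) \<longleftrightarrow> \<epsilon> \<in> extensional {K. compactin X K} \<and>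
    (\<forall>K. compactin X K \<longrightarrow> \<epsilon> K \<in> compl_components X K) \<and>
    (\<forall>K L. compactin X K \<and> compactin X L \<and> K \<subseteq> L \<longrightarrow> \<epsilon> L \<subseteq> \<epsilon> K)"
  unfolding ends_space_def topspace_subtopology topspace_product_topology
  by (auto simp: PiE_iff)

definition ends_in :: "'m topology \<Rightarrow> 'm set \<Rightarrow> ('m set \<Rightarrow> 'm set) set" where
  "ends_in X V = {\<epsilon> \<in> topspace (ends_space X). \<exists>K. compactin X K \<and> \<epsilon> K \<subseteq> V}"

lemma ends_space_meet:
  assumes "\<epsilon> \<in> topspace (ends_space X)" "compactin X K" "compactin X L"
  shows "\<epsilon> K \<inter> \<epsilon> L \<noteq> {}" "\<epsilon> (K \<union> L) \<subseteq> \<epsilon> K \<inter> \<epsilon> L"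
proof -
  have KL: "compactin X (K \<union> L)" using assms by (simp add: compactin_Un)
  then show "\<epsilon> (K \<union> L) \<subseteq> \<epsilon> K \<inter> \<epsilon> L"
    using assms unfolding topspace_ends_space by (metis Int_greatest Un_upper1 Un_upper2)
  moreover have "\<epsilon> (K \<union> L) \<noteq> {}"
    using assms(1) KL compl_componentsD(1) unfolding topspace_ends_space by metis
  ultimately show "\<epsilon> K \<inter> \<epsilon> L \<noteq> {}" by blast
qed

text \<open>Any two values of an end meet, and the component \<open>\<epsilon> K\<close> cannot
  cross the frontier of \<open>V\<close>; so any one witness \<open>K\<close> decides whether the
  end lies in \<open>V\<close>.\<close>

lemma ends_in_iff:
  assumes \<epsilon>: "\<epsilon> \<in> topspace (ends_space X)" and K: "compactin X K"
    and V: "openin X (V - K)" "openin X (topspace X - V - K)"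
  shows "\<epsilon> \<in> ends_in X V \<longleftrightarrow> \<epsilon> K \<subseteq> V" "\<epsilon> K \<subseteq> V \<or> \<epsilon> K \<inter> V = {}"
proof -
  have C: "\<epsilon> K \<in> compl_components X K" using \<epsilon> K by (simp add: topspace_ends_space)
  show d: "\<epsilon> K \<subseteq> V \<or> \<epsilon> K \<inter> V = {}"
    by (rule compl_component_end_set [OF C V subset_refl])
  show "\<epsilon> \<in> ends_in X V \<longleftrightarrow> \<epsilon> K \<subseteq> V"
  proof
    assume "\<epsilon> \<in> ends_in X V"
    then obtain L where L: "compactin X L" "\<epsilon> L \<subseteq> V" by (auto simp: ends_in_def)
    then show "\<epsilon> K \<subseteq> V" using d ends_space_meet(1) [OF \<epsilon> K L(1)] by blast
  next
    assume "\<epsilon> K \<subseteq> V"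
    then show "\<epsilon> \<in> ends_in X V" using \<epsilon> K by (auto simp: ends_in_def)
  qed
qed

lemma openin_ends_space_coordinate:
  assumes K: "compactin X K"
  shows "openin (ends_space X) {\<epsilon> \<in> topspace (ends_space X). \<epsilon> K \<in> \<C>}"
proof -
  let ?P = "product_topology (\<lambda>K. discrete_topology (compl_components X K)) {K. compactin X K}"
  have "continuous_map ?P (discrete_topology (compl_components X K)) (\<lambda>\<epsilon>. \<epsilon> K)"
    using K by (intro continuous_map_product_projection) simp
  then have "continuous_map (ends_space X) (discrete_topology (compl_components X K)) (\<lambda>\<epsilon>. \<epsilon> K)"
    unfolding ends_space_def by (rule continuous_map_from_subtopology)
  then have "openin (ends_space X) {\<epsilon> \<in> topspace (ends_space X). \<epsilon> K \<in> compl_components X K \<inter> \<C>}"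
    by (rule openin_continuous_map_preimage) simp
  moreover have "{\<epsilon> \<in> topspace (ends_space X). \<epsilon> K \<in> compl_components X K \<inter> \<C>} =
      {\<epsilon> \<in> topspace (ends_space X). \<epsilon> K \<in> \<C>}"
    using K by (auto simp: topspace_ends_space)
  ultimately show ?thesis by simp
qed

text \<open>A basic open set of the product restricts finitely many coordinates, and by coherence
  all of them are determined by the coordinate at the union of these compact sets.\<close>

lemma openin_ends_space_basic:
  assumes W: "openin (ends_space X) W" and \<epsilon>: "\<epsilon> \<in> W"
  obtains K where "compactin X K"
    "\<And>\<delta>. \<delta> \<in> topspace (ends_space X) \<Longrightarrow> \<delta> K = \<epsilon> K \<Longrightarrow> \<delta> \<in> W"
proof -
  let ?I = "{K. compactin X K}"
  let ?P = "product_topology (\<lambda>K. discrete_topology (compl_components X K)) ?I"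
  let ?coh = "{\<epsilon>. \<forall>K L. compactin X K \<and> compactin X L \<and> K \<subseteq> L \<longrightarrow> \<epsilon> L \<subseteq> \<epsilon> K}"
  obtain T where T: "openin ?P T" "W = T \<inter> ?coh"
    using W unfolding ends_space_def openin_subtopology by blast
  have \<epsilon>S: "\<epsilon> \<in> topspace (ends_space X)" using openin_subset [OF W] \<epsilon> by blast
  have "\<epsilon> \<in> T" using \<epsilon> T(2) by blast
  from bspec [OF T(1) [unfolded openin_product_topology_alt] this]
  obtain U where U: "finite {i \<in> ?I. U i \<noteq> topspace (discrete_topology (compl_components X i))}"
    "\<epsilon> \<in> PiE ?I U" "PiE ?I U \<subseteq> T"
    by blast
  define J where "J = {i \<in> ?I. U i \<noteq> compl_components X i}"
  have J: "finite J" using U(1) by (simp add: J_def)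
  have KJ: "compactin X (\<Union>J)"
    using J by (intro compactin_Union) (auto simp: J_def)
  have "\<delta> \<in> W" if \<delta>: "\<delta> \<in> topspace (ends_space X)" "\<delta> (\<Union>J) = \<epsilon> (\<Union>J)" for \<delta>
  proof -
    have "\<delta> i \<in> U i" if i: "compactin X i" for i
    proof (cases "i \<in> J")
      case True
      have sub: "i \<subseteq> \<Union>J" using True by blast
      have "\<delta> (\<Union>J) \<subseteq> \<delta> i" "\<epsilon> (\<Union>J) \<subseteq> \<epsilon> i"
        using \<delta>(1) \<epsilon>S sub KJ i unfolding topspace_ends_space by blast+
      moreover have C: "\<delta> i \<in> compl_components X i" "\<epsilon> i \<in> compl_components X i"
        "\<epsilon> (\<Union>J) \<in> compl_components X (\<Union>J)"
        using \<delta>(1) \<epsilon>S i KJ by (auto simp: topspace_ends_space)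
      ultimately have "\<delta> i \<inter> \<epsilon> i \<noteq> {}" using compl_componentsD(1) [OF C(3)] \<delta>(2) by auto
      then have "\<delta> i = \<epsilon> i" by (rule compl_components_eq [OF C(1,2)])
      then show ?thesis using U(2) i by (auto simp: PiE_iff)
    next
      case False
      then show ?thesis using \<delta>(1) i by (auto simp: J_def topspace_ends_space)
    qed
    then have "\<delta> \<in> PiE ?I U" using \<delta>(1) by (auto simp: PiE_iff topspace_ends_space)
    then have "\<delta> \<in> T" using U(3) by (rule subsetD [rotated])
    moreover have "\<delta> \<in> ?coh" using \<delta>(1) by (simp add: topspace_ends_space)
    ultimately show ?thesis using T(2) by simp
  qed
  then show thesis using that [OF KJ] by simp
qed

text \<open>The set \<open>L - U\<close> is a compact shell around \<open>K\<close>. A component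
  that leaves \<open>L\<close> without meeting the shell would be clopen in \<open>X\<close>. So the
  components in question all meet the shell, which finitely many of the disjoint open components
  cover.\<close>

lemma finite_unbounded_compl_components:
  assumes X: "connected_space X" "Hausdorff_space X" "locally_connected_space X"
    and K: "compactin X K" and L: "compactin X L" and U: "openin X U" "K \<subseteq> U" "U \<subseteq> L"
  shows "finite {D \<in> compl_components X K. \<not> D \<subseteq> L}"
proof (cases "\<exists>D\<in>compl_components X K. D = topspace X")
  \<comment> \<open>Here \<open>K\<close> is empty and the whole space is the only component; the
    clopen argument below needs this case excluded.\<close>
  case True
  then have "{D \<in> compl_components X K. \<not> D \<subseteq> L} \<subseteq> {topspace X}"
    using compl_components_eq compl_componentsD(1,3) by fastforce
  then show ?thesis by (rule finite_subset) simp
next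
  case False
  have clL: "closedin X L" using L X(2) compactin_imp_closedin by blast
  have op: "openin X D" if "D \<in> compl_components X K" for D
    by (rule openin_compl_components [OF X(2,3) K that])
  have meet: "D \<inter> (L - U) \<noteq> {}" if D: "D \<in> compl_components X K" "\<not> D \<subseteq> L" for D
  proof
    assume 0: "D \<inter> (L - U) = {}"
    have "D \<subseteq> U \<union> (topspace X - L)" using 0 compl_componentsD(3) [OF D(1)] by blast
    moreover have "U \<inter> (topspace X - L) \<inter> D = {}" using U(3) by blast
    moreover have "openin X (topspace X - L)" using clL by blast
    ultimately have "D \<subseteq> U \<or> D \<inter> U = {}"
      using connectedin_clopen_subset [OF compl_componentsD(2) [OF D(1)] U(1)] by blast
    then have DL: "D \<inter> U = {}" using D(2) U(3) by blast
    have "topspace X - D = U \<union> \<Union>(compl_components X K - {D})"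
    proof -
      have "\<Union>(compl_components X K - {D}) = topspace (subtopology X (topspace X - K)) - D"
        using complement_connected_components_of_Union [OF D(1)] by simp
      then show ?thesis using DL U(2) openin_subset [OF U(1)] by auto
    qed
    moreover have "openin X (U \<union> \<Union>(compl_components X K - {D}))"
      using op U(1) by (intro openin_Un openin_Union) auto
    ultimately have "closedin X D"
      using compl_componentsD(3) [OF D(1)] unfolding closedin_def by auto
    then have "D = {} \<or> D = topspace X"
      using X(1) op [OF D(1)] unfolding connected_space_clopen_in by blast
    then show False using False D(1) compl_componentsD(1) [OF D(1)] by blast
  qed
  have "closedin X (L - U)" using clL U(1) by (rule closedin_diff)
  then have "compactin X (L - U)" using L by (meson Diff_subset closed_compactin)
  moreover have "\<forall>D\<in>compl_components X K. openin X D" using op by blast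
  moreover have "L - U \<subseteq> \<Union>(compl_components X K)"
    unfolding Union_compl_components using U(2) compactin_subset_topspace [OF L] by blast
  ultimately obtain \<F> where \<F>: "finite \<F>" "\<F> \<subseteq> compl_components X K" "L - U \<subseteq> \<Union>\<F>"
    unfolding compactin_def by meson
  have "{D \<in> compl_components X K. \<not> D \<subseteq> L} \<subseteq> \<F>"
  proof
    fix D assume "D \<in> {D \<in> compl_components X K. \<not> D \<subseteq> L}"
    then have D: "D \<in> compl_components X K" "\<not> D \<subseteq> L" by simp_all
    obtain x where x: "x \<in> D" "x \<in> L - U" using meet [OF D] by blast
    then obtain C where C: "C \<in> \<F>" "x \<in> C" using \<F>(3) by blast
    have "D = C"
      by (rule compl_components_eq [OF D(1)]) (use C x \<F>(2) in auto)
    then show "D \<in> \<F>" using C(1) by simp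
  qed
  then show ?thesis using \<F>(1) by (rule finite_subset)
qed

text \<open>Only finitely many components leave \<open>K (Suc n)\<close>. If those inside
  \<open>Y\<close> were all bounded, they would cover \<open>Y\<close> together with
  \<open>K (Suc n)\<close> and \<open>K n\<close>, and \<open>Y\<close> would be bounded.\<close>

lemma exhaustion_unbounded_component:
  assumes X: "connected_space X" "Hausdorff_space X" "locally_connected_space X"
    and K: "exhaustion X K" and Y: "Y \<subseteq> topspace X" "\<not> bounded_in X Y"
    and sat: "\<And>D. D \<in> compl_components X (K n) \<Longrightarrow> D \<subseteq> Y \<or> D \<inter> Y = {}"
  shows "\<exists>D\<in>compl_components X (K n). D \<subseteq> Y \<and> \<not> bounded_in X D"
proof (rule ccontr)
  assume "\<not> ?thesis"
  then have bd: "bounded_in X D" if "D \<in> compl_components X (K n)" "D \<subseteq> Y" for D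
    using that by blast
  have cK: "compactin X (K n)" for n using K by (simp add: exhaustion_def)
  obtain U where U: "openin X U" "K n \<subseteq> U" "U \<subseteq> K (Suc n)"
    using K unfolding exhaustion_def by blast
  let ?D = "{D \<in> compl_components X (K n). \<not> D \<subseteq> K (Suc n)}"
  let ?Y = "{D \<in> ?D. D \<subseteq> Y}"
  have "finite ?D"
    by (rule finite_unbounded_compl_components [OF X cK cK U])
  then have "finite ?Y" by (rule rev_finite_subset) blast
  then have "bounded_in X (\<Union>?Y)"
    using bd by (intro bounded_in_Union) auto
  moreover have "bounded_in X (K n \<union> K (Suc n))"
    using cK by (intro bounded_in_compactin compactin_Un)
  ultimately have "bounded_in X (\<Union>?Y \<union> (K n \<union> K (Suc n)))"
    by (rule bounded_in_Un)
  moreover have "Y \<subseteq> \<Union>?Y \<union> (K n \<union> K (Suc n))"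
  proof
    fix y assume y: "y \<in> Y"
    show "y \<in> \<Union>?Y \<union> (K n \<union> K (Suc n))"
    proof (cases "y \<in> K n")
      case False
      then have "y \<in> \<Union>(compl_components X (K n))"
        unfolding Union_compl_components using y Y(1) by blast
      then obtain D where D: "D \<in> compl_components X (K n)" "y \<in> D" by blast
      then have "D \<subseteq> Y" using sat [OF D(1)] y by blast
      then show ?thesis using D by blast
    qed simp
  qed
  ultimately show False using Y(2) bounded_in_subset by blast
qed

text \<open>Koenig's lemma along the exhaustion, the branching being finite by the preceding lemmas.\<close>

lemma ends_in_nonempty:
  assumes X: "connected_space X" "Hausdorff_space X" "locally_connected_space X"
    and K: "exhaustion X K" and Y: "end_set X Y" "\<not> bounded_in X Y"
  shows "ends_in X Y \<noteq> {}"
proof -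
  have cK: "compactin X (K n)" for n using K by (simp add: exhaustion_def)
  have mono: "K m \<subseteq> K n" if "m \<le> n" for m n
    using that
  proof (rule lift_Suc_mono_le [rotated])
    show "K n \<subseteq> K (Suc n)" for n using K unfolding exhaustion_def by blast
  qed
  obtain L where L: "compactin X L" "openin X (Y - L)" "openin X (topspace X - Y - L)"
    using Y(1) by (auto simp: end_set_def)
  \<comment> \<open>Starting beyond the witness \<open>L\<close> makes every component lie on one
    side of \<open>Y\<close>.\<close>
  obtain n0 where n0: "L \<subseteq> K n0" using K L(1) unfolding exhaustion_def by blast
  let ?C = "\<lambda>n. compl_components X (K (n0 + n))"
  have "\<exists>D. \<forall>n. (D n \<in> ?C n \<and> D n \<subseteq> Y \<and> \<not> bounded_in X (D n)) \<and> D (Suc n) \<subseteq> D n"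
  proof (rule dependent_nat_choice)
    have "Y \<subseteq> topspace X" using Y(1) by (simp add: end_set_def)
    moreover have "C \<subseteq> Y \<or> C \<inter> Y = {}" if "C \<in> compl_components X (K n0)" for C
      by (rule compl_component_end_set [OF that L(2,3) n0])
    ultimately have "\<exists>D\<in>compl_components X (K n0). D \<subseteq> Y \<and> \<not> bounded_in X D"
      by (intro exhaustion_unbounded_component [OF X K _ Y(2)])
    then show "\<exists>D. D \<in> ?C 0 \<and> D \<subseteq> Y \<and> \<not> bounded_in X D" by auto
  next
    fix D n assume D: "D \<in> ?C n \<and> D \<subseteq> Y \<and> \<not> bounded_in X D"
    have DX: "D \<subseteq> topspace X" using D compl_componentsD(3) by blast
    have sat: "C \<subseteq> D \<or> C \<inter> D = {}" if C: "C \<in> compl_components X (K (n0 + Suc n))" for C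
    proof (rule ccontr)
      assume 0: "\<not> (C \<subseteq> D \<or> C \<inter> D = {})"
      have "C \<subseteq> topspace X - K (n0 + n)"
        using compl_componentsD(3) [OF C] mono [of "n0 + n" "n0 + Suc n"] by auto
      then show False
        using compl_components_maximal [of D X "K (n0 + n)" C] compl_componentsD(2) [OF C] D 0 by blast
    qed
    have "\<exists>D'\<in>compl_components X (K (n0 + Suc n)). D' \<subseteq> D \<and> \<not> bounded_in X D'"
      by (rule exhaustion_unbounded_component [OF X K DX _ sat]) (use D in auto)
    then show "\<exists>D'. (D' \<in> ?C (Suc n) \<and> D' \<subseteq> Y \<and> \<not> bounded_in X D') \<and> D' \<subseteq> D"
      using D by blast
  qed
  then obtain D where D: "\<And>n. D n \<in> ?C n" "\<And>n. D n \<subseteq> Y" "\<And>n. D (Suc n) \<subseteq> D n" by blast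
  have anti: "D n \<subseteq> D m" if "m \<le> n" for m n
    using that by (rule lift_Suc_antimono_le [of D, rotated]) (rule D(3))
  have meet: "A \<inter> B \<noteq> {}" if "D m \<subseteq> A" "D n \<subseteq> B" for A B m n
  proof -
    have "D (max m n) \<subseteq> A \<inter> B" using that anti [of m "max m n"] anti [of n "max m n"] by auto
    then show ?thesis using compl_componentsD(1) [OF D(1) [of "max m n"]] by auto
  qed
  \<comment> \<open>An end also needs values at compact sets outside the exhaustion: a component
    containing some \<open>D m\<close>. As the \<open>D m\<close> are nested, any two such
    components meet, which gives coherence.\<close>
  define P where "P = (\<lambda>M C. C \<in> compl_components X M \<and> (\<exists>m. D m \<subseteq> C))"
  have exP: "\<exists>C. P M C" if M: "compactin X M" for M
  proof -
    obtain m where "M \<subseteq> K m" using K M unfolding exhaustion_def by blast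
    then have "M \<subseteq> K (n0 + m)" using mono [of m "n0 + m"] by auto
    then have "D m \<subseteq> topspace X - M" using compl_componentsD(3) [OF D(1) [of m]] by blast
    then obtain C where "C \<in> compl_components X M" "D m \<subseteq> C"
      by (rule compl_components_superset [OF compl_componentsD(2) [OF D(1)] _ compl_componentsD(1) [OF D(1)]])
    then show ?thesis unfolding P_def by blast
  qed
  define \<epsilon> where "\<epsilon> = (\<lambda>M. if compactin X M then SOME C. P M C else undefined)"
  have \<epsilon>P: "P M (\<epsilon> M)" if "compactin X M" for M
    using someI_ex [OF exP [OF that]] that by (simp add: \<epsilon>_def)
  have "\<epsilon> \<in> topspace (ends_space X)"
    unfolding topspace_ends_space
  proof (intro conjI allI impI, goal_cases)
    case 1
    show ?case by (simp add: extensional_def \<epsilon>_def)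
  next
    case (2 M)
    then show ?case using \<epsilon>P [of M] by (simp add: P_def)
  next
    case (3 M N)
    then have MN: "P M (\<epsilon> M)" "P N (\<epsilon> N)" "M \<subseteq> N" using \<epsilon>P by auto
    obtain m n where mn: "D m \<subseteq> \<epsilon> M" "D n \<subseteq> \<epsilon> N" using MN(1,2) by (auto simp: P_def)
    have C: "\<epsilon> M \<in> compl_components X M" "\<epsilon> N \<in> compl_components X N" using MN(1,2) by (auto simp: P_def)
    show ?case
    proof (rule compl_components_maximal [OF C(1) compl_componentsD(2) [OF C(2)]])
      show "\<epsilon> N \<subseteq> topspace X - M" using compl_componentsD(3) [OF C(2)] MN(3) by blast
      show "\<epsilon> N \<inter> \<epsilon> M \<noteq> {}" by (rule meet [OF mn(2,1)])
    qed
  qed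
  moreover have "\<epsilon> (K n0) \<subseteq> Y"
  proof -
    have "P (K n0) (\<epsilon> (K n0))" by (rule \<epsilon>P [OF cK])
    then obtain m where m: "D m \<subseteq> \<epsilon> (K n0)" "\<epsilon> (K n0) \<in> compl_components X (K n0)"
      by (auto simp: P_def)
    have "D 0 \<in> compl_components X (K n0)" using D(1) [of 0] by simp
    then have "\<epsilon> (K n0) = D 0"
      by (rule compl_components_eq [OF m(2)]) (rule meet [OF m(1) subset_refl])
    then show ?thesis using D(2) by simp
  qed
  ultimately have "\<epsilon> \<in> ends_in X Y" using cK unfolding ends_in_def by blast
  then show ?thesis by blast
qed

text \<open>A clopen set of ends is compact, hence a finite union of sets of ends through a
  prescribed component, and the union of these components represents it. An inclusion of sets of
  ends forces a bounded difference because an unbounded end set carries an end.\<close>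

theorem end_model_ends_space:
  assumes X: "connected_space X" "Hausdorff_space X" "locally_connected_space X"
    and K: "exhaustion X K" and cpt: "compact_space (ends_space X)"
  shows "end_model X (ends_space X) (ends_in X)"
  unfolding end_model_def
proof (intro conjI allI impI)
  fix V assume "end_set X V"
  then obtain L where L: "compactin X L" "openin X (V - L)" "openin X (topspace X - V - L)"
    by (auto simp: end_set_def)
  have eq: "ends_in X V = {\<epsilon> \<in> topspace (ends_space X). \<epsilon> L \<in> Pow V}"
    "topspace (ends_space X) - ends_in X V = {\<epsilon> \<in> topspace (ends_space X). \<epsilon> L \<in> - Pow V}"
    using ends_in_iff(1) [OF _ L] by (auto simp: ends_in_def)
  have "openin (ends_space X) (ends_in X V)"
    unfolding eq(1) by (rule openin_ends_space_coordinate [OF L(1)])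
  moreover have "openin (ends_space X) (topspace (ends_space X) - ends_in X V)"
    unfolding eq(2) by (rule openin_ends_space_coordinate [OF L(1)])
  ultimately show "clopenin (ends_space X) (ends_in X V)"
    by (simp add: clopenin_def closedin_def openin_subset)
next
  fix A assume A: "clopenin (ends_space X) A"
  let ?N = "\<lambda>K D. {\<epsilon> \<in> topspace (ends_space X). \<epsilon> K = D}"
  have oN: "openin (ends_space X) (?N L D)" if "compactin X L" for L D
    using openin_ends_space_coordinate [OF that, of "{D}"] by simp
  have AS: "A \<subseteq> topspace (ends_space X)" by (rule clopenin_subset [OF A])
  define \<U> where "\<U> = {?N L D | L D. compactin X L \<and> D \<in> compl_components X L \<and> ?N L D \<subseteq> A}"
  have "compactin (ends_space X) A"
    using A cpt by (simp add: clopenin_def closedin_compact_space)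
  moreover have "\<forall>U\<in>\<U>. openin (ends_space X) U" using oN by (auto simp: \<U>_def)
  moreover have "A \<subseteq> \<Union>\<U>"
  proof
    fix \<epsilon> assume \<epsilon>: "\<epsilon> \<in> A"
    have "openin (ends_space X) A" using A by (simp add: clopenin_def)
    then obtain L where L: "compactin X L"
      "\<And>\<delta>. \<delta> \<in> topspace (ends_space X) \<Longrightarrow> \<delta> L = \<epsilon> L \<Longrightarrow> \<delta> \<in> A"
      by (rule openin_ends_space_basic [OF _ \<epsilon>]) (rule that)
    have "\<epsilon> L \<in> compl_components X L"
      using \<epsilon> AS L(1) topspace_ends_space [of \<epsilon> X] by blast
    moreover have "?N L (\<epsilon> L) \<subseteq> A" using L(2) by blast
    ultimately have "?N L (\<epsilon> L) \<in> \<U>" using L(1) unfolding \<U>_def by blast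
    moreover have "\<epsilon> \<in> ?N L (\<epsilon> L)" using \<epsilon> AS by blast
    ultimately show "\<epsilon> \<in> \<Union>\<U>" by (rule UnionI)
  qed
  ultimately obtain \<F> where \<F>: "finite \<F>" "\<F> \<subseteq> \<U>" "A \<subseteq> \<Union>\<F>"
    unfolding compactin_def by meson
  have "\<forall>W\<in>\<F>. \<exists>L D. compactin X L \<and> D \<in> compl_components X L \<and> ?N L D = W \<and> W \<subseteq> A"
  proof
    fix W assume "W \<in> \<F>"
    with \<F>(2) have "W \<in> \<U>" by (rule subsetD)
    then show "\<exists>L D. compactin X L \<and> D \<in> compl_components X L \<and> ?N L D = W \<and> W \<subseteq> A"
      unfolding \<U>_def by (elim CollectE exE conjE) (intro exI conjI, assumption+, simp_all)
  qed
  from bchoice [OF this] obtain l where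
    "\<forall>W\<in>\<F>. \<exists>D. compactin X (l W) \<and> D \<in> compl_components X (l W) \<and> ?N (l W) D = W \<and> W \<subseteq> A" ..
  from bchoice [OF this] obtain d where
    "\<forall>W\<in>\<F>. compactin X (l W) \<and> d W \<in> compl_components X (l W) \<and> ?N (l W) (d W) = W \<and> W \<subseteq> A" ..
  then have ld: "compactin X (l W)" "d W \<in> compl_components X (l W)" "?N (l W) (d W) = W" "W \<subseteq> A"
    if "W \<in> \<F>" for W
    using that by simp_all
  define V where "V = \<Union>(d ` \<F>)"
  have "end_set X V"
    unfolding V_def
  proof (rule end_set_Union [OF X(2)])
    show "finite (d ` \<F>)" using \<F>(1) by simp
    show "end_set X U" if "U \<in> d ` \<F>" for U
      using that end_set_compl_component [OF X(2,3) ld(1,2)] by auto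
  qed
  moreover have "ends_in X V = A"
  proof
    show "A \<subseteq> ends_in X V"
    proof
      fix \<epsilon> assume "\<epsilon> \<in> A"
      then obtain W where W: "W \<in> \<F>" "\<epsilon> \<in> W" using \<F>(3) by blast
      then have "\<epsilon> \<in> topspace (ends_space X)" "\<epsilon> (l W) = d W" using ld(3) [OF W(1)] by auto
      moreover have "d W \<subseteq> V" using W(1) by (auto simp: V_def)
      ultimately show "\<epsilon> \<in> ends_in X V" using ld(1) [OF W(1)] unfolding ends_in_def by auto
    qed
    show "ends_in X V \<subseteq> A"
    proof
      fix \<epsilon> assume "\<epsilon> \<in> ends_in X V"
      then obtain L where \<epsilon>: "\<epsilon> \<in> topspace (ends_space X)" and L: "compactin X L" "\<epsilon> L \<subseteq> V"
        by (auto simp: ends_in_def)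
      define M where "M = \<Union>(l ` \<F>)"
      have M: "compactin X M"
        unfolding M_def using \<F>(1) ld(1) by (intro compactin_Union) auto
      have LM: "compactin X (L \<union> M)" using L M by (simp add: compactin_Un)
      have C: "\<epsilon> (L \<union> M) \<in> compl_components X (L \<union> M)"
        using \<epsilon> LM by (simp add: topspace_ends_space)
      have sub: "\<epsilon> (L \<union> M) \<subseteq> V" using ends_space_meet(2) [OF \<epsilon> L(1) M] L(2) by blast
      then obtain W where W: "W \<in> \<F>" "\<epsilon> (L \<union> M) \<inter> d W \<noteq> {}"
        using compl_componentsD(1) [OF C] unfolding V_def by blast
      have "l W \<subseteq> L \<union> M" using W(1) by (auto simp: M_def)
      then have "\<epsilon> (L \<union> M) \<subseteq> \<epsilon> (l W)"
        using \<epsilon> ld(1) [OF W(1)] LM unfolding topspace_ends_space by blast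
      then have "\<epsilon> (l W) \<inter> d W \<noteq> {}" using W(2) by blast
      moreover have "\<epsilon> (l W) \<in> compl_components X (l W)"
        using \<epsilon> ld(1) [OF W(1)] by (simp add: topspace_ends_space)
      ultimately have "\<epsilon> (l W) = d W"
        using compl_components_eq ld(2) [OF W(1)] by blast
      then have "\<epsilon> \<in> W" using ld(3) [OF W(1)] \<epsilon> by blast
      then show "\<epsilon> \<in> A" using ld(4) [OF W(1)] by blast
    qed
  qed
  ultimately show "\<exists>V. end_set X V \<and> ends_in X V = A" by blast
next
  fix U V assume U: "end_set X U" and V: "end_set X V"
  obtain L where L: "compactin X L" "openin X (U - L)" "openin X (topspace X - U - L)"
    "openin X (V - L)" "openin X (topspace X - V - L)"
    by (rule end_set_common_witness [OF X(2) U V])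
  show "ends_in X U \<subseteq> ends_in X V \<longleftrightarrow> bounded_in X (U - V)"
  proof
    assume sub: "ends_in X U \<subseteq> ends_in X V"
    show "bounded_in X (U - V)"
    proof (rule ccontr)
      assume "\<not> bounded_in X (U - V)"
      then obtain \<epsilon> where "\<epsilon> \<in> ends_in X (U - V)"
        using ends_in_nonempty [OF X K end_set_Diff [OF X(2) U V]] by blast
      then obtain M where \<epsilon>: "\<epsilon> \<in> topspace (ends_space X)" and M: "compactin X M" "\<epsilon> M \<subseteq> U - V"
        by (auto simp: ends_in_def)
      have "\<epsilon> \<in> ends_in X U" using \<epsilon> M by (auto simp: ends_in_def)
      then have "\<epsilon> L \<subseteq> V" using sub ends_in_iff(1) [OF \<epsilon> L(1,4,5)] by blast
      then show False using M(2) ends_space_meet(1) [OF \<epsilon> M(1) L(1)] by blast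
    qed
  next
    assume "bounded_in X (U - V)"
    then obtain Z where Z: "compactin X Z" "U - V \<subseteq> Z" by (auto simp: bounded_in_def)
    show "ends_in X U \<subseteq> ends_in X V"
    proof
      fix \<epsilon> assume \<epsilon>U: "\<epsilon> \<in> ends_in X U"
      then have \<epsilon>: "\<epsilon> \<in> topspace (ends_space X)" by (simp add: ends_in_def)
      have LZ: "compactin X (L \<union> Z)" using L(1) Z(1) by (simp add: compactin_Un)
      have "\<epsilon> (L \<union> Z) \<in> compl_components X (L \<union> Z)" using \<epsilon> LZ by (simp add: topspace_ends_space)
      then have "\<epsilon> (L \<union> Z) \<inter> Z = {}" using compl_componentsD(3) by blast
      moreover have "\<epsilon> (L \<union> Z) \<subseteq> U"
        using ends_space_meet(2) [OF \<epsilon> L(1) Z(1)] \<epsilon>U ends_in_iff(1) [OF \<epsilon> L(1,2,3)] by blast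
      ultimately have "\<epsilon> (L \<union> Z) \<subseteq> V" using Z(2) by blast
      then show "\<epsilon> \<in> ends_in X V" using \<epsilon> LZ unfolding ends_in_def by blast
    qed
  qed
qed

lemma end_model_clopenin: "end_model X E \<Lambda> \<Longrightarrow> end_set X V \<Longrightarrow> clopenin E (\<Lambda> V)"
  by (simp add: end_model_def)

lemma end_model_subset_iff:
  "end_model X E \<Lambda> \<Longrightarrow> end_set X U \<Longrightarrow> end_set X V \<Longrightarrow> \<Lambda> U \<subseteq> \<Lambda> V \<longleftrightarrow> bounded_in X (U - V)"
  by (simp add: end_model_def)

section \<open>Transport of end models\<close>

lemma bounded_in_homeomorphic_image:
  assumes h: "homeomorphic_map X Y h" and V: "bounded_in X V"
  shows "bounded_in Y (h ` V)"
proof -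
  obtain K where K: "compactin X K" "V \<subseteq> K" using V by (auto simp: bounded_in_def)
  have "compactin Y (h ` K)"
    using K(1) h by (meson homeomorphic_imp_continuous_map image_compactin)
  moreover have "h ` V \<subseteq> h ` K" using K(2) by (rule image_mono)
  ultimately show ?thesis unfolding bounded_in_def by blast
qed

lemma end_set_homeomorphic_image:
  assumes h: "homeomorphic_map X Y h" and V: "end_set X V"
  shows "end_set Y (h ` V)"
proof -
  obtain K where K: "compactin X K" "openin X (V - K)" "openin X (topspace X - V - K)"
    using V by (auto simp: end_set_def)
  have VX: "V \<subseteq> topspace X" using V by (simp add: end_set_def)
  have KX: "K \<subseteq> topspace X" using K(1) by (rule compactin_subset_topspace)
  have inj: "inj_on h (topspace X)" and im: "h ` topspace X = topspace Y"
    using h homeomorphic_imp_injective_map homeomorphic_imp_surjective_map by blast+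
  have d1: "h ` (V - K) = h ` V - h ` K"
    by (rule inj_on_image_set_diff [OF inj]) (use VX KX in auto)
  have "h ` (topspace X - V) = h ` topspace X - h ` V"
    by (rule inj_on_image_set_diff [OF inj]) (use VX in auto)
  moreover have "h ` (topspace X - V - K) = h ` (topspace X - V) - h ` K"
    by (rule inj_on_image_set_diff [OF inj]) (use KX in auto)
  ultimately have d2: "h ` (topspace X - V - K) = topspace Y - h ` V - h ` K"
    using im by simp
  have "compactin Y (h ` K)"
    using K(1) h by (meson homeomorphic_imp_continuous_map image_compactin)
  moreover have "openin Y (h ` V - h ` K)" "openin Y (topspace Y - h ` V - h ` K)"
    using K(2,3) h homeomorphic_map_openness_eq [OF h] unfolding d1 [symmetric] d2 [symmetric] by blast+
  moreover have "h ` V \<subseteq> topspace Y" using VX im by blast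
  ultimately show ?thesis unfolding end_set_def by blast
qed

lemma homeomorphic_maps_image_inverse:
  assumes "homeomorphic_maps X Y h k" "V \<subseteq> topspace X"
  shows "k ` h ` V = V"
  using assms unfolding homeomorphic_maps_def by (force simp: image_image)

lemma end_model_homeomorphic:
  assumes hk: "homeomorphic_maps X Y h k" and model: "end_model X E \<Lambda>"
  shows "end_model Y E (\<lambda>V. \<Lambda> (k ` V))"
proof -
  have h: "homeomorphic_map X Y h" and k: "homeomorphic_map Y X k"
    using hk homeomorphic_maps_map by blast+
  have kh: "homeomorphic_maps Y X k h" using hk homeomorphic_maps_sym by blast
  have inj: "inj_on k (topspace Y)" using k homeomorphic_imp_injective_map by blast
  show ?thesis
    unfolding end_model_def
  proof (intro conjI allI impI)
    fix V assume "end_set Y V"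
    then have "end_set X (k ` V)" by (rule end_set_homeomorphic_image [OF k])
    then show "clopenin E (\<Lambda> (k ` V))" using model by (simp add: end_model_def)
  next
    fix A assume "clopenin E A"
    then obtain V where V: "end_set X V" "\<Lambda> V = A" using model unfolding end_model_def by blast
    have "k ` h ` V = V"
      using V(1) by (intro homeomorphic_maps_image_inverse [OF hk]) (simp add: end_set_def)
    then show "\<exists>V. end_set Y V \<and> \<Lambda> (k ` V) = A"
      using end_set_homeomorphic_image [OF h V(1)] V(2) by (intro exI [of _ "h ` V"]) simp
  next
    fix U V assume U: "end_set Y U" and V: "end_set Y V"
    have UV: "U \<subseteq> topspace Y" "V \<subseteq> topspace Y" using U V by (auto simp: end_set_def)
    have d: "k ` U - k ` V = k ` (U - V)"
      by (rule inj_on_image_set_diff [OF inj, symmetric]) (use UV in auto)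
    have "h ` k ` (U - V) = U - V"
      by (rule homeomorphic_maps_image_inverse [OF kh]) (use UV in auto)
    then have "bounded_in X (k ` (U - V)) \<longleftrightarrow> bounded_in Y (U - V)"
      using bounded_in_homeomorphic_image [OF k, of "U - V"]
        bounded_in_homeomorphic_image [OF h, of "k ` (U - V)"] by auto
    moreover have "\<Lambda> (k ` U) \<subseteq> \<Lambda> (k ` V) \<longleftrightarrow> bounded_in X (k ` U - k ` V)"
      using model end_set_homeomorphic_image [OF k U] end_set_homeomorphic_image [OF k V]
      by (simp add: end_model_def)
    ultimately show "\<Lambda> (k ` U) \<subseteq> \<Lambda> (k ` V) \<longleftrightarrow> bounded_in Y (U - V)"
      unfolding d by simp
  qed
qed

lemma end_model_homeomorphic_space:
  assumes model: "end_model X E \<Lambda>" and hk: "homeomorphic_maps E F h k"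
  shows "end_model X F (\<lambda>V. h ` \<Lambda> V)"
proof -
  have h: "homeomorphic_map E F h" and k: "homeomorphic_map F E k"
    using hk homeomorphic_maps_map by blast+
  have inj: "inj_on h (topspace E)" using h homeomorphic_imp_injective_map by blast
  have cl: "clopenin G (f ` A)" if f: "homeomorphic_map D G f" and A: "clopenin D A"
    for D :: "'x topology" and G :: "'y topology" and f A
    using that homeomorphic_map_openness_eq [OF f] homeomorphic_map_closedness_eq [OF f]
    unfolding clopenin_def by blast
  have sub: "\<Lambda> V \<subseteq> topspace E" if "end_set X V" for V
    using that model clopenin_subset unfolding end_model_def by blast
  show ?thesis
    unfolding end_model_def
  proof (intro conjI allI impI)
    fix V assume "end_set X V"
    then have "clopenin E (\<Lambda> V)" using model by (simp add: end_model_def)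
    then show "clopenin F (h ` \<Lambda> V)" by (rule cl [OF h])
  next
    fix A assume A: "clopenin F A"
    then have "clopenin E (k ` A)" by (rule cl [OF k])
    then obtain V where V: "end_set X V" "\<Lambda> V = k ` A" using model unfolding end_model_def by blast
    have "homeomorphic_maps F E k h" using hk homeomorphic_maps_sym by blast
    then have "h ` k ` A = A" using clopenin_subset [OF A] by (rule homeomorphic_maps_image_inverse)
    then show "\<exists>V. end_set X V \<and> h ` \<Lambda> V = A" using V by (intro exI [of _ V] conjI) (simp_all only:)
  next
    fix U V assume U: "end_set X U" and V: "end_set X V"
    have "h ` \<Lambda> U \<subseteq> h ` \<Lambda> V \<longleftrightarrow> \<Lambda> U \<subseteq> \<Lambda> V"
      using inj_on_image_subset_iff [OF inj sub [OF U] sub [OF V]] .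
    then show "h ` \<Lambda> U \<subseteq> h ` \<Lambda> V \<longleftrightarrow> bounded_in X (U - V)"
      using model U V by (simp add: end_model_def)
  qed
qed

section \<open>Open sets with one end at their frontier\<close>

text \<open>
  The open set \<open>C\<close> has exactly one end at its frontier \<open>c\<close>, and \<open>N\<close> is a neighbourhood of that end:
  the last conjunct says that \<open>N\<close> carries no more than one end of \<open>C\<close>.
\<close>

definition collared :: "'m topology \<Rightarrow> 'm set \<Rightarrow> 'm set \<Rightarrow> 'm set \<Rightarrow> bool" where
  "collared X C c N \<longleftrightarrow> openin X C \<and> compactin X c \<and> C \<inter> c = {} \<and> openin X (topspace X - (C \<union> c)) \<and>
     N \<subseteq> C \<and> openin X (topspace X - (C - N)) \<and> bounded_in X N \<and> end_set (subtopology X C) N \<and>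
     \<not> bounded_in (subtopology X C) N \<and>
     (\<forall>V. end_set (subtopology X C) V \<longrightarrow>
        bounded_in (subtopology X C) (N \<inter> V) \<or> bounded_in (subtopology X C) (N - V))"

lemma bounded_in_subtopology:
  "bounded_in (subtopology X C) V \<Longrightarrow> bounded_in X V"
  unfolding bounded_in_def by (auto simp: compactin_subtopology)

text \<open>Adding \<open>c\<close> to the compact witness absorbs the end at the frontier, since
  the complement of \<open>C\<close> and \<open>c\<close> is open.\<close>

lemma collared_end_set:
  assumes C: "collared X C c N" and V: "end_set (subtopology X C) V"
  shows "end_set X V"
proof -
  have oC: "openin X C" and c: "compactin X c" "C \<inter> c = {}" "openin X (topspace X - (C \<union> c))"
    using C by (auto simp: collared_def)
  have CX: "C \<subseteq> topspace X" using oC by (rule openin_subset)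
  then have tC: "topspace (subtopology X C) = C" by auto
  obtain J where J: "compactin (subtopology X C) J" "openin (subtopology X C) (V - J)"
    "openin (subtopology X C) (C - V - J)" and VC: "V \<subseteq> C"
    using V unfolding end_set_def tC by blast
  have JX: "compactin X J" "J \<subseteq> C" using J(1) by (auto simp: compactin_subtopology)
  have o: "openin X (V - J)" "openin X (C - V - J)"
    using J(2,3) oC openin_trans_full by blast+
  have "V - (J \<union> c) = V - J"
    "topspace X - V - (J \<union> c) = (C - V - J) \<union> (topspace X - (C \<union> c))"
    using VC CX c(2) JX(2) by blast+
  then have "openin X (V - (J \<union> c))" "openin X (topspace X - V - (J \<union> c))"
    using o(1) openin_Un [OF o(2) c(3)] by simp_all
  moreover have "compactin X (J \<union> c)" using JX c by (simp add: compactin_Un)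
  moreover have "V \<subseteq> topspace X" using VC CX by blast
  ultimately show ?thesis unfolding end_set_def by blast
qed

text \<open>
  The end set \<open>V\<close> of \<open>C\<close> is encoded by the clopen set \<open>\<Lambda> (V - N)\<close> of ends of \<open>X\<close> together with the truth
  value telling whether \<open>V\<close> contains the end at \<open>c\<close>.
\<close>

lemma collared_order:
  assumes X: "Hausdorff_space X" and model: "end_model X E \<Lambda>" and C: "collared X C c N"
    and U: "end_set (subtopology X C) U" and V: "end_set (subtopology X C) V"
  shows "\<Lambda> (U - N) \<subseteq> \<Lambda> (V - N) \<and>
      (bounded_in (subtopology X C) (N - U) \<longrightarrow> bounded_in (subtopology X C) (N - V)) \<longleftrightarrow>
    bounded_in (subtopology X C) (U - V)"
proof -
  let ?Y = "subtopology X C"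
  have Y: "Hausdorff_space ?Y" using X by (rule Hausdorff_space_subtopology)
  have N: "end_set ?Y N" "N \<subseteq> C" "openin X (topspace X - (C - N))"
    and dich: "bounded_in ?Y (N \<inter> W) \<or> bounded_in ?Y (N - W)" if "end_set ?Y W" for W
    using C that by (auto simp: collared_def)
  have oC: "openin X C" using C by (simp add: collared_def)
  have UC: "U \<subseteq> C" using U by (auto simp: end_set_def)
  have UN: "end_set X (U - N)" "end_set X (V - N)"
    using collared_end_set [OF C] end_set_Diff [OF Y] U V N(1)  C by (auto simp: collared_def)
  then have ord: "\<Lambda> (U - N) \<subseteq> \<Lambda> (V - N) \<longleftrightarrow> bounded_in X (U - N - (V - N))"
    using model by (simp add: end_model_def)
  have clCN: "closedin X (C - N)"
  proof -
    have "C - N \<subseteq> topspace X" using openin_subset [OF oC] by blast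
    then show ?thesis using C by (simp add: closedin_def collared_def)
  qed
  show ?thesis
  proof (intro iffI conjI impI)
    assume "bounded_in ?Y (U - V)"
    then have "bounded_in X (U - V)" by (rule bounded_in_subtopology)
    then have "bounded_in X (U - N - (V - N))" by (rule bounded_in_subset) blast
    then show "\<Lambda> (U - N) \<subseteq> \<Lambda> (V - N)" using ord by simp
  next
    assume "bounded_in ?Y (U - V)" "bounded_in ?Y (N - U)"
    then have "bounded_in ?Y ((U - V) \<union> (N - U))" by (rule bounded_in_Un)
    then show "bounded_in ?Y (N - V)" by (rule bounded_in_subset) blast
  next
    assume *: "\<Lambda> (U - N) \<subseteq> \<Lambda> (V - N) \<and> (bounded_in ?Y (N - U) \<longrightarrow> bounded_in ?Y (N - V))"
    then obtain Z where Z: "compactin X Z" "U - N - (V - N) \<subseteq> Z"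
      using ord by (auto simp: bounded_in_def)
    \<comment> \<open>\<open>C - N\<close> is closed in \<open>X\<close>, so for its subsets
      boundedness in \<open>X\<close> implies boundedness in \<open>C\<close>; the collar is the
      only place where the two notions differ.\<close>
    have "compactin X (Z \<inter> (C - N))"
      using Z(1) clCN by (rule compact_Int_closedin)
    then have "compactin ?Y (Z \<inter> (C - N))" by (auto simp: compactin_subtopology)
    then have "bounded_in ?Y (Z \<inter> (C - N))" by (rule bounded_in_compactin)
    then have 1: "bounded_in ?Y (U - N - (V - N))"
      by (rule bounded_in_subset) (use Z(2) UC in auto)
    \<comment> \<open>On the collar the flags decide: either \<open>N - U\<close> is bounded and
      then so is \<open>N - V\<close>, or \<open>N \<inter> U\<close> is bounded.\<close>
    have 2: "bounded_in ?Y (N \<inter> (U - V))"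
    proof (cases "bounded_in ?Y (N - U)")
      case True
      then have "bounded_in ?Y (N - V)" using * by simp
      then show ?thesis by (rule bounded_in_subset) blast
    next
      case False
      then have "bounded_in ?Y (N \<inter> U)" using dich [OF U] by simp
      then show ?thesis by (rule bounded_in_subset) blast
    qed
    have "bounded_in ?Y ((U - N - (V - N)) \<union> N \<inter> (U - V))"
      using 1 2 by (rule bounded_in_Un)
    then show "bounded_in ?Y (U - V)" by (rule bounded_in_subset) blast
  qed
qed

text \<open>A set \<open>U\<close> representing \<open>A\<close> may be replaced by its intersection
  with \<open>C - N\<close>, because \<open>N\<close> and \<open>U - C\<close> are bounded in
  \<open>X\<close>. Adjoining \<open>N\<close> or not then sets the flag without changing the ends
  away from the collar.\<close>

lemma collared_surj:
  assumes X: "Hausdorff_space X" and model: "end_model X E \<Lambda>" and C: "collared X C c N"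
    and A: "clopenin E A" "A \<subseteq> \<Lambda> C"
  shows "\<exists>V. end_set (subtopology X C) V \<and> \<Lambda> (V - N) = A \<and>
    (bounded_in (subtopology X C) (N - V) \<longleftrightarrow> b)"
proof -
  let ?Y = "subtopology X C"
  have Y: "Hausdorff_space ?Y" using X by (rule Hausdorff_space_subtopology)
  have oC: "openin X C" and N: "end_set ?Y N" "N \<subseteq> C" "bounded_in X N" "\<not> bounded_in ?Y N"
    using C by (auto simp: collared_def)
  have CX: "C \<subseteq> topspace X" using oC by (rule openin_subset)
  then have tC: "topspace ?Y = C" by auto
  have clCN: "closedin X (C - N)"
  proof -
    have "C - N \<subseteq> topspace X" using CX by blast
    then show ?thesis using C by (simp add: closedin_def collared_def)
  qed
  obtain U where U: "end_set X U" "\<Lambda> U = A" using model A(1) unfolding end_model_def by blast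
  have endC: "end_set X C"
    using collared_end_set [OF C end_set_topspace] tC by simp
  have "bounded_in X (U - C)"
    using model U A(2) endC by (auto simp: end_model_def)
  obtain J where J: "compactin X J" "openin X (U - J)" "openin X (topspace X - U - J)"
    using U(1) by (auto simp: end_set_def)
  obtain L where L: "compactin ?Y L" "openin ?Y (N - L)" "openin ?Y (C - N - L)"
    using N(1) unfolding end_set_def tC by blast
  define V where "V = U \<inter> (C - N)"
  have VC: "V \<subseteq> C" "V \<inter> N = {}" by (auto simp: V_def)
  have "end_set ?Y V"
  proof -
    have "compactin X (J \<inter> (C - N))" using J(1) clCN by (rule compact_Int_closedin)
    then have "compactin ?Y (J \<inter> (C - N))" by (auto simp: compactin_subtopology)
    then have K: "compactin ?Y (L \<union> J \<inter> (C - N))" using L(1) by (simp add: compactin_Un)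
    have Lo: "openin X (N - L)" "openin X (C - N - L)"
      using L(2,3) oC openin_trans_full by blast+
    have "V - (L \<union> J \<inter> (C - N)) = (U - J) \<inter> (C - N - L)"
      "C - V - (L \<union> J \<inter> (C - N)) = (topspace X - U - J) \<inter> (C - N - L) \<union> (N - L)"
      using CX N(2) by (auto simp: V_def)
    then have "openin X (V - (L \<union> J \<inter> (C - N)))" "openin X (C - V - (L \<union> J \<inter> (C - N)))"
      using openin_Int [OF J(2) Lo(2)] openin_Un [OF openin_Int [OF J(3) Lo(2)] Lo(1)] by simp_all
    then have "openin ?Y (V - (L \<union> J \<inter> (C - N)))" "openin ?Y (C - V - (L \<union> J \<inter> (C - N)))"
      using VC(1) oC by (auto simp: openin_open_subtopology)
    then show ?thesis using K VC(1) unfolding end_set_def tC by blast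
  qed
  then have endV: "end_set X V" by (rule collared_end_set [OF C])
  have \<Lambda>V: "\<Lambda> V = A"
  proof
    have "\<Lambda> V \<subseteq> \<Lambda> U \<longleftrightarrow> bounded_in X (V - U)" "\<Lambda> U \<subseteq> \<Lambda> V \<longleftrightarrow> bounded_in X (U - V)"
      using model endV U(1) by (simp_all add: end_model_def)
    moreover have "V - U = {}" by (auto simp: V_def)
    moreover have "bounded_in X ((U - C) \<union> N)"
      using \<open>bounded_in X (U - C)\<close> N(3) by (rule bounded_in_Un)
    then have "bounded_in X (U - V)" by (rule bounded_in_subset) (auto simp: V_def)
    ultimately show "\<Lambda> V \<subseteq> A" "A \<subseteq> \<Lambda> V" using U(2) by auto
  qed
  show ?thesis
  proof (cases b)
    case True
    have "end_set ?Y (V \<union> N)" using Y \<open>end_set ?Y V\<close> N(1) by (rule end_set_Un)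
    moreover have "V \<union> N - N = V" using VC(2) by auto
    then have "\<Lambda> (V \<union> N - N) = A" using \<Lambda>V by (simp only:)
    moreover have "N - (V \<union> N) = {}" by blast
    then have "bounded_in ?Y (N - (V \<union> N))" by (simp only: bounded_in_empty)
    ultimately show ?thesis using True by blast
  next
    case False
    have "V - N = V" "N - V = N" using VC(2) by auto
    then have "\<Lambda> (V - N) = A" "\<not> bounded_in ?Y (N - V)" using \<Lambda>V N(4) by (simp_all only: not_False_eq_True)
    then show ?thesis using \<open>end_set ?Y V\<close> False by blast
  qed
qed

text \<open>
  A homeomorphism from \<open>C\<close> to \<open>D\<close> need not respect the collars, but both \<open>\<Lambda> C\<close> and \<open>\<Lambda> D\<close> with an isolated
  point added are the space of ends of \<open>C\<close>, and isolated points can be cancelled.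
\<close>

lemma collared_homeomorphic:
  assumes X: "Hausdorff_space X" and E: "stone_space E" and model: "end_model X E \<Lambda>"
    and C: "collared X C c N" and D: "collared X D d B"
    and CD: "subtopology X C homeomorphic_space subtopology X D"
  shows "subtopology E (\<Lambda> C) homeomorphic_space subtopology E (\<Lambda> D)"
proof -
  let ?C = "subtopology X C" and ?D = "subtopology X D"
  obtain h k where hk: "homeomorphic_maps ?C ?D h k"
    using CD by (auto simp: homeomorphic_space_def)
  have h: "homeomorphic_map ?C ?D h" and k: "homeomorphic_map ?D ?C k"
    using hk homeomorphic_maps_map by blast+
  have cl: "clopenin E (\<Lambda> C')" "topspace (subtopology X C') = C'"
    if "collared X C' c' N'" for C' c' N'
  proof -
    show "topspace (subtopology X C') = C'"
      using that openin_subset by (auto simp: collared_def)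
    then have "end_set X C'" using collared_end_set [OF that end_set_topspace] by simp
    then show "clopenin E (\<Lambda> C')" using model by (simp add: end_model_def)
  qed
  have clop: "clopenin (subtopology E (\<Lambda> C')) (\<Lambda> (V - N'))"
    if C': "collared X C' c' N'" and V: "end_set (subtopology X C') V" for C' c' N' V
  proof -
    have Y: "Hausdorff_space (subtopology X C')" using X by (rule Hausdorff_space_subtopology)
    have "end_set (subtopology X C') N'" using C' by (simp add: collared_def)
    then have "end_set X (V - N')" by (intro collared_end_set [OF C'] end_set_Diff [OF Y V])
    moreover have "end_set X C'" using collared_end_set [OF C' end_set_topspace] cl(2) [OF C'] by simp
    moreover have "V - N' - C' \<subseteq> {}" using V by (auto simp: end_set_def)
    then have "bounded_in X (V - N' - C')" by (rule bounded_in_subset [OF bounded_in_empty])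
    ultimately have "clopenin E (\<Lambda> (V - N'))" "\<Lambda> (V - N') \<subseteq> \<Lambda> C'"
      by (simp_all only: end_model_clopenin [OF model] end_model_subset_iff [OF model])
    then show ?thesis by (simp add: clopenin_subtopology [OF cl(1) [OF C']])
  qed
  show ?thesis
  \<comment> \<open>The end sets \<open>V\<close> of \<open>C\<close> index both families;
    \<open>D\<close> uses their images under \<open>h\<close>. The flags of \<open>V\<close> and of
    its image may differ.\<close>
  proof (rule clopen_order_iso_homeomorphic_add_point [where \<A> = "{V. end_set ?C V}"])
    show "stone_space (subtopology E (\<Lambda> C))" "stone_space (subtopology E (\<Lambda> D))"
      using stone_space_subtopology [OF E] cl C D by blast+
    show "clopenin (subtopology E (\<Lambda> C)) (\<Lambda> (V - N))" if "V \<in> {V. end_set ?C V}" for V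
      using clop [OF C] that by simp
    show "\<exists>V\<in>{V. end_set ?C V}. \<Lambda> (V - N) = A \<and> (bounded_in ?C (N - V) \<longleftrightarrow> b)"
      if "clopenin (subtopology E (\<Lambda> C)) A" for A b
    proof -
      have "clopenin E A" "A \<subseteq> \<Lambda> C" using that by (auto simp: clopenin_subtopology [OF cl(1) [OF C]])
      from collared_surj [OF X model C this, of b] show ?thesis by blast
    qed
    show "clopenin (subtopology E (\<Lambda> D)) (\<Lambda> (h ` V - B))" if "V \<in> {V. end_set ?C V}" for V
      using clop [OF D end_set_homeomorphic_image [OF h]] that by simp
    show "\<exists>V\<in>{V. end_set ?C V}. \<Lambda> (h ` V - B) = A \<and> (bounded_in ?D (B - h ` V) \<longleftrightarrow> b)"
      if "clopenin (subtopology E (\<Lambda> D)) A" for A b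
    proof -
      have "clopenin E A" "A \<subseteq> \<Lambda> D" using that by (auto simp: clopenin_subtopology [OF cl(1) [OF D]])
      from collared_surj [OF X model D this, of b]
      obtain W where W: "end_set ?D W" "\<Lambda> (W - B) = A" "bounded_in ?D (B - W) \<longleftrightarrow> b" by blast
      have "homeomorphic_maps ?D ?C k h" using hk homeomorphic_maps_sym by blast
      then have "h ` k ` W = W"
        using W(1) by (intro homeomorphic_maps_image_inverse) (auto simp: end_set_def)
      then show ?thesis
        using W end_set_homeomorphic_image [OF k W(1)] by (intro bexI [of _ "k ` W"]) simp_all
    qed
  next
    fix U V assume "U \<in> {V. end_set ?C V}" "V \<in> {V. end_set ?C V}"
    then have UV: "end_set ?C U" "end_set ?C V" by simp_all
    have UVC: "U \<subseteq> topspace ?C" "V \<subseteq> topspace ?C" using UV by (simp_all only: end_set_def)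
    have "h ` (U - V) = h ` U - h ` V"
      by (rule inj_on_image_set_diff [OF homeomorphic_imp_injective_map [OF h]]) (use UVC in blast)+
    moreover have "k ` h ` (U - V) = U - V"
      by (rule homeomorphic_maps_image_inverse [OF hk]) (use UVC in blast)
    ultimately have "bounded_in ?C (U - V) \<longleftrightarrow> bounded_in ?D (h ` U - h ` V)"
      using bounded_in_homeomorphic_image [OF h, of "U - V"]
        bounded_in_homeomorphic_image [OF k, of "h ` (U - V)"] by auto
    then show "\<Lambda> (U - N) \<subseteq> \<Lambda> (V - N) \<and> (bounded_in ?C (N - U) \<longrightarrow> bounded_in ?C (N - V)) \<longleftrightarrow>
      \<Lambda> (h ` U - B) \<subseteq> \<Lambda> (h ` V - B) \<and> (bounded_in ?D (B - h ` U) \<longrightarrow> bounded_in ?D (B - h ` V))"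
      using collared_order [OF X model C UV]
        collared_order [OF X model D end_set_homeomorphic_image [OF h UV(1)]
          end_set_homeomorphic_image [OF h UV(2)]] by simp
  qed
qed

section \<open>Plane topology\<close>

lemma compactin_top_of_set: "compactin (top_of_set \<Omega>) K \<longleftrightarrow> compact K \<and> K \<subseteq> \<Omega>"
  by (auto simp: compactin_subtopology)

lemma openin_top_of_set_open:
  "open \<Omega> \<Longrightarrow> V \<subseteq> \<Omega> \<Longrightarrow> openin (top_of_set \<Omega>) V \<longleftrightarrow> open V"
  by (simp add: openin_open_eq)

lemma subtopology_top_of_set: "C \<subseteq> \<Omega> \<Longrightarrow> subtopology (top_of_set \<Omega>) C = top_of_set C"
  by (simp add: subtopology_subtopology Int_absorb1)

lemma bounded_in_top_of_set:
  "bounded_in (top_of_set \<Omega>) V \<longleftrightarrow> (\<exists>K. compact K \<and> K \<subseteq> \<Omega> \<and> V \<subseteq> K)"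
  unfolding bounded_in_def compactin_top_of_set by auto

lemma end_set_top_of_set:
  assumes "open \<Omega>" "V \<subseteq> \<Omega>"
  shows "end_set (top_of_set \<Omega>) V \<longleftrightarrow> (\<exists>K. compact K \<and> K \<subseteq> \<Omega> \<and> open (V - K) \<and> open (\<Omega> - V - K))"
proof -
  have "openin (top_of_set \<Omega>) (V - K) \<longleftrightarrow> open (V - K)"
    "openin (top_of_set \<Omega>) (\<Omega> - V - K) \<longleftrightarrow> open (\<Omega> - V - K)" for K
    using assms by (auto intro!: openin_top_of_set_open)
  then show ?thesis
    using assms(2) unfolding end_set_def compactin_top_of_set by auto
qed

text \<open>By \<open>thin\<close>, beyond any compact \<open>J\<close> the collar contains a
  connected tail \<open>T\<close>, and the rest of \<open>N\<close> is bounded in \<open>C\<close>.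
  Hence \<open>N\<close> is unbounded in \<open>C\<close>; and an end set of \<open>C\<close>,
  having compact frontier, contains a whole tail or misses it, so \<open>N\<close> carries a single
  end.\<close>

lemma collared_top_of_set:
  assumes \<Omega>: "open \<Omega>" and C: "open C" "C \<subseteq> \<Omega>"
    and c: "compact c" "c \<subseteq> \<Omega>" "C \<inter> c = {}" "open (\<Omega> - (C \<union> c))"
    and N: "N \<subseteq> C" "open (\<Omega> - (C - N))" "compact Z" "Z \<subseteq> \<Omega>" "N \<subseteq> Z"
    and J: "compact J" "J \<subseteq> C" "open (N - J)" "open (C - N - J)"
    and thin: "\<And>J. compact J \<Longrightarrow> J \<subseteq> C \<Longrightarrow>
      \<exists>T L. connected T \<and> T \<noteq> {} \<and> T \<subseteq> N - J \<and> compact L \<and> L \<subseteq> C \<and> N - T \<subseteq> L"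
  shows "collared (top_of_set \<Omega>) C c N"
proof -
  have sub: "subtopology (top_of_set \<Omega>) C = top_of_set C"
    using C(2) by (rule subtopology_top_of_set)
  have not: "\<not> bounded_in (top_of_set C) N"
  proof
    assume "bounded_in (top_of_set C) N"
    then obtain K where K: "compact K" "K \<subseteq> C" "N \<subseteq> K" by (auto simp: bounded_in_top_of_set)
    then obtain T where "T \<noteq> {}" "T \<subseteq> N - K" using thin [OF K(1,2)] by blast
    then show False using K(3) by blast
  qed
  have dich: "bounded_in (top_of_set C) (N \<inter> V) \<or> bounded_in (top_of_set C) (N - V)"
    if V: "end_set (top_of_set C) V" for V
  proof -
    have VC: "V \<subseteq> C" using V by (simp add: end_set_def)
    then obtain K where K: "compact K" "K \<subseteq> C" "open (V - K)" "open (C - V - K)"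
      using V end_set_top_of_set [OF C(1) VC] by blast
    obtain T L where T: "connected T" "T \<subseteq> N - K" and L: "compact L" "L \<subseteq> C" "N - T \<subseteq> L"
      using thin [OF K(1,2)] by blast
    have "T \<subseteq> (V - K) \<union> (C - V - K)" using T(2) N(1) by blast
    moreover have "(V - K) \<inter> (C - V - K) \<inter> T = {}" by blast
    moreover have "connectedin euclidean T" using T(1) by simp
    ultimately have "T \<subseteq> V - K \<or> T \<inter> (V - K) = {}"
      using connectedin_clopen_subset [of euclidean T "V - K" "C - V - K"] K(3,4) by simp
    then have "N - V \<subseteq> L \<or> N \<inter> V \<subseteq> L" using L(3) T(2) by blast
    then show ?thesis using L(1,2) unfolding bounded_in_top_of_set by blast
  qed
  have "openin (top_of_set \<Omega>) C" "openin (top_of_set \<Omega>) (\<Omega> - (C \<union> c))" "openin (top_of_set \<Omega>) (\<Omega> - (C - N))"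
    using \<Omega> C c N by (simp_all add: openin_top_of_set_open)
  moreover have "end_set (top_of_set C) N"
    unfolding end_set_top_of_set [OF C(1) N(1)] using J by blast
  moreover have "bounded_in (top_of_set \<Omega>) N" unfolding bounded_in_top_of_set using N by blast
  moreover have "compactin (top_of_set \<Omega>) c" using c by (simp add: compactin_top_of_set)
  ultimately show ?thesis
    unfolding collared_def sub topspace_euclidean_subtopology using c N(1) not dich by blast
qed

lemma compact_subset_ball_gap:
  assumes "compact S" "\<And>z. z \<in> S \<Longrightarrow> norm z < r" "r0 < r"
  obtains s where "r0 < s" "s < r" "\<And>z. z \<in> S \<Longrightarrow> norm z \<le> s"
proof (cases "S = {}")
  case True
  then show thesis using that [of "(r0 + r) / 2"] assms(3) by simp
next
  case False
  obtain z where z: "z \<in> S" "\<And>y. y \<in> S \<Longrightarrow> norm y \<le> norm z"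
    using continuous_attains_sup [OF assms(1) False, of norm] continuous_on_norm_id by blast
  show thesis
  proof (rule that [of "(max r0 (norm z) + r) / 2"])
    have "norm z < r" using assms(2) z(1) by simp
    then show "r0 < (max r0 (norm z) + r) / 2" "(max r0 (norm z) + r) / 2 < r"
      using assms(3) by (auto simp: max_def)
    show "norm y \<le> (max r0 (norm z) + r) / 2" if "y \<in> S" for y
      using z(2) [OF that] \<open>norm z < r\<close> assms(3) by (auto simp: max_def)
  qed
qed

lemma compact_outside_ball_gap:
  assumes "compact S" "\<And>z. z \<in> S \<Longrightarrow> r < norm z" "r < r0"
  obtains s where "r < s" "s < r0" "\<And>z. z \<in> S \<Longrightarrow> s \<le> norm z"
proof (cases "S = {}")
  case True
  then show thesis using that [of "(r0 + r) / 2"] assms(3) by simp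
next
  case False
  obtain z where z: "z \<in> S" "\<And>y. y \<in> S \<Longrightarrow> norm z \<le> norm y"
    using continuous_attains_inf [OF assms(1) False, of norm] continuous_on_norm_id by blast
  show thesis
  proof (rule that [of "(min r0 (norm z) + r) / 2"])
    have "r < norm z" using assms(2) z(1) by simp
    then show "r < (min r0 (norm z) + r) / 2" "(min r0 (norm z) + r) / 2 < r0"
      using assms(3) by (auto simp: min_def)
    show "(min r0 (norm z) + r) / 2 \<le> norm y" if "y \<in> S" for y
      using z(2) [OF that] \<open>r < norm z\<close> assms(3) by (auto simp: min_def)
  qed
qed

section \<open>Concentric shells in a disc\<close>

locale disc_chart =
  fixes W :: "complex set" and \<eta> \<zeta> :: "complex \<Rightarrow> complex"
  assumes open_W: "open W" and chart: "homeomorphism (ball 0 1) W \<eta> \<zeta>"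
begin

text \<open>Radii are selected by a predicate, so that set identities between discs, circles and
  annuli reduce through \<open>shell_iff\<close> to inequalities between reals.\<close>

definition shell :: "(real \<Rightarrow> bool) \<Rightarrow> complex set" where
  "shell P = \<eta> ` {z. P (norm z) \<and> norm z < 1}"

lemma shell_iff: "x \<in> shell P \<longleftrightarrow> x \<in> W \<and> P (norm (\<zeta> x))"
proof
  assume "x \<in> shell P"
  then obtain z where "x = \<eta> z" "P (norm z)" "norm z < 1" by (auto simp: shell_def)
  then show "x \<in> W \<and> P (norm (\<zeta> x))" using chart by (auto simp: homeomorphism_def)
next
  assume "x \<in> W \<and> P (norm (\<zeta> x))"
  then have "\<zeta> x \<in> ball 0 1" "\<eta> (\<zeta> x) = x" "P (norm (\<zeta> x))"
    using chart unfolding homeomorphism_def by blast+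
  then show "x \<in> shell P" unfolding shell_def by (intro image_eqI [of _ _ "\<zeta> x"]) auto
qed

lemma open_shell:
  assumes "open {z :: complex. P (norm z)}"
  shows "open (shell P)"
proof -
  have "{z :: complex. P (norm z) \<and> norm z < 1} = {z. P (norm z)} \<inter> ball 0 1" by auto
  then have "open {z :: complex. P (norm z) \<and> norm z < 1}" using assms by auto
  then have "openin (top_of_set (ball 0 1)) {z :: complex. P (norm z) \<and> norm z < 1}"
    by (subst openin_open_eq) auto
  then have "openin (top_of_set W) (shell P)"
    unfolding shell_def by (rule homeomorphism_imp_open_map [OF chart])
  then show ?thesis using open_W openin_open_eq by blast
qed

lemma compact_shell:
  assumes "closed {z :: complex. P (norm z)}" "\<And>t. P t \<Longrightarrow> t \<le> r" "r < 1"
  shows "compact (shell P)"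
proof -
  have "{z :: complex. P (norm z) \<and> norm z < 1} = {z. P (norm z)} \<inter> cball 0 r"
    using assms(2,3) by (fastforce simp: dist_norm)
  then have "compact {z :: complex. P (norm z) \<and> norm z < 1}"
    using assms(1) by (simp add: closed_Int_compact)
  moreover have "continuous_on {z :: complex. P (norm z) \<and> norm z < 1} \<eta>"
    by (rule continuous_on_subset [OF homeomorphism_cont1 [OF chart]]) auto
  ultimately show ?thesis unfolding shell_def by (rule compact_continuous_image [rotated])
qed

lemma connected_shell:
  assumes "a < b" "b \<le> 1" "0 \<le> a"
  shows "connected (shell (\<lambda>t. a < t \<and> t < b))" "shell (\<lambda>t. a < t \<and> t < b) \<noteq> {}"
proof -
  have eq: "{z :: complex. (a < norm z \<and> norm z < b) \<and> norm z < 1} = {z. a < norm (z - 0) \<and> norm (z - 0) < b}"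
    using assms by auto
  have "connected {z :: complex. a < norm (z - 0) \<and> norm (z - 0) < b}"
    by (rule connected_annulus) simp
  then have "connected {z :: complex. (a < norm z \<and> norm z < b) \<and> norm z < 1}" unfolding eq .
  moreover have "continuous_on {z :: complex. (a < norm z \<and> norm z < b) \<and> norm z < 1} \<eta>"
    by (rule continuous_on_subset [OF homeomorphism_cont1 [OF chart]]) auto
  ultimately show "connected (shell (\<lambda>t. a < t \<and> t < b))"
    unfolding shell_def by (rule connected_continuous_image [rotated])
  have "complex_of_real ((a + b) / 2) \<in> {z. (a < norm z \<and> norm z < b) \<and> norm z < 1}"
    using assms by (simp add: norm_of_real del: of_real_divide of_real_add)
  then show "shell (\<lambda>t. a < t \<and> t < b) \<noteq> {}" unfolding shell_def by blast
qed

lemma open_norm_ivl: "open {z :: complex. a < norm z}" "open {z :: complex. norm z < b}"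
  "open {z :: complex. a < norm z \<and> norm z < b}"
  by (auto intro!: open_Collect_conj open_Collect_less continuous_intros)

lemma closed_norm_ivl: "closed {z :: complex. a \<le> norm z \<and> norm z \<le> b}" "closed {z :: complex. norm z \<le> b}"
  "closed {z :: complex. norm z = b}"
  by (auto intro!: closed_Collect_conj closed_Collect_le closed_Collect_eq continuous_intros)

lemma compact_coordinates:
  assumes "compact J" "J \<subseteq> W"
  shows "compact (\<zeta> ` J)"
  using assms chart compact_continuous_image continuous_on_subset unfolding homeomorphism_def by metis

text \<open>A compact \<open>J\<close> inside the disc of radius \<open>r2\<close> misses a thin
  annulus below \<open>r2\<close>, and this annulus is the connected tail. Only the closed annulus
  from \<open>r1\<close> to \<open>r2\<close> has to lie in \<open>\<Omega>\<close>; the inner disc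
  may contain points of its complement.\<close>

lemma collared_inner:
  assumes \<Omega>: "open \<Omega>" and r: "0 \<le> r1" "r1 < r2" "r2 < 1"
    and sub: "shell (\<lambda>t. r1 \<le> t \<and> t \<le> r2) \<subseteq> \<Omega>"
  shows "collared (top_of_set \<Omega>) (shell (\<lambda>t. t < r2) \<inter> \<Omega>) (shell (\<lambda>t. t = r2)) (shell (\<lambda>t. r1 < t \<and> t < r2))"
proof (rule collared_top_of_set [OF \<Omega>, where Z = "shell (\<lambda>t. r1 \<le> t \<and> t \<le> r2)" and J = "shell (\<lambda>t. t = r1)"])
  let ?C = "shell (\<lambda>t. t < r2) \<inter> \<Omega>" and ?N = "shell (\<lambda>t. r1 < t \<and> t < r2)"
  have clos: "closed (shell (\<lambda>t. t \<le> r1))" "closed (shell (\<lambda>t. t \<le> r2))"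
    using r by (auto intro!: compact_imp_closed compact_shell [where r = r2] closed_norm_ivl)
  have op: "open (shell (\<lambda>t. t < r2))" "open ?N" "open (shell (\<lambda>t. t < r1))"
    by (intro open_shell open_norm_ivl)+
  show "open ?C" using op(1) \<Omega> by auto
  show "?C \<subseteq> \<Omega>" by blast
  show "compact (shell (\<lambda>t. t = r2))" "compact (shell (\<lambda>t. t = r1))" "compact (shell (\<lambda>t. r1 \<le> t \<and> t \<le> r2))"
    using r by (auto intro!: compact_shell [where r = r2] closed_norm_ivl)
  show "shell (\<lambda>t. t = r2) \<subseteq> \<Omega>" "shell (\<lambda>t. t = r1) \<subseteq> ?C" "?N \<subseteq> ?C"
    "shell (\<lambda>t. r1 \<le> t \<and> t \<le> r2) \<subseteq> \<Omega>"
    using sub r by (auto simp: shell_iff subset_iff)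
  show "?C \<inter> shell (\<lambda>t. t = r2) = {}" "?N \<subseteq> shell (\<lambda>t. r1 \<le> t \<and> t \<le> r2)"
    by (auto simp: shell_iff)
  have "\<Omega> - (?C \<union> shell (\<lambda>t. t = r2)) = \<Omega> - shell (\<lambda>t. t \<le> r2)"
    by (auto simp: shell_iff)
  then show "open (\<Omega> - (?C \<union> shell (\<lambda>t. t = r2)))" using \<Omega> clos(2) by (simp add: open_Diff)
  have "\<Omega> - (?C - ?N) = \<Omega> - shell (\<lambda>t. t \<le> r1)"
    using r sub by (auto simp: shell_iff subset_iff)
  then show "open (\<Omega> - (?C - ?N))" using \<Omega> clos(1) by (simp add: open_Diff)
  have "?N - shell (\<lambda>t. t = r1) = ?N" by (auto simp: shell_iff)
  then show "open (?N - shell (\<lambda>t. t = r1))" using op(2) by simp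
  have "?C - ?N - shell (\<lambda>t. t = r1) = shell (\<lambda>t. t < r1) \<inter> \<Omega>"
    using r by (auto simp: shell_iff)
  then show "open (?C - ?N - shell (\<lambda>t. t = r1))" using op(3) \<Omega> by (simp add: open_Int)
  fix J assume J: "compact J" "J \<subseteq> ?C"
  have "compact (\<zeta> ` J)" using J by (intro compact_coordinates) (auto simp: shell_iff)
  moreover have "norm z < r2" if "z \<in> \<zeta> ` J" for z using that J(2) by (auto simp: shell_iff)
  ultimately obtain s where s: "r1 < s" "s < r2" "\<And>z. z \<in> \<zeta> ` J \<Longrightarrow> norm z \<le> s"
    using compact_subset_ball_gap [OF _ _ r(2)] by metis
  let ?T = "shell (\<lambda>t. s < t \<and> t < r2)" and ?L = "shell (\<lambda>t. r1 \<le> t \<and> t \<le> s)"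
  have "connected ?T" "?T \<noteq> {}" using s r connected_shell [of s r2] by auto
  moreover have "?T \<subseteq> ?N - J" using s by (fastforce simp: shell_iff)
  moreover have "compact ?L" using s r by (auto intro!: compact_shell [where r = s] closed_norm_ivl)
  moreover have "?L \<subseteq> ?C" "?N - ?T \<subseteq> ?L" using s sub by (auto simp: shell_iff subset_iff)
  ultimately show "\<exists>T L. connected T \<and> T \<noteq> {} \<and> T \<subseteq> ?N - J \<and> compact L \<and> L \<subseteq> ?C \<and> ?N - T \<subseteq> L"
    by blast
qed

lemma collared_outer:
  assumes \<Omega>: "open \<Omega>" and r: "0 \<le> r1" "r1 < r2" "r2 < 1"
    and sub: "shell (\<lambda>t. r1 \<le> t \<and> t \<le> r2) \<subseteq> \<Omega>"
  shows "collared (top_of_set \<Omega>) (\<Omega> - shell (\<lambda>t. t \<le> r1)) (shell (\<lambda>t. t = r1)) (shell (\<lambda>t. r1 < t \<and> t < r2))"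
proof (rule collared_top_of_set [OF \<Omega>, where Z = "shell (\<lambda>t. r1 \<le> t \<and> t \<le> r2)" and J = "shell (\<lambda>t. t = r2)"])
  let ?C = "\<Omega> - shell (\<lambda>t. t \<le> r1)" and ?N = "shell (\<lambda>t. r1 < t \<and> t < r2)"
  have clos: "closed (shell (\<lambda>t. t \<le> r1))" "closed (shell (\<lambda>t. t \<le> r2))"
    using r by (auto intro!: compact_imp_closed compact_shell [where r = r2] closed_norm_ivl)
  have op: "open (shell (\<lambda>t. t < r2))" "open ?N" "open (shell (\<lambda>t. t < r1))"
    by (intro open_shell open_norm_ivl)+
  show "open ?C" using clos(1) \<Omega> by (simp add: open_Diff)
  show "?C \<subseteq> \<Omega>" by blast
  show "compact (shell (\<lambda>t. t = r1))" "compact (shell (\<lambda>t. t = r2))" "compact (shell (\<lambda>t. r1 \<le> t \<and> t \<le> r2))"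
    using r by (auto intro!: compact_shell [where r = r2] closed_norm_ivl)
  show "shell (\<lambda>t. t = r1) \<subseteq> \<Omega>" "shell (\<lambda>t. t = r2) \<subseteq> ?C" "?N \<subseteq> ?C"
    "shell (\<lambda>t. r1 \<le> t \<and> t \<le> r2) \<subseteq> \<Omega>"
    using sub r by (auto simp: shell_iff subset_iff)
  show "?C \<inter> shell (\<lambda>t. t = r1) = {}" "?N \<subseteq> shell (\<lambda>t. r1 \<le> t \<and> t \<le> r2)"
    by (auto simp: shell_iff)
  have "\<Omega> - (?C \<union> shell (\<lambda>t. t = r1)) = shell (\<lambda>t. t < r1) \<inter> \<Omega>"
    by (auto simp: shell_iff)
  then show "open (\<Omega> - (?C \<union> shell (\<lambda>t. t = r1)))" using \<Omega> op(3) by (simp add: open_Int)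
  have "\<Omega> - (?C - ?N) = shell (\<lambda>t. t < r2) \<inter> \<Omega>"
    using r sub by (auto simp: shell_iff subset_iff)
  then show "open (\<Omega> - (?C - ?N))" using \<Omega> op(1) by (simp add: open_Int)
  have "?N - shell (\<lambda>t. t = r2) = ?N" by (auto simp: shell_iff)
  then show "open (?N - shell (\<lambda>t. t = r2))" using op(2) by simp
  have "?C - ?N - shell (\<lambda>t. t = r2) = \<Omega> - shell (\<lambda>t. t \<le> r2)"
    using r by (auto simp: shell_iff)
  then show "open (?C - ?N - shell (\<lambda>t. t = r2))" using clos(2) \<Omega> by (simp add: open_Diff)
  fix J assume J: "compact J" "J \<subseteq> ?C"
  \<comment> \<open>Here \<open>J\<close> may leave the chart, so only its part of radius at most
    \<open>r2\<close> is measured.\<close>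
  have JW: "J \<inter> shell (\<lambda>t. t \<le> r2) \<subseteq> W" by (auto simp: shell_iff)
  have "compact (\<zeta> ` (J \<inter> shell (\<lambda>t. t \<le> r2)))"
    using J(1) clos(2) by (intro compact_coordinates JW compact_Int_closed)
  moreover have "r1 < norm z" if "z \<in> \<zeta> ` (J \<inter> shell (\<lambda>t. t \<le> r2))" for z
    using that J(2) by (force simp: shell_iff)
  ultimately obtain s where s: "r1 < s" "s < r2"
    "\<And>z. z \<in> \<zeta> ` (J \<inter> shell (\<lambda>t. t \<le> r2)) \<Longrightarrow> s \<le> norm z"
    using compact_outside_ball_gap [OF _ _ r(2)] by metis
  let ?T = "shell (\<lambda>t. r1 < t \<and> t < s)" and ?L = "shell (\<lambda>t. s \<le> t \<and> t \<le> r2)"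
  have "connected ?T" "?T \<noteq> {}" using s r connected_shell [of r1 s] by auto
  moreover have "?T \<subseteq> ?N - J"
  proof
    fix x assume x: "x \<in> ?T"
    then have x': "x \<in> W" "r1 < norm (\<zeta> x)" "norm (\<zeta> x) < s" by (auto simp: shell_iff)
    have "x \<notin> J"
    proof
      assume "x \<in> J"
      then have "x \<in> J \<inter> shell (\<lambda>t. t \<le> r2)" using x' s(2) by (simp add: shell_iff)
      then show False using s(3) [of "\<zeta> x"] x'(3) by auto
    qed
    then show "x \<in> ?N - J" using x' s(2) by (simp add: shell_iff)
  qed
  moreover have "compact ?L" using s r by (auto intro!: compact_shell [where r = r2] closed_norm_ivl)
  moreover have "?L \<subseteq> ?C" "?N - ?T \<subseteq> ?L" using s sub by (auto simp: shell_iff subset_iff)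
  ultimately show "\<exists>T L. connected T \<and> T \<noteq> {} \<and> T \<subseteq> ?N - J \<and> compact L \<and> L \<subseteq> ?C \<and> ?N - T \<subseteq> L"
    by blast
qed

end

text \<open>The puncture is the circle of radius 0 in a small disc around \<open>p\<close>, the
  degenerate case of \<open>collared_outer\<close>.\<close>

lemma collared_punctured:
  fixes \<Omega> :: "complex set"
  assumes \<Omega>: "open \<Omega>" and p: "p \<in> \<Omega>"
  shows "\<exists>N. collared (top_of_set \<Omega>) (\<Omega> - {p}) {p} N"
proof -
  obtain \<rho> where \<rho>: "0 < \<rho>" "ball p \<rho> \<subseteq> \<Omega>" using \<Omega> p openE by blast
  have "homeomorphism (ball 0 1) (ball p \<rho>) (\<lambda>z. p + of_real \<rho> * z) (\<lambda>w. (w - p) / of_real \<rho>)"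
  proof (rule homeomorphismI)
    show "continuous_on (ball 0 1) (\<lambda>z. p + of_real \<rho> * z)" "continuous_on (ball p \<rho>) (\<lambda>w. (w - p) / of_real \<rho>)"
      using \<rho>(1) by (auto intro!: continuous_intros)
    show "(\<lambda>z. p + of_real \<rho> * z) ` ball 0 1 \<subseteq> ball p \<rho>"
      using \<rho>(1) by (auto simp: dist_norm norm_mult)
    show "(\<lambda>w. (w - p) / of_real \<rho>) ` ball p \<rho> \<subseteq> ball 0 1"
      using \<rho>(1) by (auto simp: dist_norm norm_divide norm_minus_commute)
  qed (use \<rho>(1) in auto)
  then interpret disc_chart "ball p \<rho>" "\<lambda>z. p + of_real \<rho> * z" "\<lambda>w. (w - p) / of_real \<rho>"
    by unfold_locales auto
  have "shell (\<lambda>t. 0 \<le> t \<and> t \<le> 1 / 2) \<subseteq> \<Omega>" using \<rho>(2) by (auto simp: shell_iff)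
  moreover have "shell (\<lambda>t. t \<le> 0) = {p}" "shell (\<lambda>t. t = 0) = {p}"
    using \<rho>(1) by (auto simp: shell_iff)
  ultimately show ?thesis using collared_outer [OF \<Omega>, of 0 "1 / 2"] by auto
qed

section \<open>The curve axiom and circles as simple closed curves\<close>

definition curve_property :: "'m topology \<Rightarrow> bool" where
  "curve_property M \<longleftrightarrow>
     (\<forall>c. simple_closed_curve M c \<and> separating M c \<longrightarrow>
        (\<exists>C \<in> connected_components_of (subtopology M (topspace M - c)). \<exists>p \<in> topspace M.
           subtopology M C homeomorphic_space subtopology M (topspace M - {p})))"

lemma homeomorphic_map_subtopology_image:
  assumes h: "homeomorphic_map X Y h" and S: "S \<subseteq> topspace X"
  shows "homeomorphic_map (subtopology X S) (subtopology Y (h ` S)) h"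
proof (rule homeomorphic_map_subtopologies [OF h])
  have "h ` S \<subseteq> topspace Y" using S homeomorphic_imp_surjective_map [OF h] by blast
  then show "h ` (topspace X \<inter> S) = topspace Y \<inter> h ` S" using S by (simp add: Int_absorb1)
qed

lemma homeomorphic_map_image_Diff:
  assumes h: "homeomorphic_map X Y h" and S: "S \<subseteq> topspace X"
  shows "h ` (topspace X - S) = topspace Y - h ` S"
  using inj_on_image_set_diff [OF homeomorphic_imp_injective_map [OF h], of "topspace X" S] S
    homeomorphic_imp_surjective_map [OF h] by simp

text \<open>The axiom is moved twice: from the manifold to a plane domain, and from this domain to
  its image under an inversion.\<close>

lemma curve_property_homeomorphic:
  assumes hk: "homeomorphic_maps X Y h k" and X: "curve_property X"
  shows "curve_property Y"
  unfolding curve_property_def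
proof (intro allI impI, elim conjE)
  fix c assume c: "simple_closed_curve Y c" "separating Y c"
  have h: "homeomorphic_map X Y h" and k: "homeomorphic_map Y X k"
    using hk homeomorphic_maps_map by blast+
  have kh: "homeomorphic_maps Y X k h" using hk homeomorphic_maps_sym by blast
  obtain \<gamma> where \<gamma>: "embedding_map (top_of_set (sphere (0 :: real^2) 1)) Y \<gamma>" "c = \<gamma> ` sphere 0 1"
    using c(1) by (auto simp: simple_closed_curve_def)
  have "continuous_map (top_of_set (sphere (0 :: real^2) 1)) Y \<gamma>"
    using \<gamma>(1) homeomorphic_imp_continuous_map continuous_map_in_subtopology
    unfolding embedding_map_def by blast
  then have cY: "c \<subseteq> topspace Y"
    using \<gamma>(2) continuous_map_image_subset_topspace by fastforce
  have kc: "k ` c \<subseteq> topspace X" using cY homeomorphic_imp_surjective_map [OF k] by blast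
  have hkc: "h ` k ` c = c" by (rule homeomorphic_maps_image_inverse [OF kh cY])
  have "embedding_map (top_of_set (sphere (0 :: real^2) 1)) X (k \<circ> \<gamma>)"
    using embedding_map_compose [OF \<gamma>(1)] k surjective_embedding_map by blast
  then have 1: "simple_closed_curve X (k ` c)"
    unfolding simple_closed_curve_def \<gamma>(2) by (metis image_comp)
  let ?X = "subtopology X (topspace X - k ` c)" and ?Y = "subtopology Y (topspace Y - c)"
  have hXY: "homeomorphic_map ?X ?Y h"
    using homeomorphic_map_subtopology_image [OF h, of "topspace X - k ` c"]
      homeomorphic_map_image_Diff [OF h kc] hkc by simp
  then have "?X homeomorphic_space ?Y" by (rule homeomorphic_map_imp_homeomorphic_space)
  then have 2: "separating X (k ` c)"
    using c(2) homeomorphic_connected_space unfolding separating_def by blast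
  obtain C p where C: "C \<in> connected_components_of ?X" and p: "p \<in> topspace X"
    and iso: "subtopology X C homeomorphic_space subtopology X (topspace X - {p})"
    using X 1 2 unfolding curve_property_def by blast
  have CX: "C \<subseteq> topspace X"
    using compl_componentsD(3) [OF C] by blast
  have "h ` C \<in> connected_components_of ?Y"
    using homeomorphic_map_connected_components_of [OF hXY] C by blast
  moreover have "h p \<in> topspace Y" using p homeomorphic_imp_surjective_map [OF h] by blast
  moreover have "subtopology Y (h ` C) homeomorphic_space subtopology X C"
    using homeomorphic_map_subtopology_image [OF h CX]
    by (metis homeomorphic_map_imp_homeomorphic_space homeomorphic_space_sym)
  moreover have "subtopology X (topspace X - {p}) homeomorphic_space subtopology Y (topspace Y - {h p})"
  proof (rule homeomorphic_map_imp_homeomorphic_space)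
    show "homeomorphic_map (subtopology X (topspace X - {p})) (subtopology Y (topspace Y - {h p})) h"
      using homeomorphic_map_subtopology_image [OF h, of "topspace X - {p}"]
        homeomorphic_map_image_Diff [OF h, of "{p}"] p by simp
  qed
  ultimately show "\<exists>C\<in>connected_components_of ?Y. \<exists>p\<in>topspace Y.
      subtopology Y C homeomorphic_space subtopology Y (topspace Y - {p})"
    using iso by (meson homeomorphic_space_trans)
qed

lemma (in disc_chart) simple_closed_curve_shell:
  assumes r: "0 < r" "r < 1" and sub: "shell (\<lambda>t. t = r) \<subseteq> \<Omega>"
  shows "simple_closed_curve (top_of_set \<Omega>) (shell (\<lambda>t. t = r))"
proof -
  \<comment> \<open>Curves are parametrized by the unit circle of \<open>real^2\<close>;
    \<open>\<phi>\<close> identifies this plane linearly with the complex one, scaled to radius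
    \<open>r\<close>.\<close>
  define \<phi> :: "real^2 \<Rightarrow> complex" where "\<phi> = (\<lambda>v. of_real r * Complex (v $ 1) (v $ 2))"
  have norm: "norm (\<phi> v) = r * norm v" for v
  proof -
    have "norm v = sqrt ((v $ 1)\<^sup>2 + (v $ 2)\<^sup>2)"
      by (simp add: norm_eq_sqrt_inner inner_vec_def sum_2 power2_eq_square)
    then show ?thesis using r by (simp add: \<phi>_def norm_mult complex_norm)
  qed
  have cont: "continuous_on S \<phi>" for S
    unfolding \<phi>_def by (auto intro!: continuous_intros continuous_on_Complex)
  have inj: "\<phi> v = \<phi> w \<longleftrightarrow> v = w" for v w
    using r by (auto simp: \<phi>_def vec_eq_iff forall_2)
  have surj: "\<exists>v. \<phi> v = z" for z
  proof
    show "\<phi> (\<chi> i. if i = 1 then Re z / r else Im z / r) = z"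
      using r by (simp add: \<phi>_def complex_eq_iff)
  qed
  have im: "\<phi> ` sphere 0 1 = {z. norm z = r}"
  proof
    show "\<phi> ` sphere 0 1 \<subseteq> {z. norm z = r}" using norm by auto
    show "{z. norm z = r} \<subseteq> \<phi> ` sphere 0 1"
    proof
      fix z :: complex assume z: "z \<in> {z. norm z = r}"
      obtain v where v: "\<phi> v = z" using surj by blast
      then have "norm v = 1" using norm [of v] z r by simp
      then show "z \<in> \<phi> ` sphere 0 1" using v by (intro image_eqI [of _ _ v]) auto
    qed
  qed
  have "{z :: complex. norm z = r \<and> norm z < 1} = {z. norm z = r}" using r by auto
  then have eq: "(\<eta> \<circ> \<phi>) ` sphere 0 1 = shell (\<lambda>t. t = r)"
    unfolding shell_def image_comp [symmetric] im by simp
  have sub1: "{z :: complex. norm z = r} \<subseteq> ball 0 1" using r by auto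
  have "continuous_on (\<phi> ` sphere 0 1) \<eta>"
    unfolding im by (rule continuous_on_subset [OF homeomorphism_cont1 [OF chart] sub1])
  then have "continuous_on (sphere 0 1) (\<eta> \<circ> \<phi>)" by (rule continuous_on_compose [OF cont])
  then have 1: "continuous_map (top_of_set (sphere 0 1)) (top_of_set \<Omega>) (\<eta> \<circ> \<phi>)"
    using sub unfolding eq [symmetric] by (auto simp: continuous_map_in_subtopology)
  have 2: "inj_on (\<eta> \<circ> \<phi>) (sphere 0 1)"
  proof (rule comp_inj_on)
    show "inj_on \<phi> (sphere 0 1)" using inj by (simp add: inj_on_def)
    show "inj_on \<eta> (\<phi> ` sphere 0 1)"
      unfolding im
    proof (rule inj_on_inverseI [of _ \<zeta>])
      fix z :: complex assume "z \<in> {z. norm z = r}"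
      then show "\<zeta> (\<eta> z) = z" by (rule homeomorphism_apply1 [OF chart subsetD [OF sub1]])
    qed
  qed
  have "embedding_map (top_of_set (sphere 0 1)) (top_of_set \<Omega>) (\<eta> \<circ> \<phi>)"
    using 1 2 by (intro continuous_imp_embedding_map) (auto simp: compact_space_subtopology Hausdorff_space_subtopology)
  then show ?thesis unfolding simple_closed_curve_def eq [symmetric] by blast
qed

section \<open>Components of the complement of a compact connected set\<close>

lemma end_model_cobounded:
  assumes model: "end_model X E \<Lambda>" and D: "end_set X D" "bounded_in X (topspace X - D)"
  shows "\<Lambda> D = topspace E"
proof -
  obtain V where V: "end_set X V" "\<Lambda> V = topspace E"
    using model clopenin_topspace unfolding end_model_def by blast
  have "V \<subseteq> topspace X" using V(1) by (simp add: end_set_def)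
  then have "bounded_in X (V - D)" using D(2) by (intro bounded_in_subset [OF D(2)]) blast
  then have "topspace E \<subseteq> \<Lambda> D" using end_model_subset_iff [OF model V(1) D(1)] V(2) by simp
  moreover have "\<Lambda> D \<subseteq> topspace E" using clopenin_subset end_model_clopenin [OF model D(1)] by blast
  ultimately show ?thesis by blast
qed

text \<open>Janiszewski's theorem for two disjoint, hence trivially intersecting, sets.\<close>

lemma planar_connected_avoiding:
  fixes x y :: complex
  assumes "open \<Omega>" "connected \<Omega>" "compact S" "S \<subseteq> \<Omega>" "x \<in> \<Omega>" "y \<in> \<Omega>"
    and "connected_component (- S) x y"
  obtains T where "connected T" "T \<subseteq> \<Omega> - S" "x \<in> T" "y \<in> T"
proof -
  have "S \<inter> - \<Omega> = {}" using assms(4) by blast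
  then have "connected (S \<inter> - \<Omega>)" by simp
  moreover have "closed (- \<Omega>)" using assms(1) by (simp add: closed_Compl)
  moreover have "connected_component (- (- \<Omega>)) x y"
    using assms unfolding connected_component_def by auto
  ultimately have "connected_component (- (S \<union> - \<Omega>)) x y"
    by (intro Janiszewski assms)
  moreover have "- (S \<union> - \<Omega>) = \<Omega> - S" by blast
  ultimately have "connected_component (\<Omega> - S) x y" by simp
  then show thesis using that unfolding connected_component_def by blast
qed

text \<open>Two points of \<open>W\<close> in \<open>\<Omega>\<close> can be joined off
  \<open>K\<close> and joined inside \<open>\<Omega>\<close>; Janiszewski's theorem joins them under
  both constraints at once.\<close>

lemma connected_component_Int_planar:
  fixes \<Omega> :: "complex set"
  assumes "open \<Omega>" "connected \<Omega>" "compact K" "K \<subseteq> \<Omega>" "W \<in> components (- K)"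
  shows "connected (W \<inter> \<Omega>)"
  unfolding connected_iff_connected_component
proof (intro ballI)
  fix x y assume xy: "x \<in> W \<inter> \<Omega>" "y \<in> W \<inter> \<Omega>"
  have W: "connected W" "W \<subseteq> - K"
    using assms(5) in_components_connected in_components_subset by blast+
  then have "connected_component (- K) x y" using xy unfolding connected_component_def by blast
  then obtain T where T: "connected T" "T \<subseteq> \<Omega> - K" "x \<in> T" "y \<in> T"
    using planar_connected_avoiding [OF assms(1-4)] xy by (metis IntD2)
  have "T \<subseteq> W"
    by (rule components_maximal [OF assms(5) T(1)]) (use T xy in auto)
  then show "connected_component (W \<inter> \<Omega>) x y"
    using T unfolding connected_component_def by blast
qed

text \<open>
  Up to relatively compact sets, one of the two sides of \<open>W\<close> contains a set whose ends form a copy of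
  all ends. The quantification over \<open>\<Lambda>\<close> allows a later twist of the model by a homeomorphism of \<open>X\<close>.
\<close>

definition copy_beside :: "'m topology \<Rightarrow> 'e topology \<Rightarrow> 'm set \<Rightarrow> bool" where
  "copy_beside X E W \<longleftrightarrow> (\<exists>C. end_set X C \<and> (bounded_in X (C - W) \<or> bounded_in X (C \<inter> W)) \<and>
     (\<forall>\<Lambda>. end_model X E \<Lambda> \<longrightarrow> E homeomorphic_space subtopology E (\<Lambda> C)))"

text \<open>The complement of \<open>W\<close> is connected because \<open>K\<close> is, and
  unbounded because \<open>W\<close> is bounded. So \<open>W\<close> has no holes and is simply
  connected.\<close>

lemma bounded_component_disc:
  fixes W :: "complex set"
  assumes "compact K" "connected K" "W \<in> components (- K)" "bounded W"
  obtains \<eta> \<zeta> where "disc_chart W \<eta> \<zeta>"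
proof -
  have "open (- K)" using assms(1) by (simp add: compact_imp_closed open_Compl)
  then have oW: "open W" using assms(3) open_components by blast
  have W: "connected W" "W \<noteq> {}" using assms(3) in_components_connected in_components_nonempty by blast+
  have cW: "connected (- W)" by (rule component_complement_connected [OF assms(2,3)])
  have "inside W = {}"
  proof (rule equals0I)
    fix x assume "x \<in> inside W"
    then have x: "x \<in> - W" "bounded (connected_component_set (- W) x)" by (auto simp: inside_def)
    then have "bounded (- W)" using connected_component_eq_self [OF cW x(1)] by simp
    then show False using assms(4) cobounded_imp_unbounded by blast
  qed
  then have "simply_connected W"
    using simply_connected_eq_empty_inside [OF oW] W(1) by simp
  then have "W homeomorphic ball (0 :: complex) 1"
    using simply_connected_eq_homeomorphic_to_disc [OF oW] W(2) by simp
  then obtain \<zeta> \<eta> where "homeomorphism W (ball (0 :: complex) 1) \<zeta> \<eta>"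
    unfolding homeomorphic_def by blast
  then have "homeomorphism (ball 0 1) W \<eta> \<zeta>" by (rule homeomorphism_symD)
  then have "disc_chart W \<eta> \<zeta>" using oW by (simp add: disc_chart_def)
  then show thesis by (rule that)
qed

text \<open>The frontier of \<open>W\<close> lies in \<open>K\<close>, so the points of the closure
  of \<open>W\<close> outside \<open>\<Omega>\<close> form a compact subset of \<open>W\<close>, and
  all circles of large radius lie in \<open>\<Omega>\<close>. The curve axiom picks the inner or the
  outer side, whence the disjunction in \<open>copy_beside\<close>.\<close>

lemma bounded_component_copy:
  fixes \<Omega> W :: "complex set" and E :: "'e topology"
  assumes \<Omega>: "open \<Omega>" "connected \<Omega>" and K: "compact K" "connected K" "K \<subseteq> \<Omega>"
    and W: "W \<in> components (- K)" "bounded W"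
    and curve: "curve_property (top_of_set \<Omega>)" and E: "stone_space E"
  shows "copy_beside (top_of_set \<Omega>) E W"
proof -
  let ?X = "top_of_set \<Omega>"
  obtain \<eta> \<zeta> where "disc_chart W \<eta> \<zeta>" by (rule bounded_component_disc [OF K(1,2) W])
  then interpret disc_chart W \<eta> \<zeta> .
  have "frontier W \<subseteq> K"
    using frontier_of_components_closed_complement W(1) K(1) compact_imp_closed by blast
  then have clW: "closure W \<subseteq> W \<union> K" unfolding frontier_def interior_open [OF open_W] by blast
  have "compact (closure W - \<Omega>)"
    using W(2) \<Omega>(1) by (simp add: compact_diff compact_closure)
  moreover have sub: "closure W - \<Omega> \<subseteq> W" using clW K(3) by blast
  ultimately have "compact (\<zeta> ` (closure W - \<Omega>))" by (rule compact_coordinates)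
  moreover have "norm z < 1" if "z \<in> \<zeta> ` (closure W - \<Omega>)" for z
    using that sub homeomorphism_image2 [OF chart] by force
  ultimately obtain s where s: "0 < s" "s < 1" "\<And>z. z \<in> \<zeta> ` (closure W - \<Omega>) \<Longrightarrow> norm z \<le> s"
    using compact_subset_ball_gap [of "\<zeta> ` (closure W - \<Omega>)" 1 0] by auto
  have far: "x \<in> \<Omega>" if "x \<in> W" "s < norm (\<zeta> x)" for x
  proof (rule ccontr)
    assume "x \<notin> \<Omega>"
    then have "\<zeta> x \<in> \<zeta> ` (closure W - \<Omega>)" using that(1) closure_subset by blast
    then show False using s(3) that(2) by fastforce
  qed
  \<comment> \<open>The curve has radius \<open>r2\<close>; \<open>r1\<close> and \<open>r3\<close>
    leave room for a collar on each side, still beyond \<open>s\<close>, where the disc lies in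
    \<open>\<Omega>\<close>.\<close>
  define r1 r2 r3 where "r1 = s + (1 - s) / 4" and "r2 = s + (1 - s) / 2" and "r3 = s + (1 - s) * 3 / 4"
  have r: "s < r1" "r1 < r2" "r2 < r3" "r3 < 1"
    using s(2) by (auto simp: r1_def r2_def r3_def field_simps)
  have sh: "shell P \<subseteq> \<Omega>" if "\<And>t. P t \<Longrightarrow> s < t" for P
    using that far by (auto simp: shell_iff)
  let ?c = "shell (\<lambda>t. t = r2)" and ?C1 = "shell (\<lambda>t. t < r2) \<inter> \<Omega>" and ?C2 = "\<Omega> - shell (\<lambda>t. t \<le> r2)"
  have coll1: "collared ?X ?C1 ?c (shell (\<lambda>t. r1 < t \<and> t < r2))"
    using r s(1) by (intro collared_inner \<Omega>(1) sh) auto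
  have coll2: "collared ?X ?C2 ?c (shell (\<lambda>t. r2 < t \<and> t < r3))"
    using r s(1) by (intro collared_outer \<Omega>(1) sh) auto
  have ne1: "shell (\<lambda>t. r1 < t \<and> t < r2) \<noteq> {}" and ne2: "shell (\<lambda>t. r2 < t \<and> t < r3) \<noteq> {}"
    using r s(1) connected_shell(2) [of r1 r2] connected_shell(2) [of r2 r3] by auto
  have ne: "?C1 \<noteq> {}" "?C2 \<noteq> {}" using coll1 coll2 ne1 ne2 unfolding collared_def by blast+
  have op: "open ?C1" "open ?C2"
    using coll1 coll2 openin_open_eq [OF \<Omega>(1)] unfolding collared_def by blast+
  have part: "\<Omega> - ?c = ?C1 \<union> ?C2" "?C1 \<inter> ?C2 = {}"
    by (auto simp: shell_iff)
  have cpt: "compact ?c" "compact (shell (\<lambda>t. t \<le> r2))"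
    using r by (auto intro!: compact_shell [where r = r2] closed_norm_ivl)
  have cO: "?c \<subseteq> \<Omega>" using r by (intro sh) simp
  have split: "T \<subseteq> ?C1 \<or> T \<subseteq> ?C2" if T: "connected T" "T \<subseteq> \<Omega> - ?c" for T
  proof -
    have "T \<subseteq> ?C1 \<or> T \<inter> ?C1 = {}"
      using connectedin_clopen_subset [of euclidean T ?C1 ?C2] T part op by auto
    then show ?thesis using T(2) part(1) by blast
  qed
  \<comment> \<open>The open disc of radius \<open>r2\<close> is connected and misses the circle;
    Janiszewski's theorem keeps its intersection with \<open>\<Omega>\<close> connected. This
    identifies the component given by the curve axiom with a full side.\<close>
  have con1: "connected ?C1"
    unfolding connected_iff_connected_component
  proof (intro ballI)
    fix x y assume xy: "x \<in> ?C1" "y \<in> ?C1"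
    have "{z :: complex. norm z < r2 \<and> norm z < 1} = ball 0 r2" using r by auto
    then have "connected (shell (\<lambda>t. t < r2))"
      unfolding shell_def using r
      by (auto intro!: connected_continuous_image continuous_on_subset [OF homeomorphism_cont1 [OF chart]])
    moreover have "shell (\<lambda>t. t < r2) \<subseteq> - ?c" by (auto simp: shell_iff)
    ultimately have "connected_component (- ?c) x y"
      using xy unfolding connected_component_def by blast
    then obtain T where T: "connected T" "T \<subseteq> \<Omega> - ?c" "x \<in> T" "y \<in> T"
      using planar_connected_avoiding [OF \<Omega> cpt(1) cO] xy by (metis IntD2)
    then have "T \<subseteq> ?C1" using split [OF T(1,2)] xy part(2) by blast
    then show "connected_component ?C1 x y" using T unfolding connected_component_def by blast
  qed
  \<comment> \<open>The same argument outside, where connectedness before intersecting comes from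
    the closed disc being homeomorphic to a convex compact set.\<close>
  have con2: "connected ?C2"
    unfolding connected_iff_connected_component
  proof (intro ballI)
    fix x y assume xy: "x \<in> ?C2" "y \<in> ?C2"
    have eq: "{z :: complex. norm z \<le> r2 \<and> norm z < 1} = cball 0 r2" using r by auto
    have "homeomorphism (cball 0 r2) (shell (\<lambda>t. t \<le> r2)) \<eta> \<zeta>"
      using r by (intro homeomorphism_of_subsets [OF chart]) (auto simp: shell_def eq homeomorphism_image1 [OF chart, symmetric])
    then have hom: "shell (\<lambda>t. t \<le> r2) homeomorphic cball (0::complex) r2"
      using homeomorphic_def homeomorphic_sym by blast
    have conn: "connected (- shell (\<lambda>t. t \<le> r2))"
      by (rule connected_complement_homeomorphic_convex_compact [OF hom]) auto
    have x': "x \<in> \<Omega>" "y \<in> \<Omega>" "x \<in> - shell (\<lambda>t. t \<le> r2)" "y \<in> - shell (\<lambda>t. t \<le> r2)" using xy by auto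
    have "- shell (\<lambda>t. t \<le> r2) \<subseteq> - ?c" by (auto simp: shell_iff)
    then have "connected_component (- ?c) x y"
      using conn x' unfolding connected_component_def by blast
    then obtain T where T: "connected T" "T \<subseteq> \<Omega> - ?c" "x \<in> T" "y \<in> T"
      using planar_connected_avoiding [OF \<Omega> cpt(1) cO x'(1,2)] by metis
    then have "T \<subseteq> ?C2" using split [OF T(1,2)] xy part(2) by blast
    then show "connected_component ?C2 x y" using T unfolding connected_component_def by blast
  qed
  have "simple_closed_curve ?X ?c"
    using r s(1) by (intro simple_closed_curve_shell cO) auto
  moreover have "separating ?X ?c"
  proof -
    have "\<not> connected (\<Omega> - ?c)"
    proof
      assume "connected (\<Omega> - ?c)"
      then have "\<Omega> - ?c \<subseteq> ?C1 \<or> \<Omega> - ?c \<subseteq> ?C2" by (rule split) simp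
      then show False using part ne by blast
    qed
    then show ?thesis
      unfolding separating_def by (simp add: subtopology_top_of_set flip: connectedin_topspace)
  qed
  ultimately obtain C p where C: "C \<in> compl_components ?X ?c" and p: "p \<in> \<Omega>"
    and iso: "subtopology ?X C homeomorphic_space subtopology ?X (\<Omega> - {p})"
    using curve unfolding curve_property_def by auto
  have Cc: "connected C" "C \<subseteq> \<Omega> - ?c" "C \<noteq> {}"
    using compl_componentsD [OF C] by (auto simp: connectedin_subtopology)
  have max: "T \<subseteq> C" if "connected T" "T \<subseteq> \<Omega> - ?c" "T \<inter> C \<noteq> {}" for T
    by (rule compl_components_maximal [OF C]) (use that in \<open>auto simp: connectedin_subtopology\<close>)
  have C12: "C = ?C1 \<or> C = ?C2"
    using split [OF Cc(1,2)]
  proof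
    assume "C \<subseteq> ?C1"
    then have "?C1 \<subseteq> C" using part(1) Cc(3) by (intro max con1) auto
    then show ?thesis using \<open>C \<subseteq> ?C1\<close> by blast
  next
    assume "C \<subseteq> ?C2"
    then have "?C2 \<subseteq> C" using part(1) Cc(3) by (intro max con2) auto
    then show ?thesis using \<open>C \<subseteq> ?C2\<close> by blast
  qed
  then obtain N where N: "collared ?X C ?c N" using coll1 coll2 by blast
  have Haus: "Hausdorff_space ?X" by (simp add: Hausdorff_space_subtopology)
  have end': "end_set ?X C'" if "collared ?X C' c' N'" for C' c' N'
  proof -
    have "C' \<subseteq> \<Omega>" using that openin_subset by (fastforce simp: collared_def)
    then have "topspace (subtopology ?X C') = C'" by auto
    then show ?thesis using collared_end_set [OF that end_set_topspace] by simp
  qed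
  obtain N' where N': "collared ?X (\<Omega> - {p}) {p} N'" using collared_punctured [OF \<Omega>(1) p] by blast
  have "E homeomorphic_space subtopology E (\<Lambda> C)" if model: "end_model ?X E \<Lambda>" for \<Lambda>
  proof -
    \<comment> \<open>A point is bounded, so the punctured domain still carries all ends of
      \<open>\<Omega>\<close>.\<close>
    have "topspace ?X - (\<Omega> - {p}) = {p}" using p by auto
    moreover have "bounded_in ?X {p}"
      using p by (intro bounded_in_compactin) (simp add: compactin_top_of_set)
    ultimately have "\<Lambda> (\<Omega> - {p}) = topspace E"
      using end_model_cobounded [OF model end' [OF N']] by simp
    then have "subtopology E (\<Lambda> C) homeomorphic_space E"
      using collared_homeomorphic [OF Haus E model N N' iso] by simp
    then show ?thesis using homeomorphic_space_sym by blast
  qed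
  moreover have "bounded_in ?X (C - W) \<or> bounded_in ?X (C \<inter> W)"
    using C12
  proof
    assume "C = ?C1"
    then have "C - W = {}" by (auto simp: shell_iff)
    then have "bounded_in ?X (C - W)" by (simp only: bounded_in_empty)
    then show ?thesis by simp
  next
    assume C2: "C = ?C2"
    \<comment> \<open>Inside \<open>W\<close> the outer side consists of points beyond the circle.
      Adding the frontier, which lies in \<open>K\<close>, makes this a compact subset of
      \<open>\<Omega>\<close>.\<close>
    let ?Z = "closure W - shell (\<lambda>t. t < r2)"
    have "compact ?Z"
      using W(2) by (intro compact_diff open_shell open_norm_ivl) (simp add: compact_closure)
    moreover have "?Z \<subseteq> \<Omega>"
    proof
      fix x assume x: "x \<in> ?Z"
      show "x \<in> \<Omega>"
      proof (cases "x \<in> W")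
        case True
        then show ?thesis using x r far by (auto simp: shell_iff)
      next
        case False
        then show ?thesis using x clW K(3) by blast
      qed
    qed
    moreover have "C \<inter> W \<subseteq> ?Z" using C2 closure_subset by (fastforce simp: shell_iff)
    ultimately have "bounded_in ?X (C \<inter> W)"
      by (intro bounded_in_subset [OF bounded_in_compactin]) (simp_all add: compactin_top_of_set)
    then show ?thesis by simp
  qed
  ultimately show ?thesis unfolding copy_beside_def using end' [OF N] by blast
qed

lemma unbounded_component_outside:
  fixes W :: "complex set"
  assumes K: "compact K" and W: "W \<in> components (- K)" "\<not> bounded W"
  obtains R where "0 < R" "\<And>z. R < norm z \<Longrightarrow> z \<in> W"
proof -
  obtain R where R: "0 < R" "\<And>z. z \<in> K \<Longrightarrow> norm z \<le> R"
    using compact_imp_bounded [OF K] bounded_pos by blast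
  have "connected (- cball (0 :: complex) R)"
    by (rule connected_complement_bounded_convex) auto
  moreover have "- cball 0 R \<subseteq> - K" using R(2) by auto
  moreover have "W \<inter> - cball 0 R \<noteq> {}"
  proof
    assume "W \<inter> - cball 0 R = {}"
    then have "W \<subseteq> cball 0 R" by blast
    then show False using W(2) bounded_subset [OF bounded_cball] by blast
  qed
  ultimately have "- cball 0 R \<subseteq> W" by (intro components_maximal [OF W(1)])
  then show thesis using that [OF R(1)] by (auto simp: subset_iff)
qed

lemma copy_beside_homeomorphic:
  assumes hk: "homeomorphic_maps X Y h k" and Y: "copy_beside Y E W'"
    and W: "\<And>x. x \<in> topspace X \<Longrightarrow> x \<in> W \<longleftrightarrow> h x \<in> W'"
  shows "copy_beside X E W"
proof -
  have k: "homeomorphic_map Y X k" using hk homeomorphic_maps_map by blast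
  obtain C where C: "end_set Y C" "bounded_in Y (C - W') \<or> bounded_in Y (C \<inter> W')"
    and iso: "\<And>\<Lambda>. end_model Y E \<Lambda> \<Longrightarrow> E homeomorphic_space subtopology E (\<Lambda> C)"
    using Y unfolding copy_beside_def by blast
  have W': "k y \<in> W \<longleftrightarrow> y \<in> W'" if "y \<in> C" for y
  proof -
    have y: "y \<in> topspace Y" using that C(1) by (auto simp: end_set_def)
    then have "k y \<in> topspace X" "h (k y) = y"
      using hk unfolding homeomorphic_maps_def continuous_map_def by auto
    then show ?thesis using W [of "k y"] by simp
  qed
  have "k ` C - W = k ` (C - W')" "k ` C \<inter> W = k ` (C \<inter> W')"
    using W' by auto
  then have "bounded_in X (k ` C - W) \<or> bounded_in X (k ` C \<inter> W)"
    using C(2) bounded_in_homeomorphic_image [OF k] by auto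
  moreover have "end_set X (k ` C)" by (rule end_set_homeomorphic_image [OF k C(1)])
  moreover have "E homeomorphic_space subtopology E (\<Lambda> (k ` C))" if "end_model X E \<Lambda>" for \<Lambda>
    by (rule iso [OF end_model_homeomorphic [OF hk that]])
  ultimately show ?thesis unfolding copy_beside_def by blast
qed

lemma homeomorphic_maps_top_of_set:
  "homeomorphism S T f g \<Longrightarrow> homeomorphic_maps (top_of_set S) (top_of_set T) f g"
  unfolding homeomorphic_maps_def homeomorphism_def by (auto simp: continuous_map_in_subtopology)

text \<open>Inversion at \<open>q\<close> turns \<open>W\<close>, up to the point at infinity, into a bounded component.\<close>

lemma copy_beside_inversion:
  fixes \<Omega> W :: "complex set" and E :: "'e topology"
  assumes \<Omega>: "open \<Omega>" "connected \<Omega>" and K: "compact K" "connected K" "K \<subseteq> \<Omega>"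
    and W: "W \<in> components (- K)" "x0 \<in> W \<inter> \<Omega>" and q: "q \<notin> \<Omega>" "q \<notin> W"
    and curve: "curve_property (top_of_set \<Omega>)" and E: "stone_space E"
  shows "copy_beside (top_of_set \<Omega>) E W"
proof -
  define \<iota> where "\<iota> = (\<lambda>z. inverse (z - q))"
  define \<kappa> where "\<kappa> = (\<lambda>w. q + inverse w)"
  \<comment> \<open>As \<open>inverse 0 = 0\<close>, both identities hold without exception;
    \<open>q\<close> and 0 must be avoided only for continuity.\<close>
  have \<kappa>\<iota>: "\<kappa> (\<iota> z) = z" for z by (simp add: \<iota>_def \<kappa>_def)
  have \<iota>\<kappa>: "\<iota> (\<kappa> w) = w" for w by (simp add: \<iota>_def \<kappa>_def)
  have \<iota>0: "\<iota> z \<noteq> 0" if "z \<noteq> q" for z using that by (simp add: \<iota>_def)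
  have cont\<iota>: "continuous_on S \<iota>" if "q \<notin> S" for S
    unfolding \<iota>_def using that by (intro continuous_intros) auto
  have cont\<kappa>: "continuous_on S \<kappa>" if "0 \<notin> S" for S
    unfolding \<kappa>_def using that by (intro continuous_intros) auto
  let ?\<Omega> = "\<iota> ` \<Omega>" and ?K = "\<iota> ` K"
  have Kq: "q \<notin> K" using K(3) q(1) by blast
  have hom: "homeomorphism \<Omega> ?\<Omega> \<iota> \<kappa>"
  proof (rule homeomorphismI)
    show "continuous_on ?\<Omega> \<kappa>"
      using \<iota>0 q(1) by (intro cont\<kappa>) force
  qed (use cont\<iota> q(1) \<kappa>\<iota> \<iota>\<kappa> in auto)
  have maps: "homeomorphic_maps (top_of_set \<Omega>) (top_of_set ?\<Omega>) \<iota> \<kappa>"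
    by (rule homeomorphic_maps_top_of_set [OF hom])
  have "?\<Omega> = (- {0}) \<inter> \<kappa> -` \<Omega>"
  proof
    show "?\<Omega> \<subseteq> (- {0}) \<inter> \<kappa> -` \<Omega>" using \<kappa>\<iota> \<iota>0 q(1) by force
    show "(- {0}) \<inter> \<kappa> -` \<Omega> \<subseteq> ?\<Omega>" using \<iota>\<kappa> by (auto simp: image_iff) (metis \<iota>\<kappa>)
  qed
  moreover have "open (- {0 :: complex})" by (simp add: open_Compl)
  ultimately have open\<Omega>: "open ?\<Omega>"
    using continuous_open_preimage [OF cont\<kappa> [of "- {0}"] _ \<Omega>(1)] by simp
  have conn\<Omega>: "connected ?\<Omega>" by (rule connected_continuous_image [OF cont\<iota> [OF q(1)] \<Omega>(2)])
  have K': "compact ?K" "connected ?K" "?K \<subseteq> ?\<Omega>"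
    using compact_continuous_image [OF cont\<iota> [OF Kq] K(1)]
      connected_continuous_image [OF cont\<iota> [OF Kq] K(2)] K(3) by auto
  have \<iota>K: "\<iota> z \<in> ?K \<longleftrightarrow> z \<in> K" for z
    using \<kappa>\<iota> by (metis image_eqI imageE)
  have \<kappa>K: "\<kappa> w \<in> K \<longleftrightarrow> w \<in> ?K" for w
    using \<iota>K [of "\<kappa> w"] \<iota>\<kappa> by simp
  have WK: "W \<subseteq> - K" using W(1) by (rule in_components_subset)
  have x0: "x0 \<in> W" "x0 \<in> \<Omega>" "x0 \<notin> K" "x0 \<noteq> q" using W(2) WK q(1) by auto
  \<comment> \<open>If \<open>W\<close> is unbounded, then 0, the image of infinity, belongs to
    \<open>W'\<close> without coming from a point of \<open>W\<close>. So \<open>W'\<close> is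
    defined through a base point and compared with \<open>W\<close> only inside
    \<open>\<Omega>\<close>.\<close>
  define W' where "W' = connected_component_set (- ?K) (\<iota> x0)"
  have x0': "\<iota> x0 \<in> - ?K" using x0(3) \<iota>K by simp
  then have comp: "W' \<in> components (- ?K)" unfolding W'_def components_def by blast
  have x0W: "\<iota> x0 \<in> W'" unfolding W'_def using x0' by simp
  have W'K: "W' \<subseteq> - ?K" "connected W'" using comp in_components_subset in_components_connected by blast+
  have oW': "open W'"
    using comp K'(1) open_components compact_imp_closed open_Compl by blast
  have into_W: "\<kappa> ` T \<subseteq> W" if T: "connected T" "T \<subseteq> W'" "0 \<notin> T" "\<iota> x0 \<in> T" for T
  proof (rule components_maximal [OF W(1)])
    show "connected (\<kappa> ` T)" by (rule connected_continuous_image [OF cont\<kappa> [OF T(3)] T(1)])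
    show "\<kappa> ` T \<subseteq> - K" using T(2) W'K(1) \<kappa>K by blast
    have "\<kappa> (\<iota> x0) \<in> \<kappa> ` T" using T(4) by (rule imageI)
    then show "W \<inter> \<kappa> ` T \<noteq> {}" using \<kappa>\<iota> x0(1) by auto
  qed
  have sides: "x \<in> W \<longleftrightarrow> \<iota> x \<in> W'" if x: "x \<in> \<Omega>" for x
  proof
    assume "x \<in> W"
    have "connected (\<iota> ` (W \<inter> \<Omega>))"
      by (rule connected_continuous_image [OF cont\<iota> connected_component_Int_planar [OF \<Omega> K(1,3) W(1)]])
        (use q in auto)
    moreover have "\<iota> ` (W \<inter> \<Omega>) \<subseteq> - ?K"
    proof (rule image_subsetI)
      fix z assume "z \<in> W \<inter> \<Omega>"
      then have "z \<notin> K" using WK by blast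
      then show "\<iota> z \<in> - ?K" unfolding Compl_iff \<iota>K .
    qed
    moreover have "\<iota> x0 \<in> \<iota> ` (W \<inter> \<Omega>)" using W(2) by (rule imageI)
    then have "W' \<inter> \<iota> ` (W \<inter> \<Omega>) \<noteq> {}" using x0W by blast
    ultimately have "\<iota> ` (W \<inter> \<Omega>) \<subseteq> W'" by (intro components_maximal [OF comp])
    then show "\<iota> x \<in> W'" using x \<open>x \<in> W\<close> by blast
  next
    assume "\<iota> x \<in> W'"
    have "0 \<notin> W' \<inter> ?\<Omega>" using \<iota>0 q(1) by force
    then have "\<kappa> ` (W' \<inter> ?\<Omega>) \<subseteq> W"
      using connected_component_Int_planar [OF open\<Omega> conn\<Omega> K'(1,3) comp] x0W x0(2)
      by (intro into_W) auto
    moreover have "\<iota> x \<in> W' \<inter> ?\<Omega>" using \<open>\<iota> x \<in> W'\<close> x by simp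
    ultimately have "\<kappa> (\<iota> x) \<in> W" by blast
    then show "x \<in> W" by (simp add: \<kappa>\<iota>)
  qed
  \<comment> \<open>Otherwise \<open>W'\<close> contains a neighbourhood of infinity, so
    \<open>W\<close> contains a punctured disc around \<open>q\<close>; since \<open>q\<close> is
    not in \<open>K\<close>, it would then lie in \<open>W\<close>.\<close>
  have "bounded W'"
  proof (rule ccontr)
    assume "\<not> bounded W'"
    then obtain R where R: "0 < R" "\<And>z. R < norm z \<Longrightarrow> z \<in> W'"
      by (rule unbounded_component_outside [OF K'(1) comp]) (rule that)
    have "connected (W' - {0})" by (rule connected_open_delete [OF oW' W'K(2)]) simp
    then have sub: "\<kappa> ` (W' - {0}) \<subseteq> W"
      using x0W \<iota>0 [OF x0(4)] by (intro into_W) auto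
    have near: "z \<in> W" if z: "z \<in> ball q (1 / R)" "z \<noteq> q" for z
    proof -
      have "norm (z - q) < 1 / R" "0 < norm (z - q)" using z by (auto simp: dist_norm norm_minus_commute)
      then have "R < inverse (norm (z - q))"
        using R(1) by (simp add: field_simps)
      then have "R < norm (\<iota> z)" by (simp add: \<iota>_def norm_inverse)
      then have "\<iota> z \<in> W' - {0}" using R(2) \<iota>0 [OF z(2)] by simp
      then have "\<kappa> (\<iota> z) \<in> W" using sub by blast
      then show ?thesis by (simp add: \<kappa>\<iota>)
    qed
    have "ball q (1 / R) \<subseteq> W"
    proof (rule components_maximal [OF W(1)])
      show "ball q (1 / R) \<subseteq> - K" using near WK Kq by blast
      have "q + of_real (1 / (2 * R)) \<in> ball q (1 / R)" "q + of_real (1 / (2 * R)) \<noteq> q"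
        using R(1) by (auto simp: dist_norm norm_divide norm_mult field_simps)
      then show "W \<inter> ball q (1 / R) \<noteq> {}" using near by blast
    qed simp
    moreover have "q \<in> ball q (1 / R)" using R(1) by simp
    ultimately show False using q(2) by blast
  qed
  then have "copy_beside (top_of_set ?\<Omega>) E W'"
    using bounded_component_copy [OF open\<Omega> conn\<Omega> K' comp _ curve_property_homeomorphic [OF maps curve] E]
    by blast
  then show ?thesis
    by (rule copy_beside_homeomorphic [OF maps]) (simp add: sides)
qed

text \<open>All of \<open>\<Omega>\<close> serves as the copy if \<open>W\<close> misses
  \<open>\<Omega>\<close>, or if \<open>W\<close> is unbounded and contains the complement of
  \<open>\<Omega>\<close>, because then the complement of \<open>W\<close> is a compact subset of
  \<open>\<Omega>\<close>. In the remaining unbounded case there is a point outside both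
  \<open>\<Omega>\<close> and \<open>W\<close> at which to invert.\<close>

lemma component_copy:
  fixes \<Omega> W :: "complex set" and E :: "'e topology"
  assumes \<Omega>: "open \<Omega>" "connected \<Omega>" and K: "compact K" "connected K" "K \<subseteq> \<Omega>"
    and W: "W \<in> components (- K)"
    and curve: "curve_property (top_of_set \<Omega>)" and E: "stone_space E"
  shows "copy_beside (top_of_set \<Omega>) E W"
proof -
  have whole: "copy_beside (top_of_set \<Omega>) E W"
    if "bounded_in (top_of_set \<Omega>) (\<Omega> - W) \<or> bounded_in (top_of_set \<Omega>) (\<Omega> \<inter> W)"
  proof -
    have end\<Omega>: "end_set (top_of_set \<Omega>) \<Omega>" using end_set_topspace [of "top_of_set \<Omega>"] by simp
    have "E homeomorphic_space subtopology E (\<Lambda> \<Omega>)" if "end_model (top_of_set \<Omega>) E \<Lambda>" for \<Lambda>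
      using end_model_cobounded [OF that end\<Omega>] by (simp add: homeomorphic_space_refl)
    then show ?thesis using that end\<Omega> unfolding copy_beside_def by blast
  qed
  consider "bounded W" | "W \<inter> \<Omega> = {}" | "\<not> bounded W" "- \<Omega> \<subseteq> W"
    | x q where "x \<in> W \<inter> \<Omega>" "q \<notin> \<Omega>" "q \<notin> W"
    by blast
  then show ?thesis
  proof cases
    case 1
    then show ?thesis by (intro bounded_component_copy [OF \<Omega> K W _ curve E])
  next
    case 2
    then have "\<Omega> \<inter> W = {}" by blast
    then have "bounded_in (top_of_set \<Omega>) (\<Omega> \<inter> W)" by (simp only: bounded_in_empty)
    then show ?thesis using whole by simp
  next
    case 3
    obtain R where R: "0 < R" "\<And>z. R < norm z \<Longrightarrow> z \<in> W"
      by (rule unbounded_component_outside [OF K(1) W 3(1)]) (rule that)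
    have "- W \<subseteq> cball 0 R"
    proof
      fix z assume "z \<in> - W"
      then show "z \<in> cball 0 R" using R(2) [of z] by (cases "norm z \<le> R") auto
    qed
    then have "bounded (- W)" using bounded_cball bounded_subset by blast
    moreover have "open W" using W K(1) open_components compact_imp_closed open_Compl by blast
    ultimately have "compact (- W)" by (simp add: compact_eq_bounded_closed closed_Compl)
    then have "bounded_in (top_of_set \<Omega>) (- W)"
      using 3(2) by (intro bounded_in_compactin) (auto simp: compactin_top_of_set)
    then have "bounded_in (top_of_set \<Omega>) (\<Omega> - W)" by (rule bounded_in_subset) blast
    then show ?thesis using whole by simp
  next
    case 4
    then show ?thesis by (intro copy_beside_inversion [OF \<Omega> K W _ _ _ curve E])
  qed
qed

section \<open>The dichotomy for plane domains\<close>

lemma compact_connected_superset: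
  fixes \<Omega> :: "complex set"
  assumes \<Omega>: "open \<Omega>" "connected \<Omega>" "\<Omega> \<noteq> {}" and L: "compact L" "L \<subseteq> \<Omega>"
  obtains K where "compact K" "connected K" "K \<noteq> {}" "L \<subseteq> K" "K \<subseteq> \<Omega>"
proof -
  obtain a where a: "a \<in> \<Omega>" using \<Omega>(3) by blast
  have pc: "path_connected \<Omega>" using \<Omega> by (simp add: connected_open_path_connected)
  \<comment> \<open>A path from the base point \<open>a\<close> to \<open>x\<close> together with a
    closed disc around \<open>x\<close>; finitely many such sets cover \<open>L\<close> and all
    share \<open>a\<close>.\<close>
  have "\<exists>T. compact T \<and> connected T \<and> a \<in> T \<and> T \<subseteq> \<Omega> \<and> x \<in> interior T" if x: "x \<in> L" for x
  proof -
    obtain e where e: "0 < e" "cball x e \<subseteq> \<Omega>" using \<Omega>(1) x L(2) open_contains_cball by blast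
    have "x \<in> \<Omega>" using x L(2) by blast
    then obtain g where g: "path g" "path_image g \<subseteq> \<Omega>" "pathstart g = a" "pathfinish g = x"
      using pc a unfolding path_connected_def by blast
    have gi: "a \<in> path_image g" "x \<in> path_image g"
      using g(3,4) pathstart_in_path_image pathfinish_in_path_image by metis+
    have "compact (path_image g \<union> cball x e)" using compact_path_image [OF g(1)] by auto
    moreover have "connected (path_image g \<union> cball x e)"
      using connected_path_image [OF g(1)] gi e(1) by (intro connected_Un) auto
    moreover have "x \<in> interior (path_image g \<union> cball x e)"
    proof (rule interiorI)
      show "open (ball x e)" "x \<in> ball x e" "ball x e \<subseteq> path_image g \<union> cball x e"
        using e(1) by auto
    qed
    ultimately show ?thesis using g(2) e(2) gi(1) by (intro exI [of _ "path_image g \<union> cball x e"]) auto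
  qed
  then obtain T where T: "\<And>x. x \<in> L \<Longrightarrow> compact (T x) \<and> connected (T x) \<and> a \<in> T x \<and> T x \<subseteq> \<Omega> \<and> x \<in> interior (T x)"
    by metis
  obtain F where F: "F \<subseteq> L" "finite F" "L \<subseteq> (\<Union>x\<in>F. interior (T x))"
    by (rule compactE_image [OF L(1), of L "\<lambda>x. interior (T x)"]) (use T in auto)
  let ?K = "\<Union>(insert {a} (T ` F))"
  have "compact ?K" using F(1,2) T by (intro compact_Union) auto
  moreover have "connected ?K"
  proof (rule connected_Union)
    show "\<And>S. S \<in> insert {a} (T ` F) \<Longrightarrow> connected S" using F(1) T by auto
    have "a \<in> \<Inter>(insert {a} (T ` F))" using F(1) T by auto
    then show "\<Inter>(insert {a} (T ` F)) \<noteq> {}" by blast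
  qed
  moreover have "L \<subseteq> ?K" using F(3) interior_subset by fastforce
  moreover have "?K \<subseteq> \<Omega>" "?K \<noteq> {}" using F(1) T a by auto
  ultimately show thesis using that by blast
qed

lemma contains_copy_homeomorphic_space:
  assumes "E homeomorphic_space subtopology E P" "clopenin E P" "P \<subseteq> A" "clopenin E A"
  shows "contains_copy E A"
proof -
  obtain h where h: "homeomorphic_map E (subtopology E P) h"
    using assms(1) homeomorphic_space by blast
  have "h ` topspace E = P"
    using homeomorphic_imp_surjective_map [OF h] clopenin_subset [OF assms(2)] by auto
  then show ?thesis
    using clopen_embedding_homeomorphic_map [OF h assms(2)] assms(3,4) unfolding contains_copy_def by blast
qed

text \<open>An end model is required to respect only the order. A set representing the intersection
  of the two images is bounded modulo \<open>V\<close> and modulo its complement, hence bounded, so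
  the intersection is empty.\<close>

lemma end_model_compl:
  assumes X: "Hausdorff_space X" and model: "end_model X E \<Lambda>" and V: "end_set X V"
  shows "\<Lambda> (topspace X - V) \<subseteq> topspace E - \<Lambda> V"
proof -
  have V': "end_set X (topspace X - V)" by (rule end_set_compl [OF V])
  have cl: "clopenin E (\<Lambda> V)" "clopenin E (\<Lambda> (topspace X - V))"
    using end_model_clopenin [OF model] V V' by blast+
  obtain U where U: "end_set X U" "\<Lambda> U = \<Lambda> V \<inter> \<Lambda> (topspace X - V)"
    using model clopenin_Int [OF cl] unfolding end_model_def by blast
  obtain Z where Z: "end_set X Z" "\<Lambda> Z = {}"
    using model clopenin_empty unfolding end_model_def by blast
  have "bounded_in X (U - V)" "bounded_in X (U - (topspace X - V))"
    using end_model_subset_iff [OF model U(1)] V V' U(2) by blast+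
  then have "bounded_in X ((U - V) \<union> (U - (topspace X - V)))" by (rule bounded_in_Un)
  then have "bounded_in X (U - Z)" by (rule bounded_in_subset) blast
  then have "\<Lambda> U \<subseteq> \<Lambda> Z" using end_model_subset_iff [OF model U(1) Z(1)] by simp
  then show ?thesis using U(2) Z(2) clopenin_subset [OF cl(2)] by blast
qed

text \<open>
  A homeomorphism \<open>f\<close> displacing \<open>K\<close> maps the complement of \<open>W2\<close> into \<open>W1\<close>, where \<open>W2\<close> contains the
  preimage and \<open>W1\<close> the image of \<open>K\<close>. So whichever side of \<open>W2\<close> contains a copy of all ends, some component
  does.
\<close>

theorem planar_copy_dichotomy:
  fixes \<Omega> :: "complex set" and E :: "'e topology"
  assumes \<Omega>: "open \<Omega>" "connected \<Omega>" and E: "stone_space E"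
    and model: "end_model (top_of_set \<Omega>) E \<Lambda>" and curve: "curve_property (top_of_set \<Omega>)"
    and displ: "\<And>K. compact K \<Longrightarrow> K \<subseteq> \<Omega> \<Longrightarrow> K \<noteq> \<Omega> \<Longrightarrow> displaceable (top_of_set \<Omega>) K"
  shows "copy_dichotomy E"
  unfolding copy_dichotomy_def
proof (intro allI impI)
  fix A assume A: "clopenin E A"
  let ?X = "top_of_set \<Omega>"
  have Haus: "Hausdorff_space ?X" by (simp add: Hausdorff_space_subtopology)
  have A': "clopenin E (topspace E - A)" using A by (rule clopenin_compl)
  obtain V where V: "end_set ?X V" "\<Lambda> V = A" using model A unfolding end_model_def by blast
  have V\<Omega>: "V \<subseteq> \<Omega>" using V(1) by (simp add: end_set_def)
  show "contains_copy E A \<or> contains_copy E (topspace E - A)"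
  proof (cases "\<Omega> = {}")
    case True
    obtain U where U: "end_set ?X U" "\<Lambda> U = topspace E"
      using model clopenin_topspace unfolding end_model_def by blast
    have "U = {}" "V = {}" using True V\<Omega> U(1) by (auto simp: end_set_def)
    then have "A = topspace E" using U(2) V(2) by simp
    moreover have "E homeomorphic_space subtopology E (topspace E)" by (simp add: homeomorphic_space_refl)
    ultimately show ?thesis
      using contains_copy_homeomorphic_space [of E "topspace E" A] by simp
  next
    case False
    obtain L where L: "compact L" "L \<subseteq> \<Omega>" "open (V - L)" "open (\<Omega> - V - L)"
      using V(1) unfolding end_set_top_of_set [OF \<Omega>(1) V\<Omega>] by blast
    \<comment> \<open>Since \<open>K\<close> contains the witness \<open>L\<close>, each component
      of its complement meets \<open>\<Omega>\<close> in points of \<open>V\<close> only or of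
      \<open>\<Omega> - V\<close> only; see \<open>side\<close>.\<close>
    obtain K where K: "compact K" "connected K" "K \<noteq> {}" "L \<subseteq> K" "K \<subseteq> \<Omega>"
      by (rule compact_connected_superset [OF \<Omega> False L(1,2)]) (rule that)
    have "K \<noteq> \<Omega>" using K(1,3) \<Omega>(1) compact_open by blast
    then obtain f where f: "homeomorphic_map ?X ?X f" "f ` K \<inter> K = {}"
      using displ [OF K(1,5)] by (auto simp: displaceable_def)
    obtain k where fk: "homeomorphic_maps ?X ?X f k" using f(1) homeomorphic_map_maps by blast
    have k: "homeomorphic_map ?X ?X k" using fk homeomorphic_maps_map by blast
    have im: "f ` \<Omega> = \<Omega>" "k ` \<Omega> = \<Omega>"
      using homeomorphic_imp_surjective_map [OF f(1)] homeomorphic_imp_surjective_map [OF k] by auto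
    have inv: "k (f x) = x" "f (k x) = x" if "x \<in> \<Omega>" for x
      using fk that by (auto simp: homeomorphic_maps_def)
    have conn_im: "connected (g ` T)" if g: "homeomorphic_map ?X ?X g" and T: "connected T" "T \<subseteq> \<Omega>" for g T
    proof -
      have "continuous_on \<Omega> g"
        using homeomorphic_imp_continuous_map [OF g] by (simp add: continuous_map_in_subtopology)
      then show ?thesis using T connected_continuous_image continuous_on_subset by blast
    qed
    have kK: "k ` K \<inter> K = {}"
    proof (rule equals0I)
      fix y assume y: "y \<in> k ` K \<inter> K"
      then obtain x where x: "x \<in> K" "y = k x" by blast
      then have "f y = x" using inv(2) K(5) by blast
      then show False using f(2) x(1) y by blast
    qed
    have comp: "\<exists>W\<in>components (- K). T \<subseteq> W" if "connected T" "T \<noteq> {}" "T \<inter> K = {}" for T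
      using exists_component_superset [of T "- K"] that by blast
    obtain W1 where W1: "W1 \<in> components (- K)" "f ` K \<subseteq> W1"
      using comp [OF conn_im [OF f(1) K(2,5)]] K(3) f(2) by blast
    obtain W2 where W2: "W2 \<in> components (- K)" "k ` K \<subseteq> W2"
      using comp [OF conn_im [OF k K(2,5)]] K(3) kK by blast
    have side: "W \<inter> \<Omega> \<subseteq> V \<or> W \<inter> \<Omega> \<subseteq> \<Omega> - V" if W: "W \<in> components (- K)" for W
    proof -
      have "connected (W \<inter> \<Omega>)" by (rule connected_component_Int_planar [OF \<Omega> K(1,5) W])
      moreover have WL: "W \<inter> L = {}" using in_components_subset [OF W] K(4) by blast
      then have "W \<inter> \<Omega> \<subseteq> (V - L) \<union> (\<Omega> - V - L)" "(V - L) \<inter> (\<Omega> - V - L) \<inter> (W \<inter> \<Omega>) = {}" by blast+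
      ultimately have "W \<inter> \<Omega> \<subseteq> V - L \<or> (W \<inter> \<Omega>) \<inter> (V - L) = {}"
        using connectedin_clopen_subset [of euclidean "W \<inter> \<Omega>" "V - L" "\<Omega> - V - L"] L(3,4) by simp
      then show ?thesis using WL by blast
    qed
    have endC: "end_set ?X (\<Omega> - V)" using end_set_compl [OF V(1)] by simp
    have finish: "contains_copy E A \<or> contains_copy E (topspace E - A)"
      if C: "end_set ?X C" "bounded_in ?X (C - W)" and W: "W \<in> components (- K)"
        and iso: "E homeomorphic_space subtopology E (\<Lambda> C)" for C W
    proof -
      have C\<Omega>: "C \<subseteq> \<Omega>" using C(1) by (simp add: end_set_def)
      have cl: "clopenin E (\<Lambda> C)" by (rule end_model_clopenin [OF model C(1)])
      show ?thesis
        using side [OF W]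
      proof
        assume "W \<inter> \<Omega> \<subseteq> V"
        then have "bounded_in ?X (C - V)" using C\<Omega> by (intro bounded_in_subset [OF C(2)]) blast
        then have "\<Lambda> C \<subseteq> A" using end_model_subset_iff [OF model C(1) V(1)] V(2) by simp
        then show ?thesis using contains_copy_homeomorphic_space [OF iso cl _ A] by blast
      next
        assume "W \<inter> \<Omega> \<subseteq> \<Omega> - V"
        then have "bounded_in ?X (C - (\<Omega> - V))" using C\<Omega> by (intro bounded_in_subset [OF C(2)]) blast
        then have "\<Lambda> C \<subseteq> \<Lambda> (\<Omega> - V)" using end_model_subset_iff [OF model C(1) endC] by simp
        moreover have "\<Lambda> (\<Omega> - V) \<subseteq> topspace E - A"
          using end_model_compl [OF Haus model V(1)] V(2) by simp
        ultimately show ?thesis using contains_copy_homeomorphic_space [OF iso cl _ A'] by blast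
      qed
    qed
    obtain C where C: "end_set ?X C" "bounded_in ?X (C - W2) \<or> bounded_in ?X (C \<inter> W2)"
      and iso: "\<And>\<Lambda>. end_model ?X E \<Lambda> \<Longrightarrow> E homeomorphic_space subtopology E (\<Lambda> C)"
      using component_copy [OF \<Omega> K(1,2,5) W2(1) curve E] unfolding copy_beside_def by blast
    have C\<Omega>: "C \<subseteq> \<Omega>" using C(1) by (simp add: end_set_def)
    show ?thesis
      using C(2)
    proof
      assume "bounded_in ?X (C - W2)"
      then show ?thesis using finish [OF C(1) _ W2(1) iso [OF model]] by blast
    next
      assume CW: "bounded_in ?X (C \<inter> W2)"
      have kf: "homeomorphic_maps ?X ?X k f" using fk homeomorphic_maps_sym by blast
      \<comment> \<open>The image of \<open>C\<close> under \<open>f\<close> is treated by twisting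
        the end model with \<open>f\<close>; the property of \<open>C\<close> was stated for all
        models for this purpose.\<close>
      have iso': "E homeomorphic_space subtopology E (\<Lambda> (f ` C))"
        by (rule iso [OF end_model_homeomorphic [OF kf model]])
      \<comment> \<open>Removing from a connected set a component of the complement of a connected
        subset leaves a connected set. So \<open>\<Omega> - W2\<close> is connected, and its image
        under \<open>f\<close>, which misses \<open>K\<close>, stays in one component.\<close>
      have "W2 \<inter> \<Omega> \<in> components (\<Omega> - K)"
      proof -
        have W2s: "W2 \<subseteq> - K" using W2(1) by (rule in_components_subset)
        have "k ` K \<subseteq> W2 \<inter> \<Omega>" using W2(2) im(2) K(5) by blast
        then have "W2 \<inter> \<Omega> \<noteq> {}" using K(3) by blast
        moreover have "D = W2 \<inter> \<Omega>" if D: "W2 \<inter> \<Omega> \<subseteq> D" "D \<subseteq> \<Omega> - K" "connected D" for D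
        proof -
          have "W2 \<inter> D \<noteq> {}" using D(1) \<open>W2 \<inter> \<Omega> \<noteq> {}\<close> by blast
          then have "D \<subseteq> W2" using D(2,3) by (intro components_maximal [OF W2(1)]) auto
          then show ?thesis using D by blast
        qed
        ultimately show ?thesis
          unfolding in_components_maximal
          using W2s connected_component_Int_planar [OF \<Omega> K(1,5) W2(1)] by blast
      qed
      from component_diff_connected [OF K(2) \<Omega>(2) K(5) this]
      have "connected (\<Omega> - W2)" by (simp add: Diff_Int_distrib Diff_Int)
      then have "connected (f ` (\<Omega> - W2))" by (intro conn_im [OF f(1)]) auto
      moreover have "f ` (\<Omega> - W2) \<subseteq> - K"
      proof
        fix y assume "y \<in> f ` (\<Omega> - W2)"
        then obtain x where x: "x \<in> \<Omega>" "x \<notin> W2" "y = f x" by blast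
        have "y \<notin> K"
        proof
          assume "y \<in> K"
          then have "k y \<in> W2" using W2(2) by blast
          then show False using x inv(1) by simp
        qed
        then show "y \<in> - K" by simp
      qed
      moreover have "W1 \<inter> f ` (\<Omega> - W2) \<noteq> {}"
      proof -
        have "K \<subseteq> \<Omega> - W2" using K(5) in_components_subset [OF W2(1)] by blast
        then show ?thesis using W1(2) K(3) by blast
      qed
      ultimately have move: "f ` (\<Omega> - W2) \<subseteq> W1" by (intro components_maximal [OF W1(1)])
      have "f ` C - W1 \<subseteq> f ` (C \<inter> W2)"
      proof
        fix y assume y: "y \<in> f ` C - W1"
        then obtain x where x: "x \<in> C" "y = f x" by blast
        have "x \<in> W2" using move x y C\<Omega> by blast
        then show "y \<in> f ` (C \<inter> W2)" using x by blast
      qed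
      then have "bounded_in ?X (f ` C - W1)"
        by (rule bounded_in_subset [OF bounded_in_homeomorphic_image [OF f(1) CW]])
      then show ?thesis
        by (rule finish [OF end_set_homeomorphic_image [OF f(1) C(1)] _ W1(1) iso'])
    qed
  qed
qed

section \<open>From planar manifolds to open subsets of the complex plane\<close>

lemma locally_connected_space_open_planar:
  fixes \<Omega> :: "complex set"
  assumes "open \<Omega>"
  shows "locally_connected_space (top_of_set \<Omega>)"
  unfolding locally_connected_space_def neighbourhood_base_of
proof (intro allI impI, elim conjE)
  fix W x assume "openin (top_of_set \<Omega>) W" "x \<in> W"
  then have W: "open W" "W \<subseteq> \<Omega>" using openin_open_eq [OF assms] by blast+
  then obtain e where e: "0 < e" "ball x e \<subseteq> W" using \<open>x \<in> W\<close> openE by blast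
  have "openin (top_of_set \<Omega>) (ball x e)"
    using openin_open_eq [OF assms] e(2) W(2) by blast
  moreover have "connectedin (top_of_set \<Omega>) (ball x e)"
    using e(2) W(2) by (simp add: connectedin_subtopology)
  ultimately show "\<exists>U V. openin (top_of_set \<Omega>) U \<and> connectedin (top_of_set \<Omega>) V \<and> x \<in> U \<and> U \<subseteq> V \<and> V \<subseteq> W"
    using e by (intro exI [of _ "ball x e"]) simp
qed

lemma exhaustion_open_planar:
  fixes \<Omega> :: "complex set"
  assumes "open \<Omega>"
  shows "\<exists>K. exhaustion (top_of_set \<Omega>) K"
proof -
  obtain K :: "nat \<Rightarrow> complex set" where K: "\<And>n. compact (K n)" "\<And>n. K n \<subseteq> \<Omega>"
    "\<And>n. K n \<subseteq> interior (K (Suc n))" "\<Union>(range K) = \<Omega>"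
    "\<And>L. compact L \<Longrightarrow> L \<subseteq> \<Omega> \<Longrightarrow> \<exists>N. \<forall>n\<ge>N. L \<subseteq> K n"
    by (rule open_Union_compact_subsets [OF assms]) (rule that)
  have "\<exists>U. openin (top_of_set \<Omega>) U \<and> K n \<subseteq> U \<and> U \<subseteq> K (Suc n)" for n
  proof (intro exI conjI)
    show "interior (K (Suc n)) \<subseteq> K (Suc n)" by (rule interior_subset)
    then have "interior (K (Suc n)) \<subseteq> \<Omega>" using K(2) by blast
    then show "openin (top_of_set \<Omega>) (interior (K (Suc n)))"
      using openin_open_eq [OF assms] by blast
  qed (rule K(3))
  moreover have "\<exists>n. L \<subseteq> K n" if "compactin (top_of_set \<Omega>) L" for L
  proof -
    have "compact L" "L \<subseteq> \<Omega>" using that by (simp_all add: compactin_top_of_set)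
    from K(5) [OF this] obtain N where "\<forall>n\<ge>N. L \<subseteq> K n" ..
    then have "L \<subseteq> K N" by simp
    then show ?thesis by (rule exI)
  qed
  moreover have "compactin (top_of_set \<Omega>) (K n)" for n
    using K(1,2) by (simp add: compactin_top_of_set)
  ultimately have "exhaustion (top_of_set \<Omega>) K" by (simp add: exhaustion_def)
  then show ?thesis by blast
qed

lemma exhaustion_homeomorphic:
  assumes hk: "homeomorphic_maps X Y h k" and K: "exhaustion X K"
  shows "exhaustion Y (\<lambda>n. h ` K n)"
proof -
  have h: "homeomorphic_map X Y h" and k: "homeomorphic_map Y X k"
    using hk homeomorphic_maps_map by blast+
  have kh: "homeomorphic_maps Y X k h" using hk homeomorphic_maps_sym by blast
  have cpt: "compactin Y (h ` L)" if "compactin X L" for L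
    using that homeomorphic_imp_continuous_map [OF h] by (rule image_compactin)
  have "\<exists>U. openin Y U \<and> h ` K n \<subseteq> U \<and> U \<subseteq> h ` K (Suc n)" for n
  proof -
    obtain U where U: "openin X U" "K n \<subseteq> U" "U \<subseteq> K (Suc n)"
      using K unfolding exhaustion_def by blast
    have "openin Y (h ` U)" using U(1) homeomorphic_map_openness_eq [OF h] by blast
    then show ?thesis using U(2,3) by (intro exI [of _ "h ` U"]) (simp add: image_mono)
  qed
  moreover have "\<exists>n. L \<subseteq> h ` K n" if L: "compactin Y L" for L
  proof -
    have "compactin X (k ` L)"
      using L homeomorphic_imp_continuous_map [OF k] by (rule image_compactin)
    then obtain n where n: "k ` L \<subseteq> K n" using K unfolding exhaustion_def by blast
    have "h ` k ` L = L"
      using compactin_subset_topspace [OF L] by (rule homeomorphic_maps_image_inverse [OF kh])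
    then have "L \<subseteq> h ` K n" using image_mono [OF n, of h] by simp
    then show ?thesis by blast
  qed
  moreover have "compactin Y (h ` K n)" for n
    using K by (intro cpt) (simp add: exhaustion_def)
  ultimately show ?thesis by (simp add: exhaustion_def)
qed

lemma displaceable_homeomorphic:
  assumes hk: "homeomorphic_maps X Y h k" and K: "K \<subseteq> topspace Y" and D: "displaceable X (k ` K)"
  shows "displaceable Y K"
proof -
  have h: "homeomorphic_map X Y h" and k: "homeomorphic_map Y X k"
    using hk homeomorphic_maps_map by blast+
  obtain f where f: "homeomorphic_map X X f" "f ` k ` K \<inter> k ` K = {}"
    using D by (auto simp: displaceable_def)
  have "homeomorphic_map Y Y (h \<circ> (f \<circ> k))"
    by (intro homeomorphic_map_compose [OF homeomorphic_map_compose [OF k f(1)] h])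
  moreover have "(h \<circ> (f \<circ> k)) ` K \<inter> K = {}"
  proof (rule equals0I)
    fix y assume y: "y \<in> (h \<circ> (f \<circ> k)) ` K \<inter> K"
    then obtain x where x: "x \<in> K" "y = h (f (k x))" by auto
    have "k x \<in> topspace X"
      using x(1) K homeomorphic_imp_surjective_map [OF k] by blast
    then have "f (k x) \<in> topspace X" using homeomorphic_imp_surjective_map [OF f(1)] by blast
    then have "k y = f (k x)" using hk x(2) by (simp add: homeomorphic_maps_def)
    moreover have "k y \<in> k ` K" "f (k x) \<in> f ` k ` K" using x(1) y by blast+
    ultimately show False using f(2) by auto
  qed
  ultimately show ?thesis unfolding displaceable_def by blast
qed

lemma planar_homeomorphic_complex:
  assumes "planar M"
  obtains \<Omega> :: "complex set" where "open \<Omega>" "M homeomorphic_space top_of_set \<Omega>"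
proof -
  obtain U :: "(real^2) set" where U: "open U" "M homeomorphic_space top_of_set U"
    using assms by (auto simp: planar_def)
  define f :: "real^2 \<Rightarrow> complex" where "f = (\<lambda>v. Complex (v $ 1) (v $ 2))"
  define g :: "complex \<Rightarrow> real^2" where "g = (\<lambda>z. \<chi> i. if i = 1 then Re z else Im z)"
  have gf: "g (f v) = v" for v by (simp add: f_def g_def vec_eq_iff forall_2)
  have fg: "f (g z) = z" for z by (simp add: f_def g_def complex_eq_iff)
  have cf: "continuous_on S f" for S
    unfolding f_def by (intro continuous_on_Complex continuous_intros)
  have cg: "continuous_on S g" for S
    unfolding g_def
  proof (rule continuous_on_vec_lambda)
    fix i :: 2
    show "continuous_on S (\<lambda>z. if i = 1 then Re z else Im z)"
      by (cases "i = 1") (simp_all add: continuous_on_Re continuous_on_Im continuous_on_id)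
  qed
  have "f ` U = g -` U"
  proof
    show "f ` U \<subseteq> g -` U" using gf by auto
    show "g -` U \<subseteq> f ` U"
    proof
      fix z assume "z \<in> g -` U"
      then have "f (g z) \<in> f ` U" by simp
      then show "z \<in> f ` U" by (simp add: fg)
    qed
  qed
  then have "open (f ` U)" using open_vimage [OF U(1) cg] by simp
  moreover have "homeomorphism U (f ` U) f g"
    by (rule homeomorphismI) (use cf cg gf fg in auto)
  then have "top_of_set U homeomorphic_space top_of_set (f ` U)"
    by (intro homeomorphic_maps_imp_homeomorphic_space [OF homeomorphic_maps_top_of_set])
  ultimately show thesis using that U(2) homeomorphic_space_trans by blast
qed

theorem corollary2p9:
  fixes E :: "'a topology"
  assumes "stone_space E"
    and "second_countable E"
    and "uniquely_self_similar_stone TYPE('m) E"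
  shows "coarsely_bounded TYPE('x) (homeo_group E) (compact_open_topology E)"
proof -
  obtain M :: "'m topology" where M: "planar M" "self_similar M" "E homeomorphic_space ends_space M"
    using assms(3) by (auto simp: uniquely_self_similar_stone_def uniquely_self_similar_def)
  obtain \<Omega> :: "complex set" where \<Omega>: "open \<Omega>" "M homeomorphic_space top_of_set \<Omega>"
    by (rule planar_homeomorphic_complex [OF M(1)]) (rule that)
  obtain h k where hk: "homeomorphic_maps M (top_of_set \<Omega>) h k"
    using \<Omega>(2) by (auto simp: homeomorphic_space_def)
  have kh: "homeomorphic_maps (top_of_set \<Omega>) M k h" using hk homeomorphic_maps_sym by blast
  have conM: "connected_space M" "Hausdorff_space M"
    using M(2) by (auto simp: self_similar_def two_manifold_def)
  then have con: "connected \<Omega>"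
    using homeomorphic_connected_space [OF \<Omega>(2)] connectedin_topspace [of "top_of_set \<Omega>"]
    by (simp add: connectedin_subtopology)
  have "locally_connected_space M"
    using homeomorphic_locally_connected_space [OF \<Omega>(2)] locally_connected_space_open_planar [OF \<Omega>(1)] by simp
  moreover obtain K where K: "exhaustion M K"
    using exhaustion_open_planar [OF \<Omega>(1)] exhaustion_homeomorphic [OF kh] by blast
  \<comment> \<open>Compactness of the space of ends is inherited from the Stone space
    \<open>E\<close>.\<close>
  moreover have "compact_space (ends_space M)"
    using homeomorphic_compact_space [OF M(3)] assms(1) by (simp add: stone_space_def)
  ultimately have "end_model M (ends_space M) (ends_in M)"
    by (intro end_model_ends_space [OF conM])
  moreover obtain u v where "homeomorphic_maps (ends_space M) E u v"
    using M(3) homeomorphic_space_sym unfolding homeomorphic_space_def by blast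
  ultimately have "end_model M E (\<lambda>V. u ` ends_in M V)"
    by (rule end_model_homeomorphic_space)
  then have model: "end_model (top_of_set \<Omega>) E (\<lambda>V. u ` ends_in M (k ` V))"
    by (rule end_model_homeomorphic [OF hk])
  have "curve_property M" using M(2) by (simp add: self_similar_def curve_property_def)
  then have curve: "curve_property (top_of_set \<Omega>)" by (rule curve_property_homeomorphic [OF hk])
  have displ: "displaceable (top_of_set \<Omega>) K" if K: "compact K" "K \<subseteq> \<Omega>" "K \<noteq> \<Omega>" for K
  proof (rule displaceable_homeomorphic [OF hk])
    have k: "homeomorphic_map (top_of_set \<Omega>) M k" using kh homeomorphic_maps_map by blast
    have hkK: "h ` k ` K = K" by (rule homeomorphic_maps_image_inverse [OF kh]) (simp add: K)
    have "compactin M (k ` K)"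
      using K homeomorphic_imp_continuous_map [OF k] by (intro image_compactin) (auto simp: compactin_top_of_set)
    moreover have "k ` K \<noteq> topspace M"
    proof
      assume "k ` K = topspace M"
      then have "h ` topspace M = K" using hkK by simp
      moreover have "homeomorphic_map M (top_of_set \<Omega>) h" using hk homeomorphic_maps_map by blast
      ultimately show False using K(3) homeomorphic_imp_surjective_map by fastforce
    qed
    ultimately show "displaceable M (k ` K)" using M(2) by (simp add: self_similar_def)
  qed (simp add: K)
  have "copy_dichotomy E"
    by (rule planar_copy_dichotomy [OF \<Omega>(1) con assms(1) model curve displ])
  then show ?thesis
    using assms(1) unfolding stone_space_def by (intro coarsely_bounded_homeo_group) auto
qed

end
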